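(* Let $S$ be a polynomial ring in finitely many variables over a field $K$ and let $I\subset S$ be an ideal minimally generated by at least two quadratic binomials. Suppose that (i) $I$ is prime, (ii) there is a monomial order on $S$ with respect to which the initial ideal of $I$ is generated by squarefree quadratic monomials, and (iii) $I$ has linear resolution. Then there is an integer $n\geq 3$ such that $$\mu(I)=\mu(J)=\binom{n}{2},$$ where $J=(x_iy_j-x_jy_i : 1\leq i<j\leq n)\subset K[x_1,\ldots,x_n,y_1,\ldots,y_n]$.
   Context: $S$ has the standard grading. A quadratic binomial is a polynomial $u-v$ with $u\neq v$ monomials of degree $2$. An ideal generated in degree $2$ has linear resolution if its minimal graded free resolution is linear, i.e. its Castelnuovo--Mumford regularity equals $2$. For a graded ideal $L$, $\mu(L)$ denotes the number of elements in a minimal homogeneous system of generators of $L$. *)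

theory Defs
  imports "HOL-Algebra.Ideal" "HOL-Library.Poly_Mapping"
begin

text \<open>
  Monomials are finitely supported exponent vectors and polynomials are finitely supported
  families of coefficients. The ambient type has one variable for every element of \<open>'v\<close>;
  the ring \<open>K[x\<^sub>v : v \<in> X]\<close> is the carrier-based ring of the polynomials that
  only involve variables from \<open>X\<close>, so that rings in different numbers of variables can
  occur in one statement.
\<close>

type_synonym 'v mon = "'v \<Rightarrow>\<^sub>0 nat"
type_synonym ('v, 'k) pol = "'v mon \<Rightarrow>\<^sub>0 'k"

definition monomials :: "'v set \<Rightarrow> 'v mon set" where
  "monomials X = {u. Poly_Mapping.keys u \<subseteq> X}"

definition mdeg :: "'v mon \<Rightarrow> nat" where
  "mdeg u = (\<Sum>v\<in>Poly_Mapping.keys u. Poly_Mapping.lookup u v)"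

definition mono_pol :: "'v mon \<Rightarrow> ('v, 'k::field) pol" where
  "mono_pol u = Poly_Mapping.single u 1"

definition var :: "'v \<Rightarrow> ('v, 'k::field) pol" where
  "var v = mono_pol (Poly_Mapping.single v 1)"

definition poly_ring :: "'v set \<Rightarrow> ('v, 'k::field) pol ring" where
  "poly_ring X = \<lparr>carrier = {p. Poly_Mapping.keys p \<subseteq> monomials X},
     monoid.mult = (*), one = 1, zero = 0, add = (+)\<rparr>"

definition homogeneous :: "nat \<Rightarrow> ('v, 'k::field) pol \<Rightarrow> bool" where
  "homogeneous e p \<longleftrightarrow> (\<forall>u\<in>Poly_Mapping.keys p. mdeg u = e)"

definition quadratic_binomial :: "'v set \<Rightarrow> ('v, 'k::field) pol \<Rightarrow> bool" where
  "quadratic_binomial X p \<longleftrightarrow> (\<exists>u\<in>monomials X. \<exists>v\<in>monomials X.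
     u \<noteq> v \<and> mdeg u = 2 \<and> mdeg v = 2 \<and> p = mono_pol u - mono_pol v)"

definition minimal_generators :: "('a, 'm) ring_scheme \<Rightarrow> 'a set \<Rightarrow> 'a set \<Rightarrow> bool" where
  "minimal_generators R B I \<longleftrightarrow>
     B \<subseteq> carrier R \<and> I = Idl\<^bsub>R\<^esub> B \<and> (\<forall>C. C \<subset> B \<longrightarrow> Idl\<^bsub>R\<^esub> C \<noteq> I)"

text \<open>The following number is only meaningful for graded ideals.\<close>

definition mu :: "'v set \<Rightarrow> ('v, 'k::field) pol set \<Rightarrow> nat" where
  "mu X L = (THE k. \<exists>B. finite B \<and> (\<forall>b\<in>B. \<exists>e. homogeneous e b) \<and>
     minimal_generators (poly_ring X) B L \<and> card B = k)"

text \<open>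
  Monomial orders are sets of pairs \<open>(u, v)\<close> read as \<open>u \<le> v\<close>.
\<close>

definition monomial_order :: "'v set \<Rightarrow> 'v mon rel \<Rightarrow> bool" where
  "monomial_order X r \<longleftrightarrow> linear_order_on (monomials X) r \<and>
     (\<forall>u\<in>monomials X. (0, u) \<in> r) \<and>
     (\<forall>u v w. (u, v) \<in> r \<longrightarrow> w \<in> monomials X \<longrightarrow> (u + w, v + w) \<in> r)"

definition lead_mon :: "'v mon rel \<Rightarrow> ('v, 'k::field) pol \<Rightarrow> 'v mon" where
  "lead_mon r p =
     (THE u. u \<in> Poly_Mapping.keys p \<and> (\<forall>v\<in>Poly_Mapping.keys p. (v, u) \<in> r))"

definition initial_ideal ::
  "'v set \<Rightarrow> 'v mon rel \<Rightarrow> ('v, 'k::field) pol set \<Rightarrow> ('v, 'k) pol set" where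
  "initial_ideal X r I = Idl\<^bsub>poly_ring X\<^esub> {mono_pol (lead_mon r f) | f. f \<in> I \<and> f \<noteq> 0}"

definition squarefree_monomial :: "'v mon \<Rightarrow> bool" where
  "squarefree_monomial u \<longleftrightarrow> (\<forall>v. Poly_Mapping.lookup u v \<le> 1)"

text \<open>
  A graded free resolution \<open>\<dots> \<rightarrow> F\<^sub>1 \<rightarrow> F\<^sub>0 \<rightarrow> I \<rightarrow> 0\<close> over \<open>S = K[X]\<close> is given by matrices.
  The module \<open>F\<^sub>i\<close> is the direct sum of the \<open>S(-d i j)\<close> for \<open>j < b i\<close>; its elements are the
  coordinate functions below, whose values at indices \<open>j \<ge> b i\<close> are irrelevant. The basis
  of \<open>F\<^sub>0\<close> is sent to \<open>g 0, g 1, \<dots>\<close> and \<open>phi i\<close> is the matrix of \<open>F\<^sub>i\<^sub>+\<^sub>1 \<rightarrow> F\<^sub>i\<close> (row, column).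
  The modules \<open>F\<^sub>i\<close> may be zero from some point on, namely when \<open>b i = 0\<close>.
  Shifts are natural numbers, as is automatic for a minimal resolution of an ideal.
\<close>

definition free_elems :: "'v set \<Rightarrow> nat \<Rightarrow> (nat \<Rightarrow> ('v, 'k::field) pol) set" where
  "free_elems X n = {w. \<forall>j<n. w j \<in> carrier (poly_ring X)}"

definition graded_free_resolution ::
  "'v set \<Rightarrow> ('v, 'k::field) pol set \<Rightarrow> (nat \<Rightarrow> nat) \<Rightarrow> (nat \<Rightarrow> nat \<Rightarrow> nat) \<Rightarrow>
   (nat \<Rightarrow> ('v, 'k) pol) \<Rightarrow> (nat \<Rightarrow> nat \<Rightarrow> nat \<Rightarrow> ('v, 'k) pol) \<Rightarrow> bool" where
  "graded_free_resolution X I b d g phi \<longleftrightarrow>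
     \<comment> \<open>maps of graded \<open>S\<close>-modules of degree \<open>0\<close>\<close>
     (\<forall>j<b 0. g j \<in> carrier (poly_ring X) \<and> homogeneous (d 0 j) (g j)) \<and>
     (\<forall>i. \<forall>j<b i. \<forall>k<b (Suc i). phi i j k \<in> carrier (poly_ring X) \<and>
        (\<forall>u\<in>Poly_Mapping.keys (phi i j k). mdeg u + d i j = d (Suc i) k)) \<and>
     \<comment> \<open>exactness at \<open>I\<close>\<close>
     I = {\<Sum>j<b 0. g j * w j | w. w \<in> free_elems X (b 0)} \<and>
     \<comment> \<open>exactness at \<open>F\<^sub>0\<close>: kernel = image\<close>
     (\<forall>w\<in>free_elems X (b 0). (\<Sum>j<b 0. g j * w j) = 0 \<longleftrightarrow>
        (\<exists>z\<in>free_elems X (b 1). \<forall>j<b 0. w j = (\<Sum>k<b 1. phi 0 j k * z k))) \<and>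
     \<comment> \<open>exactness at \<open>F\<^sub>i\<^sub>+\<^sub>1\<close>: kernel = image\<close>
     (\<forall>i. \<forall>w\<in>free_elems X (b (Suc i)).
        (\<forall>j<b i. (\<Sum>k<b (Suc i). phi i j k * w k) = 0) \<longleftrightarrow>
        (\<exists>z\<in>free_elems X (b (Suc (Suc i))).
           \<forall>k<b (Suc i). w k = (\<Sum>l<b (Suc (Suc i)). phi (Suc i) k l * z l)))"

text \<open>
  Minimality: the differentials map \<open>F\<^sub>i\<^sub>+\<^sub>1\<close> into \<open>\<mm> F\<^sub>i\<close>, where \<open>\<mm>\<close> is generated by the variables.
\<close>

definition minimal_graded_free_resolution ::
  "'v set \<Rightarrow> ('v, 'k::field) pol set \<Rightarrow> (nat \<Rightarrow> nat) \<Rightarrow> (nat \<Rightarrow> nat \<Rightarrow> nat) \<Rightarrow>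
   (nat \<Rightarrow> ('v, 'k) pol) \<Rightarrow> (nat \<Rightarrow> nat \<Rightarrow> nat \<Rightarrow> ('v, 'k) pol) \<Rightarrow> bool" where
  "minimal_graded_free_resolution X I b d g phi \<longleftrightarrow>
     graded_free_resolution X I b d g phi \<and>
     (\<forall>i. \<forall>j<b i. \<forall>k<b (Suc i). phi i j k \<in> Idl\<^bsub>poly_ring X\<^esub> (var ` X))"

text \<open>
  For an ideal generated in degree \<open>q\<close>. Minimal graded free resolutions are unique up to
  isomorphism, so it does not matter which one is taken.
\<close>

definition linear_resolution :: "'v set \<Rightarrow> nat \<Rightarrow> ('v, 'k::field) pol set \<Rightarrow> bool" where
  "linear_resolution X q I \<longleftrightarrow> (\<exists>b d g phi. minimal_graded_free_resolution X I b d g phi \<and>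
     (\<forall>i. \<forall>j<b i. d i j = q + i))"

text \<open>
  The variables \<open>x\<^sub>i\<close> and \<open>y\<^sub>i\<close> are indexed by \<open>Inl i\<close> and \<open>Inr i\<close>.
\<close>

definition xy_vars :: "nat \<Rightarrow> (nat + nat) set" where
  "xy_vars n = {1..n} <+> {1..n}"

definition minors_ideal :: "nat \<Rightarrow> (nat + nat, 'k::field) pol set" where
  "minors_ideal n = Idl\<^bsub>poly_ring (xy_vars n)\<^esub>
     {var (Inl i) * var (Inr j) - var (Inl j) * var (Inr i) | i j. 1 \<le> i \<and> i < j \<and> j \<le> n}"

text \<open>
  Hence the predicate \<^const>\<open>primeideal\<close>, which includes \<^const>\<open>cring\<close>,
  has its usual meaning for polynomial rings.
\<close>

lemma cring_poly_ring: "cring (poly_ring X :: ('v, 'k::field) pol ring)"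
proof -
  have add: "Poly_Mapping.keys (p + q) \<subseteq> monomials X"
    if "Poly_Mapping.keys p \<subseteq> monomials X" "Poly_Mapping.keys q \<subseteq> monomials X"
    for p q :: "('v, 'k) pol"
    using that Poly_Mapping.keys_add[of p q] by blast
  have mult: "Poly_Mapping.keys (p * q) \<subseteq> monomials X"
    if "Poly_Mapping.keys p \<subseteq> monomials X" "Poly_Mapping.keys q \<subseteq> monomials X"
    for p q :: "('v, 'k) pol"
  proof
    fix u assume "u \<in> Poly_Mapping.keys (p * q)"
    then obtain a c where u: "u = a + c" "a \<in> Poly_Mapping.keys p" "c \<in> Poly_Mapping.keys q"
      using keys_mult[of p q] by blast
    then show "u \<in> monomials X"
      using that Poly_Mapping.keys_add[of a c] unfolding monomials_def by blast
  qed
  have zero: "0 \<in> monomials X"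
    by (simp add: monomials_def)
  have one: "Poly_Mapping.keys (1 :: ('v, 'k) pol) \<subseteq> monomials X"
    by (simp add: monomials_def)
  have neg: "\<exists>y. Poly_Mapping.keys y \<subseteq> monomials X \<and> p + y = 0"
    if "Poly_Mapping.keys p \<subseteq> monomials X" for p :: "('v, 'k) pol"
    using that by (intro exI[of _ "- p"]) simp
  show ?thesis
    by (intro cringI abelian_groupI comm_monoidI)
       (simp_all add: poly_ring_def add mult zero one neg algebra_simps)
qed

end

theory Submission
  imports Defs "HOL-Library.Function_Algebras" "HOL-Library.Multiset"
    "HOL-Computational_Algebra.Polynomial_FPS"
begin

text \<open>
  As \<open>I\<close> is a prime binomial ideal, \<open>S/I\<close> is the algebra of a cancellative monoid, and by the
  hypothesis on the initial ideal every element of this monoid has a unique representation as a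
  monomial supported on a clique of a graph \<open>H\<close> on the variables. The cones over the maximal cliques
  therefore triangulate a convex cone. Hence all maximal cliques have the same size \<open>d\<close>, and \<open>H\<close> stays
  connected when at most \<open>d - 2\<close> vertices are removed.

  Let \<open>c = card X - d\<close>. The connectedness kills the linear strand of the initial ideal, and so that of
  \<open>I\<close>, in homological degrees beyond \<open>c\<close>. If the resolution of \<open>I\<close> is linear, the numerator of the
  Hilbert series of \<open>S/I\<close> over \<open>(1 - t)\<^sup>N\<close>, where \<open>N = card X\<close>, thus has degree at most \<open>c + 1\<close>. This
  numerator is \<open>(1 - t)\<^sup>c h(t)\<close> with a polynomial \<open>h\<close>, so \<open>h = 1 + c t\<close>, and the coefficient
  of \<open>t\<^sup>2\<close> shows that \<open>I\<close> has \<open>c (c + 1) / 2\<close> minimal generators.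
\<close>

section \<open>Monoids with standard forms supported on cliques\<close>

text \<open>Primality makes the monoid cancellative, and cancellation gives every element integer
  coordinates with respect to each maximal clique, which serve as the ambient space of the cone.
  Only rational points of a segment correspond to monomials and have standard forms, so real points
  are reached by closedness and density. The bound \<open>d - 2\<close> fits Hochster's formula:
  linear syzygies of the initial ideal in homological degree \<open>i\<close> sit in squarefree
  multidegrees with support \<open>W\<close> of size \<open>i + 2\<close>, and are measured by the
  reduced cohomology in degree 0 of the graph induced on \<open>W\<close>. For
  \<open>i \<ge> c\<close> at most \<open>d - 2\<close> vertices lie outside \<open>W\<close>. The
  passage from \<open>I\<close> to its initial ideal is made on cycles: a generator of the
  \<open>i\<close>-th module yields a nonzero alternating Koszul cycle with values in the quadrics
  of \<open>I\<close>, whose part of largest multidegree involves leading monomials only. Finally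
  \<open>c (c + 1) / 2\<close> is \<open>(c + 1) choose 2\<close>, so the \<open>n\<close> of the
  statement is \<open>c + 1\<close>; the ideal of minors for this \<open>n\<close> has codimension
  \<open>c\<close> as well.\<close>

abbreviation "lookup \<equiv> Poly_Mapping.lookup"
abbreviation "keys \<equiv> Poly_Mapping.keys"
abbreviation "single \<equiv> Poly_Mapping.single"

lemma zero_in_monomials [simp]: "0 \<in> monomials X"
  by (simp add: monomials_def)

lemma keys_add_nat: "keys (u + v :: 'v mon) = keys u \<union> keys v"
  by (auto simp: in_keys_iff lookup_add)

lemma add_in_monomials [simp]: "u + v \<in> monomials X \<longleftrightarrow> u \<in> monomials X \<and> v \<in> monomials X"
  by (simp add: monomials_def keys_add_nat)

lemma single_in_monomials [simp]: "single x (n::nat) \<in> monomials X \<longleftrightarrow> n = 0 \<or> x \<in> X"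
  by (auto simp: monomials_def)

section \<open>Dickson's lemma for monomials in finitely many variables\<close>

lemma nat_seq_mono_subseq:
  fixes f :: "nat \<Rightarrow> nat"
  shows "\<exists>r :: nat \<Rightarrow> nat. strict_mono r \<and> mono (\<lambda>n. f (r n))"
proof -
  obtain g :: "nat \<Rightarrow> nat" where g: "strict_mono g" "monoseq (\<lambda>n. f (g n))"
    using seq_monosub by blast
  from g(2) show ?thesis unfolding monoseq_def
  proof
    assume "\<forall>m. \<forall>n\<ge>m. f (g m) \<le> f (g n)"
    then show ?thesis using g(1) by (intro exI[of _ g]) (auto simp: mono_def)
  next
    assume dec: "\<forall>m. \<forall>n\<ge>m. f (g n) \<le> f (g m)"
    \<comment> \<open>A nonincreasing subsequence is constant from the point where it attains its
      least value.\<close>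
    define l where "l = (LEAST x. x \<in> range (\<lambda>n. f (g n)))"
    have "l \<in> range (\<lambda>n. f (g n))" unfolding l_def by (rule LeastI) blast
    then obtain m where m: "l = f (g m)" by blast
    have "f (g (n + m)) = l" for n
    proof (rule antisym)
      show "f (g (n + m)) \<le> l" using dec m by simp
      show "l \<le> f (g (n + m))" unfolding l_def by (rule Least_le) blast
    qed
    moreover have "strict_mono (\<lambda>n. g (n + m))"
      using g(1) by (simp add: strict_mono_def)
    ultimately show ?thesis by (intro exI[of _ "\<lambda>n. g (n + m)"]) (simp add: mono_def)
  qed
qed

lemma seq_mono_subseq_finite:
  fixes a :: "nat \<Rightarrow> 'v \<Rightarrow> nat"
  assumes "finite X"
  shows "\<exists>r :: nat \<Rightarrow> nat. strict_mono r \<and> (\<forall>v\<in>X. mono (\<lambda>n. a (r n) v))"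
  using assms
proof induction
  case empty
  show ?case by (intro exI[of _ id]) (simp add: strict_mono_def)
next
  case (insert x X)
  then obtain r :: "nat \<Rightarrow> nat" where r: "strict_mono r" "\<forall>v\<in>X. mono (\<lambda>n. a (r n) v)" by blast
  obtain q :: "nat \<Rightarrow> nat" where q: "strict_mono q" "mono (\<lambda>n. a (r (q n)) x)"
    using nat_seq_mono_subseq[of "\<lambda>n. a (r n) x"] by blast
  have "mono q" using q(1) by (rule strict_mono_mono)
  then show ?case using r q
    by (intro exI[of _ "r \<circ> q"]) (auto simp: strict_mono_def mono_def)
qed

text \<open>Along a subsequence on which every exponent is nondecreasing, earlier members divide
  later ones; outside \<open>X\<close> all exponents vanish.\<close>

lemma dickson:
  assumes "finite X" "\<And>n::nat. a n \<in> monomials X"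
  shows "\<exists>i j w. i < j \<and> w \<in> monomials X \<and> a j = a i + w"
proof -
  obtain r :: "nat \<Rightarrow> nat" where r: "strict_mono r" "\<forall>v\<in>X. mono (\<lambda>n. lookup (a (r n)) v)"
    using seq_mono_subseq_finite[OF assms(1), of "\<lambda>n. lookup (a n)"] by blast
  have le: "lookup (a (r 0)) v \<le> lookup (a (r 1)) v" for v
  proof (cases "v \<in> X")
    case True then show ?thesis using r(2) by (auto simp: mono_def)
  next
    case False
    then have "v \<notin> keys (a (r 0))" using assms(2)[of "r 0"] by (auto simp: monomials_def)
    then show ?thesis by (simp add: in_keys_iff)
  qed
  have "a (r 1) = a (r 0) + (a (r 1) - a (r 0))"
    by (rule poly_mapping_eqI) (use le in \<open>simp add: lookup_add lookup_minus\<close>)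
  moreover have "a (r 1) - a (r 0) \<in> monomials X"
    using assms(2)[of "r 1"] by (metis calculation add_in_monomials)
  moreover have "r 0 < r 1" using r(1) by (simp add: strict_mono_def)
  ultimately show ?thesis by blast
qed

lemma sum_singles: "(\<Sum>x\<in>keys u. single x (lookup u x)) = u"
  by (rule poly_mapping_eqI)
    (auto simp: lookup_sum lookup_single when_def in_keys_iff if_distrib cong: if_cong)

text \<open>A dual system: each functional kills the span of all vectors but its own. It serves for
  unit vectors, for normal form binomials, for bases of free modules and for minors.\<close>

lemma (in vector_space) independent_functionals:
  fixes L :: "'i \<Rightarrow> 'b \<Rightarrow> 'a"
  assumes add: "\<And>i x y. i \<in> A \<Longrightarrow> L i (x + y) = L i x + L i y"
    and scale: "\<And>i c x. i \<in> A \<Longrightarrow> L i (c *s x) = c * L i x"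
    and diag: "\<And>i. i \<in> A \<Longrightarrow> L i (p i) \<noteq> 0"
    and off: "\<And>i j. i \<in> A \<Longrightarrow> j \<in> A \<Longrightarrow> i \<noteq> j \<Longrightarrow> L i (p j) = 0"
  shows "inj_on p A" "independent (p ` A)"
proof -
  show inj: "inj_on p A"
    using diag off by (metis inj_onI)
  show "independent (p ` A)"
    unfolding dependent_def
  proof (clarsimp)
    fix i assume i: "i \<in> A" and s: "p i \<in> span (p ` A - {p i})"
    have "L i 0 = 0" using scale[OF i, of 0 0] by simp
    then have "subspace {x. L i x = 0}"
      using add[OF i] scale[OF i] by (simp add: subspace_def)
    moreover have "p ` A - {p i} \<subseteq> {x. L i x = 0}" using off i by auto
    ultimately have "L i (p i) = 0" using s span_minimal by blast
    then show False using diag i by blast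
  qed
qed

interpretation rv: vector_space "\<lambda>(c::real) (f::'v \<Rightarrow> real) x. c * f x"
  by unfold_locales (auto simp: fun_eq_iff algebra_simps)

definition clique :: "'v set \<Rightarrow> ('v \<Rightarrow> 'v \<Rightarrow> bool) \<Rightarrow> 'v set \<Rightarrow> bool" where
  "clique X adj C \<longleftrightarrow> C \<subseteq> X \<and> (\<forall>y\<in>C. \<forall>z\<in>C. y \<noteq> z \<longrightarrow> adj y z)"

lemma clique_subset: "clique X adj C \<Longrightarrow> D \<subseteq> C \<Longrightarrow> clique X adj D"
  unfolding clique_def by blast

definition power_mon :: "'v set \<Rightarrow> nat \<Rightarrow> 'v mon" where
  "power_mon F k = (\<Sum>x\<in>F. single x k)"

lemma lookup_power_mon: "finite F \<Longrightarrow> lookup (power_mon F k) x = (if x \<in> F then k else 0)"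
  by (auto simp: power_mon_def lookup_sum lookup_single when_def sum.delta)

lemma power_mon_add: "power_mon F (k + l) = power_mon F k + power_mon F l"
  by (simp add: power_mon_def single_add sum.distrib)

lemma keys_power_mon: "finite F \<Longrightarrow> keys (power_mon F k) = (if k = 0 then {} else F)"
  by (cases "k = 0") (simp add: power_mon_def, auto simp: in_keys_iff lookup_power_mon split: if_splits)

text \<open>The classes of \<open>eqv\<close> form a cancellative commutative monoid, and
  \<open>std_ex\<close> and \<open>std_unique\<close> say that the relative interiors of the cones
  over cliques partition it. These axioms are what the geometric argument extracts from the ideal
  and the monomial order.\<close>

locale flag_monoid =
  fixes X :: "'v set" and eqv :: "'v mon \<Rightarrow> 'v mon \<Rightarrow> bool" and adj :: "'v \<Rightarrow> 'v \<Rightarrow> bool"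
  assumes fin: "finite X"
    and eqv_refl: "u \<in> monomials X \<Longrightarrow> eqv u u"
    and eqv_sym: "eqv u v \<Longrightarrow> eqv v u"
    and eqv_trans [trans]: "eqv u v \<Longrightarrow> eqv v w \<Longrightarrow> eqv u w"
    and eqv_mon: "eqv u v \<Longrightarrow> u \<in> monomials X"
    and eqv_add: "eqv u v \<Longrightarrow> w \<in> monomials X \<Longrightarrow> eqv (u + w) (v + w)"
    and eqv_cancel: "eqv (u + w) (v + w) \<Longrightarrow> eqv u v"
    and adj_sym: "adj y z \<Longrightarrow> adj z y"
    and std_ex: "u \<in> monomials X \<Longrightarrow> \<exists>s. eqv u s \<and> clique X adj (keys s)"
    and std_unique: "eqv u v \<Longrightarrow> clique X adj (keys u) \<Longrightarrow> clique X adj (keys v) \<Longrightarrow> u = v"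
begin

lemma eqv_mon2: "eqv u v \<Longrightarrow> v \<in> monomials X"
  using eqv_mon eqv_sym by blast

lemma eqv_add2: "eqv u v \<Longrightarrow> eqv u' v' \<Longrightarrow> eqv (u + u') (v + v')"
proof -
  assume e: "eqv u v" and e': "eqv u' v'"
  have "eqv (u + u') (v + u')" using eqv_add[OF e eqv_mon[OF e']] .
  also have "eqv \<dots> (v + v')"
    using eqv_add[OF e' eqv_mon2[OF e]] by (simp add: add.commute)
  finally show "eqv (u + u') (v + v')" .
qed

lemma clique_finite: "clique X adj C \<Longrightarrow> finite C"
  using fin finite_subset unfolding clique_def by blast

definition facet :: "'v set \<Rightarrow> bool" where
  "facet F \<longleftrightarrow> clique X adj F \<and> (\<forall>C. clique X adj C \<longrightarrow> F \<subseteq> C \<longrightarrow> C = F)"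

lemma facet_clique: "facet F \<Longrightarrow> clique X adj F"
  by (simp add: facet_def)

lemma facet_finite: "facet F \<Longrightarrow> finite F"
  using facet_clique clique_finite by blast

lemma facet_keys_clique: "facet F \<Longrightarrow> keys n \<subseteq> F \<Longrightarrow> clique X adj (keys n)"
  using facet_clique clique_subset by blast

lemma power_mon_monomials: "facet F \<Longrightarrow> power_mon F k \<in> monomials X"
  using facet_finite[of F] facet_clique[of F] by (auto simp: monomials_def keys_power_mon clique_def split: if_splits)

lemma facet_ex:
  assumes "clique X adj C"
  shows "\<exists>F. facet F \<and> C \<subseteq> F"
proof -
  have "finite {F. clique X adj F \<and> C \<subseteq> F}"
    by (rule finite_subset[of _ "Pow X"]) (use fin in \<open>auto simp: clique_def\<close>)
  moreover have "C \<in> {F. clique X adj F \<and> C \<subseteq> F}" using assms by simp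
  ultimately obtain F where F: "F \<in> {F. clique X adj F \<and> C \<subseteq> F}"
    and max: "\<forall>F'\<in>{F. clique X adj F \<and> C \<subseteq> F}. F \<subseteq> F' \<longrightarrow> F = F'"
    using finite_has_maximal[of "{F. clique X adj F \<and> C \<subseteq> F}"] by (metis empty_iff)
  have "C' = F" if "clique X adj C'" "F \<subseteq> C'" for C'
    using max[rule_format, of C'] F that by auto
  then show ?thesis unfolding facet_def using F by (intro exI[of _ F]) simp
qed

text \<open>Among the standard forms of \<open>u + k \<cdot> \<Sum>F\<close> two are comparable by Dickson's lemma; cancelling
  them shows that the support of the larger one contains \<open>F\<close>.\<close>

lemma facet_spans:
  assumes F: "facet F" and u: "u \<in> monomials X"
  shows "\<exists>k n. eqv (u + power_mon F k) n \<and> keys n \<subseteq> F"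
proof -
  have "\<exists>s. eqv (u + power_mon F k) s \<and> clique X adj (keys s)" for k
    using std_ex u power_mon_monomials[OF F] by simp
  then obtain s where s: "\<And>k. eqv (u + power_mon F k) (s k)" "\<And>k. clique X adj (keys (s k))"
    by metis
  obtain i j w where ij: "i < j" and w: "w \<in> monomials X" "s j = s i + w"
    using dickson[OF fin, of s] eqv_mon2[OF s(1)] by blast
  define k where "k = j - i"
  have k: "j = i + k" "k > 0" using ij by (auto simp: k_def)
  have cw: "clique X adj (keys w)"
    by (rule clique_subset[OF s(2)[of j]]) (simp add: w(2) keys_add_nat)
  have "eqv (s i + w) (u + power_mon F i + power_mon F k)"
    using eqv_sym[OF s(1)[of j]] unfolding w(2) by (simp add: k(1) power_mon_add add.assoc)
  also have "eqv \<dots> (s i + power_mon F k)"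
    using eqv_add[OF s(1)[of i] power_mon_monomials[OF F, of k]] .
  finally have "eqv w (power_mon F k)" using eqv_cancel[of w "s i" "power_mon F k"] by (simp add: add.commute)
  moreover have kp: "keys (power_mon F k) = F" using k(2) by (simp add: keys_power_mon facet_finite[OF F])
  ultimately have "w = power_mon F k" using std_unique cw facet_clique[OF F] by simp
  then have "F \<subseteq> keys (s j)" using kp by (simp add: w(2) keys_add_nat)
  then have "keys (s j) = F" using F s(2) by (auto simp: facet_def)
  then show ?thesis using s(1) by blast
qed

section \<open>Coordinates of the monoid with respect to a facet\<close>

definition coord_rep :: "'v set \<Rightarrow> 'v mon \<Rightarrow> nat \<times> 'v mon" where
  "coord_rep F u = (SOME (k, n). eqv (u + power_mon F k) n \<and> keys n \<subseteq> F)"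

text \<open>In the group of differences \<open>facet_spans\<close> writes \<open>u\<close> as
  \<open>n - k \<Sum>F\<close>, so these are the integer coordinates of \<open>u\<close> in the
  basis \<open>F\<close>. They are taken as real functions, zero outside \<open>F\<close>, to live
  in one real vector space. By \<open>coord_eq\<close> the chosen representation does not
  matter.\<close>

definition coord :: "'v set \<Rightarrow> 'v mon \<Rightarrow> 'v \<Rightarrow> real" where
  "coord F u x = (if x \<in> F then real (lookup (snd (coord_rep F u)) x) - real (fst (coord_rep F u)) else 0)"

text \<open>Two representations are compared at \<open>u + power_mon F (k + k')\<close>: both yield
  monomials supported on the clique \<open>F\<close>, which agree by uniqueness of standard
  forms.\<close>

lemma coord_eq:
  assumes F: "facet F" and r: "eqv (u + power_mon F k) n" "keys n \<subseteq> F"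
  shows "coord F u x = (if x \<in> F then real (lookup n x) - real k else 0)"
proof -
  obtain k' n' where kn: "coord_rep F u = (k', n')" by fastforce
  have "case coord_rep F u of (k, n) \<Rightarrow> eqv (u + power_mon F k) n \<and> keys n \<subseteq> F"
    unfolding coord_rep_def by (rule someI[of _ "(k, n)"]) (use r in simp)
  then have r': "eqv (u + power_mon F k') n'" "keys n' \<subseteq> F" by (simp_all add: kn)
  have "eqv (n + power_mon F k') (u + power_mon F k + power_mon F k')"
    using eqv_add[OF eqv_sym[OF r(1)] power_mon_monomials[OF F]] .
  also have "u + power_mon F k + power_mon F k' = u + power_mon F k' + power_mon F k" by (simp add: ac_simps)
  also have "eqv \<dots> (n' + power_mon F k)" using eqv_add[OF r'(1) power_mon_monomials[OF F]] .
  finally have "eqv (n + power_mon F k') (n' + power_mon F k)" .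
  then have "n + power_mon F k' = n' + power_mon F k"
    by (rule std_unique; intro facet_keys_clique[OF F])
      (use r(2) r'(2) in \<open>auto simp: keys_add_nat keys_power_mon facet_finite[OF F] split: if_splits\<close>)
  then have "lookup (n + power_mon F k') x = lookup (n' + power_mon F k) x" by simp
  then show ?thesis
    by (auto simp: coord_def kn lookup_add lookup_power_mon facet_finite[OF F])
qed

lemma coord_add:
  assumes F: "facet F" and "u \<in> monomials X" "v \<in> monomials X"
  shows "coord F (u + v) = coord F u + coord F v"
proof
  fix x
  obtain k n where r: "eqv (u + power_mon F k) n" "keys n \<subseteq> F" using facet_spans assms by metis
  obtain k' n' where r': "eqv (v + power_mon F k') n'" "keys n' \<subseteq> F" using facet_spans assms by metis
  have "eqv ((u + v) + power_mon F (k + k')) (n + n')"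
    using eqv_add2[OF r(1) r'(1)] by (simp add: power_mon_add ac_simps)
  moreover have "keys (n + n') \<subseteq> F" using r r' by (simp add: keys_add_nat)
  ultimately show "coord F (u + v) x = (coord F u + coord F v) x"
    using coord_eq[OF F r] coord_eq[OF F r'] coord_eq[OF F, of "u + v" "k + k'" "n + n'" x]
    by (simp add: lookup_add)
qed

lemma coord_cong:
  assumes F: "facet F" and e: "eqv u v"
  shows "coord F u = coord F v"
proof
  fix x
  obtain k n where r: "eqv (v + power_mon F k) n" "keys n \<subseteq> F"
    using facet_spans F eqv_mon2[OF e] by metis
  have "eqv (u + power_mon F k) n" using eqv_trans[OF eqv_add[OF e power_mon_monomials[OF F]] r(1)] .
  then show "coord F u x = coord F v x" using coord_eq[OF F] r by metis
qed

lemma coord_facet: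
  assumes F: "facet F" and "keys u \<subseteq> F"
  shows "coord F u x = real (lookup u x)"
proof -
  have "u \<in> monomials X" using assms facet_clique[OF F] by (auto simp: monomials_def clique_def)
  then have "eqv (u + power_mon F 0) u" by (simp add: power_mon_def eqv_refl)
  from coord_eq[OF F this assms(2)] show ?thesis using assms(2) by (auto simp: in_keys_iff)
qed

text \<open>Nonnegative coordinates mean that \<open>n\<close> is divisible by the power of
  \<open>F\<close> that had been added to \<open>u\<close>, and cancelling it leaves a monomial
  supported on \<open>F\<close>. So the cone over \<open>F\<close> is cut out by the coordinate
  inequalities.\<close>

lemma coord_nonneg_std:
  assumes F: "facet F" and u: "u \<in> monomials X" and nn: "\<forall>x\<in>F. coord F u x \<ge> 0"
  shows "\<exists>n. eqv u n \<and> keys n \<subseteq> F"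
proof -
  obtain k n where r: "eqv (u + power_mon F k) n" "keys n \<subseteq> F" using facet_spans assms by metis
  define m where "m = n - power_mon F k"
  have "n = m + power_mon F k"
  proof (rule poly_mapping_eqI)
    fix x show "lookup n x = lookup (m + power_mon F k) x"
      using nn coord_eq[OF F r, of x]
      by (auto simp: m_def lookup_add lookup_minus lookup_power_mon facet_finite[OF F])
  qed
  then show ?thesis using eqv_cancel[of u "power_mon F k" m] r by (auto simp: keys_add_nat)
qed

lemma coord_int: "coord F u x \<in> \<int>"
  by (simp add: coord_def)

lemma coord_zero [simp]: "facet F \<Longrightarrow> coord F 0 = 0"
  using coord_facet[of F 0] by (auto simp: fun_eq_iff)

lemma coord_single:
  assumes F: "facet F" and x: "x \<in> X"
  shows "coord F (single x n) = (\<lambda>z. real n * coord F (single x 1) z)"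
proof (induction n)
  case 0 then show ?case using coord_zero[OF F] by (auto simp: fun_eq_iff)
next
  case (Suc n)
  have "single x (Suc n) = single x n + single x 1" by (simp flip: single_add)
  then show ?case using coord_add[OF F, of "single x n" "single x 1"] x Suc
    by (auto simp: fun_eq_iff algebra_simps)
qed

lemma coord_sum:
  assumes F: "facet F" and "finite A" "\<And>i. i \<in> A \<Longrightarrow> f i \<in> monomials X"
  shows "(\<Sum>i\<in>A. f i) \<in> monomials X \<and> coord F (\<Sum>i\<in>A. f i) = (\<Sum>i\<in>A. coord F (f i))"
  using assms(2,3) by induction (simp_all add: coord_add[OF F] coord_zero[OF F])

definition var_coord :: "'v set \<Rightarrow> 'v \<Rightarrow> 'v \<Rightarrow> real" where
  "var_coord F x = coord F (single x 1)"

lemma coord_span: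
  assumes F: "facet F" and u: "u \<in> monomials X" "keys u \<subseteq> Z"
  shows "coord F u \<in> rv.span (var_coord F ` Z)"
proof -
  have k: "keys u \<subseteq> X" using u by (simp add: monomials_def)
  have "coord F u = (\<Sum>x\<in>keys u. coord F (single x (lookup u x)))"
    using coord_sum[OF F, of "keys u" "\<lambda>x. single x (lookup u x)"] k by (auto simp: sum_singles)
  also have "\<dots> = (\<Sum>x\<in>keys u. (\<lambda>z. real (lookup u x) * var_coord F x z))"
    unfolding var_coord_def by (rule sum.cong[OF refl], rule coord_single[OF F]) (use k in blast)
  also have "\<dots> \<in> rv.span (var_coord F ` Z)"
    using u(2) by (intro rv.span_sum rv.span_scale rv.span_base) auto
  finally show ?thesis .
qed

text \<open>Up to equivalence \<open>u\<close> is a difference of two monomials supported on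
  \<open>F\<close>, so the vectors of any facet span everything.\<close>

lemma coord_span_facet:
  assumes F0: "facet F0" and F: "facet F" and u: "u \<in> monomials X"
  shows "coord F0 u \<in> rv.span (var_coord F0 ` F)"
proof -
  obtain k n where r: "eqv (u + power_mon F k) n" "keys n \<subseteq> F" using facet_spans[OF F u] by blast
  have "coord F0 u + coord F0 (power_mon F k) = coord F0 n"
    using coord_cong[OF F0 r(1)] coord_add[OF F0 u power_mon_monomials[OF F]] by simp
  then have "coord F0 u = coord F0 n - coord F0 (power_mon F k)" by (simp add: algebra_simps)
  moreover have "coord F0 n \<in> rv.span (var_coord F0 ` F)"
    using coord_span[OF F0 _ r(2)] eqv_mon2[OF r(1)] .
  moreover have "coord F0 (power_mon F k) \<in> rv.span (var_coord F0 ` F)"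
    by (rule coord_span[OF F0 power_mon_monomials[OF F]]) (simp add: keys_power_mon facet_finite[OF F])
  ultimately show ?thesis by (simp add: rv.span_diff)
qed

text \<open>In its own coordinates \<open>F0\<close> consists of unit vectors, which lie in the span
  of any other facet, so the exchange lemma applies. An arbitrary \<open>T\<close> is allowed
  because the same bound shows later that fewer than \<open>card F0\<close> vectors cannot have a
  whole facet in their span.\<close>

lemma card_facet_le_span:
  assumes F0: "facet F0" and F: "facet F" and T: "finite T" "var_coord F0 ` F \<subseteq> rv.span T"
  shows "card F0 \<le> card T"
proof -
  have F0X: "F0 \<subseteq> X" using facet_clique[OF F0] by (simp add: clique_def)
  have v: "var_coord F0 y x = (if x = y then 1 else 0)" if "y \<in> F0" for y x
    using coord_facet[OF F0, of "single y 1" x] that by (auto simp: var_coord_def lookup_single when_def)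
  have *: "inj_on (var_coord F0) F0 \<and> rv.independent (var_coord F0 ` F0)"
    by (intro conjI rv.independent_functionals[where L = "\<lambda>y f. f y"]) (auto simp: v)
  have "var_coord F0 ` F0 \<subseteq> rv.span (var_coord F0 ` F)"
    using coord_span_facet[OF F0 F] F0X by (auto simp: var_coord_def)
  also have "\<dots> \<subseteq> rv.span T" using T(2) by (simp add: rv.span_minimal)
  finally have "card (var_coord F0 ` F0) \<le> card T"
    using rv.independent_span_bound[OF T(1)] * by blast
  then show ?thesis using * by (simp add: card_image)
qed

lemma card_facet:
  assumes "facet F" "facet F'"
  shows "card F = card F'"
proof -
  have "card F \<le> card F'" if "facet F" "facet F'" for F F'
    using card_facet_le_span[OF that finite_imageI[OF facet_finite[OF that(2)], of "var_coord F"]]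
      card_image_le[OF facet_finite[OF that(2)], of "var_coord F"] by (simp add: rv.span_superset)
  then show ?thesis using assms by (simp add: le_antisym)
qed

text \<open>A segment from the cone of a facet meeting one component to the cone of a facet meeting
  another one has to cross the span of the removed vertices, and this span has codimension at
  least two.\<close>

lemma induced_graph_connected:
  assumes F0: "facet F0" and W: "W \<subseteq> X" "card (X - W) + 2 \<le> card F0" and yz: "y \<in> W" "z \<in> W"
  shows "(y, z) \<in> {(p, q). p \<in> W \<and> q \<in> W \<and> adj p q}\<^sup>*"
proof (rule ccontr)
  assume nz: "(y, z) \<notin> {(p, q). p \<in> W \<and> q \<in> W \<and> adj p q}\<^sup>*"
  define Z where "Z = X - W"
  \<comment> \<open>\<open>A\<close> is the component of \<open>y\<close> in the graph on
    \<open>W\<close>, and \<open>B\<close> the rest of \<open>W\<close>. As no edge joins them,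
    every facet lies in \<open>A \<union> Z\<close> or in \<open>B \<union> Z\<close>.\<close>
  define A where "A = {p \<in> W. (y, p) \<in> {(p, q). p \<in> W \<and> q \<in> W \<and> adj p q}\<^sup>*}"
  define B where "B = W - A"
  have nadj: "\<not> adj p q" if "p \<in> A" "q \<in> B" for p q
  proof
    assume "adj p q"
    then have "(p, q) \<in> {(p, q). p \<in> W \<and> q \<in> W \<and> adj p q}"
      using that by (auto simp: A_def B_def)
    then show False using that by (auto simp: A_def B_def intro: rtrancl_into_rtrancl)
  qed
  have X: "X = A \<union> B \<union> Z" using W by (auto simp: A_def B_def Z_def)
  have disj: "A \<inter> B = {}" "A \<inter> Z = {}" "B \<inter> Z = {}" by (auto simp: A_def B_def Z_def)
  have facAZ: "F \<subseteq> A \<union> Z \<or> F \<subseteq> B \<union> Z" if "facet F" for F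
  proof (rule ccontr)
    assume "\<not> ?thesis"
    then obtain p q where pq: "p \<in> F" "p \<notin> A \<union> Z" "q \<in> F" "q \<notin> B \<union> Z" by blast
    have FX: "F \<subseteq> X" using facet_clique[OF that] by (simp add: clique_def)
    then have "p \<in> B" "q \<in> A" "p \<noteq> q" using pq X disj by auto
    moreover have "adj q p" using facet_clique[OF that] pq \<open>p \<noteq> q\<close> by (auto simp: clique_def)
    ultimately show False using nadj by blast
  qed
  have yA: "y \<in> A" using yz by (simp add: A_def)
  have zB: "z \<in> B" using yz nz by (simp add: A_def B_def)
  obtain FA where FA: "facet FA" "y \<in> FA" using facet_ex[of "{y}"] yz W by (auto simp: clique_def)
  obtain FB where FB: "facet FB" "z \<in> FB" using facet_ex[of "{z}"] yz W by (auto simp: clique_def)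
  have FAZ: "FA \<subseteq> A \<union> Z" using facAZ[OF FA(1)] FA(2) yA disj by blast
  have FBZ: "FB \<subseteq> B \<union> Z" using facAZ[OF FB(1)] FB(2) zB disj by blast
  have finZ: "finite Z" using fin by (simp add: Z_def)
  have cZ: "card Z + 2 \<le> card F0" using W by (simp add: Z_def)
  \<comment> \<open>\<open>Z\<close> has at most \<open>card F0 - 2\<close> elements, so even with
    one more vector it cannot span a facet. Hence \<open>a\<close> and \<open>b\<close> can be
    chosen independent modulo the span of \<open>Z\<close>, and the segment between them avoids this
    span.\<close>
  have "\<not> var_coord F0 ` FA \<subseteq> rv.span (var_coord F0 ` Z)"
    using card_facet_le_span[OF F0 FA(1), of "var_coord F0 ` Z"] finZ card_image_le[OF finZ, of "var_coord F0"] cZ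
    by auto
  then obtain a where a: "a \<in> FA" "var_coord F0 a \<notin> rv.span (var_coord F0 ` Z)" by blast
  have "card (insert (var_coord F0 a) (var_coord F0 ` Z)) \<le> Suc (card Z)"
    using card_insert_le_m1[of "Suc (card Z)" "var_coord F0 ` Z"] card_image_le[OF finZ, of "var_coord F0"] by simp
  then have "\<not> var_coord F0 ` FB \<subseteq> rv.span (insert (var_coord F0 a) (var_coord F0 ` Z))"
    using card_facet_le_span[OF F0 FB(1), of "insert (var_coord F0 a) (var_coord F0 ` Z)"] finZ cZ by auto
  then obtain b where b: "b \<in> FB" "var_coord F0 b \<notin> rv.span (insert (var_coord F0 a) (var_coord F0 ` Z))" by blast
  have abX: "a \<in> X" "b \<in> X"
    using a(1) b(1) facet_clique[OF FA(1)] facet_clique[OF FB(1)] by (auto simp: clique_def)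
  \<comment> \<open>Positive multiples of the rational points of the segment are represented by
    these monomials.\<close>
  define u where "u = (\<lambda>s t. single a s + single b t :: 'v mon)"
  have umon: "u s t \<in> monomials X" for s t by (simp add: u_def abX)
  have cou: "coord F (u s t) x = real s * var_coord F a x + real t * var_coord F b x" if "facet F" for F s t x
    using coord_add[OF that, of "single a s" "single b t"] coord_single[OF that abX(1), of s]
      coord_single[OF that abX(2), of t] abX by (simp add: u_def var_coord_def)
  \<comment> \<open>\<open>T F\<close> consists of the parameters at which the segment from
    \<open>a\<close> to \<open>b\<close> runs through the cone over \<open>F\<close>.\<close>
  define T where "T = (\<lambda>F. {r::real. 0 \<le> r \<and> r \<le> 1 \<and> (\<forall>x\<in>F. 0 \<le> (1 - r) * var_coord F a x + r * var_coord F b x)})"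
  define TA where "TA = (\<Union>F\<in>{F. facet F \<and> F \<subseteq> A \<union> Z}. T F)"
  define TB where "TB = (\<Union>F\<in>{F. facet F \<and> F \<subseteq> B \<union> Z}. T F)"
  have Tclosed: "closed (T F)" for F
  proof -
    have "T F = {0..1} \<inter> (\<Inter>x\<in>F. {r. 0 \<le> (1 - r) * var_coord F a x + r * var_coord F b x})"
      by (auto simp: T_def)
    moreover have "closed {r. 0 \<le> (1 - r) * var_coord F a x + r * var_coord F b x}" for x
      by (intro closed_Collect_le continuous_intros)
    ultimately show ?thesis by (simp add: closed_Int closed_INT)
  qed
  have finF: "finite {F. facet F \<and> F \<subseteq> Y}" for Y
    by (rule finite_subset[of _ "Pow X"])
      (use fin facet_clique in \<open>auto simp: clique_def\<close>)
  have closed: "closed TA" "closed TB"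
    unfolding TA_def TB_def by (intro closed_UN finF ballI Tclosed)+
  \<comment> \<open>For \<open>r = m / n\<close> the point, multiplied by \<open>n\<close>, is the
    monomial with exponents \<open>n - m\<close> and \<open>m\<close>.\<close>
  have rat: "\<exists>s t. s + t > 0 \<and> (\<forall>F. facet F \<longrightarrow> (r \<in> T F \<longleftrightarrow> (\<forall>x\<in>F. 0 \<le> coord F (u s t) x)))"
    if r: "r \<in> \<rat>" "0 \<le> r" "r \<le> 1" for r
  proof -
    obtain m n :: nat where mn: "n \<noteq> 0" "\<bar>r\<bar> = real m / real n"
      using Rats_abs_nat_div_natE[OF r(1)] by metis
    have rm: "r * real n = real m" using mn r by (simp add: field_simps)
    have "r * real n \<le> 1 * real n" by (intro mult_right_mono) (use r in auto)
    then have "m \<le> n" by (simp add: rm)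
    then have rn: "(1 - r) * real n = real (n - m)" using rm by (simp add: of_nat_diff algebra_simps)
    have *: "0 \<le> (1 - r) * var_coord F a x + r * var_coord F b x \<longleftrightarrow> 0 \<le> coord F (u (n - m) m) x"
      if "facet F" for F x
    proof -
      have "coord F (u (n - m) m) x = real n * ((1 - r) * var_coord F a x + r * var_coord F b x)"
        unfolding cou[OF that] rm[symmetric] rn[symmetric] by (simp add: algebra_simps)
      then show ?thesis using mn(1) by (simp add: zero_le_mult_iff)
    qed
    show ?thesis
      by (rule exI[of _ "n - m"], rule exI[of _ m]) (use \<open>m \<le> n\<close> mn(1) r * in \<open>auto simp: T_def\<close>)
  qed
  have cover_rat: "r \<in> TA \<union> TB" if r: "r \<in> \<rat>" "0 \<le> r" "r \<le> 1" for r
  proof -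
    from rat[OF r] obtain s t where "s + t > 0"
      and st: "\<forall>F. facet F \<longrightarrow> (r \<in> T F \<longleftrightarrow> (\<forall>x\<in>F. 0 \<le> coord F (u s t) x))"
      by (elim exE conjE) (rule that)
    obtain n where n: "eqv (u s t) n" "clique X adj (keys n)" using std_ex[OF umon] by blast
    obtain F where F: "facet F" "keys n \<subseteq> F" using facet_ex[OF n(2)] by blast
    have "r \<in> T F" using st[rule_format, OF F(1)] coord_cong[OF F(1) n(1)] coord_facet[OF F] by simp
    then show ?thesis using facAZ[OF F(1)] F(1) by (auto simp: TA_def TB_def)
  qed
  \<comment> \<open>At a common point of the two cones the unique standard form is supported on both
    \<open>F\<close> and \<open>F'\<close>, hence on \<open>Z\<close>, and the point falls into the
    span of \<open>Z\<close>.\<close>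
  have disj_rat: False
    if r: "r \<in> \<rat>" and F: "facet F" "F \<subseteq> A \<union> Z" "r \<in> T F" and F': "facet F'" "F' \<subseteq> B \<union> Z" "r \<in> T F'"
    for r F F'
  proof -
    have "0 \<le> r" "r \<le> 1" using F by (auto simp: T_def)
    from rat[OF r this] obtain s t where s_t: "s + t > 0"
      and st: "\<forall>F. facet F \<longrightarrow> (r \<in> T F \<longleftrightarrow> (\<forall>x\<in>F. 0 \<le> coord F (u s t) x))"
      by (elim exE conjE) (rule that)
    obtain n where n: "eqv (u s t) n" "keys n \<subseteq> F"
      using coord_nonneg_std[OF F(1) umon] st[rule_format, OF F(1)] F(3) by blast
    obtain n' where n': "eqv (u s t) n'" "keys n' \<subseteq> F'"
      using coord_nonneg_std[OF F'(1) umon] st[rule_format, OF F'(1)] F'(3) by blast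
    have "n = n'"
      using std_unique[OF eqv_trans[OF eqv_sym[OF n(1)] n'(1)]]
        facet_keys_clique[OF F(1) n(2)] facet_keys_clique[OF F'(1) n'(2)] by blast
    then have nZ: "keys n \<subseteq> Z" using n n' F(2) F'(2) disj by blast
    have cs: "coord F0 (u s t) \<in> rv.span (var_coord F0 ` Z)"
      using coord_span[OF F0 eqv_mon2[OF n(1)] nZ] coord_cong[OF F0 n(1)] by simp
    show False
    proof (cases "t = 0")
      case True
      then have "s \<noteq> 0" using s_t by simp
      then have "var_coord F0 a = (\<lambda>x. (1 / real s) * coord F0 (u s t) x)"
        by (auto simp: fun_eq_iff cou[OF F0] True)
      then show False using a(2) rv.span_scale[OF cs, of "1 / real s"] by simp
    next
      case False
      have "var_coord F0 b = (\<lambda>x. (1 / real t) * coord F0 (u s t) x) - (\<lambda>x. (real s / real t) * var_coord F0 a x)"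
        using False by (auto simp: fun_eq_iff cou[OF F0] field_simps)
      moreover have "(\<lambda>x. (1 / real t) * coord F0 (u s t) x) \<in> rv.span (insert (var_coord F0 a) (var_coord F0 ` Z))"
        using rv.span_scale[OF cs, of "1 / real t"] rv.span_mono[of "var_coord F0 ` Z" "insert (var_coord F0 a) (var_coord F0 ` Z)"]
        by blast
      moreover have "(\<lambda>x. (real s / real t) * var_coord F0 a x) \<in> rv.span (insert (var_coord F0 a) (var_coord F0 ` Z))"
        by (intro rv.span_scale rv.span_base) simp
      ultimately show False using b(2) by (simp add: rv.span_diff)
    qed
  qed
  have disj_real: "TA \<inter> TB = {}"
  proof (rule ccontr)
    assume "TA \<inter> TB \<noteq> {}"
    then obtain r F F' where F: "facet F" "F \<subseteq> A \<union> Z" "r \<in> T F"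
      and F': "facet F'" "F' \<subseteq> B \<union> Z" "r \<in> T F'" by (auto simp: TA_def TB_def)
    have irr: "r \<notin> \<rat>" using disj_rat F F' by blast
    then have r01: "0 < r" "r < 1" using F(3) by (auto simp: T_def less_le)
    \<comment> \<open>Along the segment a coordinate is an affine function with integer values at
      both ends. At an irrational \<open>r\<close> where it is nonnegative it is thus positive or
      identically zero, so membership in a cone persists near \<open>r\<close>, and a nearby
      rational parameter leads back to \<open>disj_rat\<close>.\<close>
    have near: "\<forall>\<^sub>F r' in nhds r. r' \<in> T G" if G: "facet G" "r \<in> T G" for G
    proof -
      have "\<forall>\<^sub>F r' in nhds r. 0 \<le> (1 - r') * var_coord G a x + r' * var_coord G b x" if x: "x \<in> G" for x
      proof (cases "(1 - r) * var_coord G a x + r * var_coord G b x = 0")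
        case True
        have "var_coord G a x = var_coord G b x"
        proof (rule ccontr)
          assume ne: "var_coord G a x \<noteq> var_coord G b x"
          have "r = var_coord G a x / (var_coord G a x - var_coord G b x)"
            using True ne by (simp add: field_simps)
          moreover have "var_coord G a x \<in> \<rat>" "var_coord G b x \<in> \<rat>"
            using coord_int Ints_subset_Rats by (auto simp: var_coord_def)
          ultimately show False using irr by (metis Rats_diff Rats_divide)
        qed
        moreover from this have "var_coord G a x = 0" using True by (simp add: algebra_simps)
        ultimately show ?thesis by simp
      next
        case False
        then have pos: "0 < (1 - r) * var_coord G a x + r * var_coord G b x"
          using G(2) x by (auto simp: T_def less_le)
        have "((\<lambda>r'. (1 - r') * var_coord G a x + r' * var_coord G b x) \<longlongrightarrow> (1 - r) * var_coord G a x + r * var_coord G b x) (nhds r)"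
          by (intro tendsto_intros filterlim_ident)
        from order_tendstoD(1)[OF this pos] show ?thesis by eventually_elim simp
      qed
      then have "\<forall>\<^sub>F r' in nhds r. \<forall>x\<in>G. 0 \<le> (1 - r') * var_coord G a x + r' * var_coord G b x"
        by (simp add: eventually_ball_finite_distrib facet_finite[OF G(1)])
      moreover have "\<forall>\<^sub>F r' in nhds r. 0 < r'" "\<forall>\<^sub>F r' in nhds r. r' < 1"
        using r01 eventually_nhds_in_open[of "{0<..<1}" r] by (auto elim: eventually_mono)
      ultimately show ?thesis by eventually_elim (simp add: T_def)
    qed
    have "\<forall>\<^sub>F r' in nhds r. r' \<in> T F \<and> r' \<in> T F'"
      using near[OF F(1,3)] near[OF F'(1,3)] by eventually_elim simp
    then obtain e where e: "e > 0" "\<And>r'. dist r' r < e \<Longrightarrow> r' \<in> T F \<and> r' \<in> T F'"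
      unfolding eventually_nhds_metric by blast
    obtain q where q: "q \<in> \<rat>" "r < q" "q < r + e" using Rats_dense_in_real[of r "r + e"] e by auto
    then show False using disj_rat[OF q(1) F(1,2) _ F'(1,2)] e(2)[of q] by (auto simp: dist_real_def)
  qed
  \<comment> \<open>The rational parameters are covered through standard forms, and a union of two
    closed sets containing a dense subset contains everything.\<close>
  have cover: "{0..1} \<subseteq> TA \<union> TB"
  proof
    fix r :: real assume r: "r \<in> {0..1}"
    show "r \<in> TA \<union> TB"
    proof (rule ccontr)
      assume "r \<notin> TA \<union> TB"
      moreover have "open (- (TA \<union> TB))" using closed by (intro open_Compl closed_Un)
      ultimately obtain e where e: "e > 0" "\<And>r'. dist r' r < e \<Longrightarrow> r' \<in> - (TA \<union> TB)"
        unfolding open_dist by blast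
      obtain q where q: "q \<in> \<rat>" "max 0 (r - e) < q" "q < min 1 (r + e)"
        using Rats_dense_in_real[of "max 0 (r - e)" "min 1 (r + e)"] e r by auto
      then have "dist q r < e" by (simp add: dist_real_def abs_less_iff)
      then show False using cover_rat[of q] e(2)[of q] q by auto
    qed
  qed
  have "0 \<in> TA"
    using FA FAZ a(1) coord_facet[OF FA(1), of "single a 1"] by (auto simp: TA_def T_def var_coord_def)
  moreover have "1 \<in> TB"
    using FB FBZ b(1) coord_facet[OF FB(1), of "single b 1"] by (auto simp: TB_def T_def var_coord_def)
  \<comment> \<open>\<open>TA\<close> and \<open>TB\<close> would split the unit interval into two
    disjoint nonempty closed sets.\<close>
  ultimately have "\<not> connected {0..1::real}"
    using closed disj_real cover unfolding connected_closed not_not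
    by (intro exI[of _ TA] exI[of _ TB]) auto
  then show False by simp
qed

end

section \<open>Linear algebra and ideals in polynomial rings\<close>

text \<open>The ambient spaces in the applications have infinite dimension, so finiteness is a
  condition on \<open>V\<close>. A basis of the kernel is extended to one of \<open>V\<close>, and
  \<open>f\<close> is injective on the span of the added vectors.\<close>

lemma (in vector_space_pair) rank_nullity:
  assumes f: "Vector_Spaces.linear s1 s2 f" and V: "vs1.subspace V" and S: "V \<subseteq> vs1.span S" "finite S"
  shows "vs1.dim V = vs1.dim {v \<in> V. f v = 0} + vs2.dim (f ` V)"
proof -
  define K where "K = {v \<in> V. f v = 0}"
  obtain BK where BK: "BK \<subseteq> K" "vs1.independent BK" "K \<subseteq> vs1.span BK" "card BK = vs1.dim K"
    using vs1.basis_exists[of K] by blast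
  obtain B where B: "BK \<subseteq> B" "B \<subseteq> V" "vs1.independent B" "V \<subseteq> vs1.span B"
    using vs1.maximal_independent_subset_extend[of BK V] BK by (auto simp: K_def)
  have finB: "finite B"
    using vs1.independent_span_bound[OF S(2) B(3)] B(2) S(1) by blast
  define C where "C = B - BK"
  have finC: "finite C" and finBK: "finite BK"
    using finB B(1) finite_subset by (auto simp: C_def)
  have inj: "inj_on f (vs1.span C)"
    unfolding linear_inj_on_iff_eq_0[OF f vs1.subspace_span]
  proof (intro ballI impI)
    fix x assume x: "x \<in> vs1.span C" "f x = 0"
    have "C \<subseteq> V" using B(2) by (auto simp: C_def)
    then have "x \<in> V" using x(1) vs1.span_minimal[OF _ V] by blast
    then have "x \<in> vs1.span BK" using x(2) BK(3) by (auto simp: K_def)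
    then obtain w where w: "x = (\<Sum>v\<in>BK. w v *a v)" using vs1.span_finite[OF finBK] by auto
    obtain u where u: "x = (\<Sum>v\<in>C. u v *a v)" using vs1.span_finite[OF finC] x(1) by auto
    \<comment> \<open>The difference of the two expansions of \<open>x\<close>, over the disjoint
      parts \<open>C\<close> and \<open>BK\<close> of the basis, is a relation among independent
      vectors.\<close>
    define r where "r v = (if v \<in> C then u v else - w v)" for v
    have "(\<Sum>v\<in>B. r v *a v) = (\<Sum>v\<in>C. r v *a v) + (\<Sum>v\<in>BK. r v *a v)"
      using sum.subset_diff[OF B(1) finB, of "\<lambda>v. r v *a v"] by (simp add: C_def)
    also have "(\<Sum>v\<in>C. r v *a v) = x" unfolding u by (rule sum.cong) (auto simp: r_def)
    also have "(\<Sum>v\<in>BK. r v *a v) = - x"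
      unfolding w sum_negf[symmetric] by (rule sum.cong) (auto simp: r_def C_def)
    finally have "(\<Sum>v\<in>B. r v *a v) = 0" by simp
    then have "r v = 0" if "v \<in> B" for v
      using vs1.independentD[OF B(3) finB subset_refl] that by blast
    then have "u v = 0" if "v \<in> C" for v using that \<open>\<And>v. v \<in> B \<Longrightarrow> r v = 0\<close>[of v] by (simp add: r_def C_def)
    then show "x = 0" by (simp add: u)
  qed
  have "vs1.independent C" using vs1.independent_mono[OF B(3)] by (auto simp: C_def)
  then have ind: "vs2.independent (f ` C)"
    using linear_inj_on_span_iff_independent_image[OF f] inj
      linear_independent_injective_image linear_dependent_inj_imageD[OF f _ inj] by blast
  have injC: "inj_on f C" using inj vs1.span_superset inj_on_subset by blast
  have "f ` V \<subseteq> vs2.span (f ` C)"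
  proof
    fix y assume "y \<in> f ` V"
    then have "y \<in> vs2.span (f ` B)" using B(4) linear_span_image[OF f, of B] by blast
    moreover have "vs2.span (f ` B) \<subseteq> vs2.span (f ` C)"
    proof (rule vs2.span_minimal)
      show "f ` B \<subseteq> vs2.span (f ` C)"
      proof safe
        fix v assume "v \<in> B"
        then show "f v \<in> vs2.span (f ` C)"
          using BK(1) by (cases "v \<in> BK") (auto simp: C_def K_def vs2.span_zero intro: vs2.span_base)
      qed
    qed simp
    ultimately show "y \<in> vs2.span (f ` C)" by blast
  qed
  moreover have "f ` C \<subseteq> f ` V" using B(2) by (auto simp: C_def)
  ultimately have "vs2.dim (f ` V) = card C"
    using vs2.basis_card_eq_dim[OF _ _ ind] injC by (simp add: card_image)
  moreover have "card B = vs1.dim V" using vs1.basis_card_eq_dim[OF B(2,4,3)] .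
  moreover have "card B = card C + card BK"
    using B(1) finB by (simp add: C_def card_Diff_subset finBK card_mono)
  ultimately show ?thesis using BK(4) by (simp add: K_def)
qed

definition pscale :: "'k::field \<Rightarrow> ('v, 'k) pol \<Rightarrow> ('v, 'k) pol" where
  "pscale c p = single 0 c * p"

lemma single_0_one [simp]: "single 0 1 = (1 :: ('v, 'k::field) pol)"
  by (simp add: single_one)

interpretation pv: vector_space "pscale :: 'k::field \<Rightarrow> ('v, 'k) pol \<Rightarrow> ('v, 'k) pol"
  by unfold_locales (simp_all add: pscale_def algebra_simps single_add mult_single flip: mult.assoc)

lemma lookup_single_mult:
  "lookup (single u c * p) (u + w) = c * lookup (p :: ('v, 'k::field) pol) w"
proof -
  have "single u c * p = (\<Sum>x\<in>keys p. single (u + x) (c * lookup p x))"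
    by (subst sum_singles[of p, symmetric]) (simp add: sum_distrib_left mult_single)
  then show ?thesis
    by (auto simp: lookup_sum lookup_single when_def in_keys_iff if_distrib cong: if_cong)
qed

lemma keys_single_mult:
  "m \<in> keys (single u c * (p :: ('v, 'k::field) pol)) \<Longrightarrow> \<exists>w\<in>keys p. m = u + w"
  using keys_mult[of "single u c" p] by (auto split: if_splits)

lemma lookup_pscale [simp]: "lookup (pscale c p) u = c * lookup p u"
  using lookup_single_mult[of 0 c p u] by (simp add: pscale_def)

lemma keys_pscale: "keys (pscale c p) \<subseteq> keys p"
  by (auto simp: in_keys_iff)

lemma lookup_mono_pol: "lookup (mono_pol u) v = (if u = v then 1 else 0)"
  by (simp add: mono_pol_def lookup_single when_def)

lemma keys_mono_pol [simp]: "keys (mono_pol u :: ('v, 'k::field) pol) = {u}"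
  by (simp add: mono_pol_def)

lemma mono_pol_mult: "mono_pol u * mono_pol v = (mono_pol (u + v) :: ('v, 'k::field) pol)"
  by (simp add: mono_pol_def mult_single)

lemma poly_mapping_sum_mono_pol:
  "(p :: ('v, 'k::field) pol) = (\<Sum>u\<in>keys p. pscale (lookup p u) (mono_pol u))"
proof -
  have "(\<Sum>u\<in>keys p. pscale (lookup p u) (mono_pol u)) = (\<Sum>u\<in>keys p. single u (lookup p u))"
    by (simp add: pscale_def mono_pol_def mult_single)
  then show ?thesis by (simp add: sum_singles)
qed

lemma in_carrier_poly_ring: "p \<in> carrier (poly_ring X) \<longleftrightarrow> keys p \<subseteq> monomials X"
  by (simp add: poly_ring_def)

lemma poly_ring_simps [simp]:
  "add (poly_ring X) = (+)" "monoid.mult (poly_ring X) = (*)"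
  "zero (poly_ring X) = 0" "one (poly_ring X) = 1"
  by (simp_all add: poly_ring_def)

lemma mono_pol_carrier [simp]: "mono_pol u \<in> carrier (poly_ring X) \<longleftrightarrow> u \<in> monomials X"
  by (simp add: in_carrier_poly_ring)

lemma single_0_carrier: "single 0 c \<in> carrier (poly_ring X)"
  by (simp add: in_carrier_poly_ring)

lemma carrier_poly_ring_closed:
  assumes "p \<in> carrier (poly_ring X)" "q \<in> carrier (poly_ring X :: ('v, 'k::field) pol ring)"
  shows "p + q \<in> carrier (poly_ring X)" "p * q \<in> carrier (poly_ring X)" "- p \<in> carrier (poly_ring X)"
    "p - q \<in> carrier (poly_ring X)" "0 \<in> carrier (poly_ring X :: ('v, 'k::field) pol ring)"
proof -
  have R: "ring (poly_ring X :: ('v, 'k) pol ring)" using cring_poly_ring cring.axioms(1) by blast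
  show "p + q \<in> carrier (poly_ring X)" "p * q \<in> carrier (poly_ring X)"
    using ring.ring_simprules(1,5)[OF R assms] by simp_all
  show "- p \<in> carrier (poly_ring X)" "p - q \<in> carrier (poly_ring X)"
    "0 \<in> carrier (poly_ring X :: ('v, 'k::field) pol ring)"
    using assms keys_diff[of p q] by (auto simp: in_carrier_poly_ring)
qed

lemma ideal_poly_ringI:
  fixes T :: "('v, 'k::field) pol set"
  assumes "T \<subseteq> carrier (poly_ring X)" "0 \<in> T" "\<And>p q. p \<in> T \<Longrightarrow> q \<in> T \<Longrightarrow> p + q \<in> T"
    and mult: "\<And>p q. p \<in> T \<Longrightarrow> q \<in> carrier (poly_ring X) \<Longrightarrow> q * p \<in> T"
  shows "ideal T (poly_ring X)"
proof (rule idealI)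
  show R: "ring (poly_ring X :: ('v, 'k) pol ring)" using cring_poly_ring cring.axioms(1) by blast
  show "subgroup T (add_monoid (poly_ring X))"
  proof
    fix p assume p: "p \<in> T"
    then have pc: "p \<in> carrier (poly_ring X)" using assms(1) by blast
    have "a_inv (poly_ring X) p = - p"
      using abelian_group.minus_equality[OF ring.is_abelian_group[OF R], of "- p" p] pc
        carrier_poly_ring_closed(3)[OF pc pc] by simp
    moreover have "- p = single 0 (- 1) * p" by (simp add: single_uminus)
    ultimately show "inv\<^bsub>add_monoid (poly_ring X)\<^esub> p \<in> T"
      using mult[OF p single_0_carrier[of "- 1"]] by (simp add: a_inv_def)
  qed (use assms in auto)
  show "q \<otimes>\<^bsub>poly_ring X\<^esub> p \<in> T" "p \<otimes>\<^bsub>poly_ring X\<^esub> q \<in> T"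
    if "p \<in> T" "q \<in> carrier (poly_ring X)" for p q
    using mult[OF that] by (simp_all add: mult.commute)
qed

lemma ideal_poly_ringD:
  fixes T :: "('v, 'k::field) pol set"
  assumes T: "ideal T (poly_ring X)"
  shows "T \<subseteq> carrier (poly_ring X)" "0 \<in> T" "\<And>p q. p \<in> T \<Longrightarrow> q \<in> T \<Longrightarrow> p + q \<in> T"
    "\<And>p q. p \<in> T \<Longrightarrow> q \<in> carrier (poly_ring X) \<Longrightarrow> q * p \<in> T"
proof -
  interpret ideal T "poly_ring X" by fact
  show "T \<subseteq> carrier (poly_ring X)" "0 \<in> T" "\<And>p q. p \<in> T \<Longrightarrow> q \<in> T \<Longrightarrow> p + q \<in> T"
    "\<And>p q. p \<in> T \<Longrightarrow> q \<in> carrier (poly_ring X) \<Longrightarrow> q * p \<in> T"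
    using a_subset I_l_closed additive_subgroup.zero_closed[OF ideal.axioms(1)[OF T]]
      additive_subgroup.a_closed[OF ideal.axioms(1)[OF T]] by auto
qed

lemma ideal_subspace: "ideal T (poly_ring X) \<Longrightarrow> pv.subspace T"
  using ideal_poly_ringD[of T X] by (auto simp: pv.subspace_def pscale_def single_0_carrier)

lemma ideal_Idl: "B \<subseteq> carrier (poly_ring X) \<Longrightarrow> ideal (Idl\<^bsub>poly_ring X\<^esub> B) (poly_ring X)"
  using ring.genideal_ideal cring_poly_ring cring.axioms(1) by blast

lemma Idl_superset: "B \<subseteq> carrier (poly_ring X) \<Longrightarrow> B \<subseteq> Idl\<^bsub>poly_ring X\<^esub> B"
  using ring.genideal_self cring_poly_ring cring.axioms(1) by blast

lemma Idl_minimal: "ideal T (poly_ring X) \<Longrightarrow> B \<subseteq> T \<Longrightarrow> Idl\<^bsub>poly_ring X\<^esub> B \<subseteq> T"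
  using ring.genideal_minimal cring_poly_ring cring.axioms(1) by blast

text \<open>The polynomials all of whose monomials are divisible by an element of \<open>A\<close>
  form an ideal that contains the generators.\<close>

lemma mono_pol_in_monomial_ideal:
  assumes A: "A \<subseteq> monomials X"
    and u: "(mono_pol u :: ('v, 'k::field) pol) \<in> Idl\<^bsub>poly_ring X\<^esub> (mono_pol ` A)"
  shows "\<exists>a\<in>A. \<exists>w\<in>monomials X. u = a + w"
proof -
  define T where "T = {p :: ('v, 'k) pol. \<forall>u\<in>keys p. \<exists>a\<in>A. \<exists>w\<in>monomials X. u = a + w}"
  have "ideal T (poly_ring X)"
  proof (rule ideal_poly_ringI)
    show "T \<subseteq> carrier (poly_ring X)"
      using A by (fastforce simp: T_def in_carrier_poly_ring)
    show "p + q \<in> T" if "p \<in> T" "q \<in> T" for p q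
      using that Poly_Mapping.keys_add[of p q] unfolding T_def by blast
    show "q * p \<in> T" if pq: "p \<in> T" "q \<in> carrier (poly_ring X)" for p q
      unfolding T_def
    proof (intro CollectI ballI)
      fix u assume "u \<in> keys (q * p)"
      then obtain b c where bc: "u = b + c" "b \<in> keys q" "c \<in> keys p" using keys_mult[of q p] by blast
      obtain a w where a: "a \<in> A" "w \<in> monomials X" "c = a + w" using pq(1) bc(3) by (auto simp: T_def)
      have "b + w \<in> monomials X" using a(2) bc(2) pq(2) by (auto simp: in_carrier_poly_ring)
      moreover have "u = a + (b + w)" by (simp add: bc a(3) ac_simps)
      ultimately show "\<exists>a\<in>A. \<exists>w\<in>monomials X. u = a + w" using a(1) by blast
    qed
  qed (simp add: T_def)
  moreover have "mono_pol ` A \<subseteq> T" by (force simp: T_def)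
  ultimately have "mono_pol u \<in> T" using Idl_minimal u by blast
  then show ?thesis by (simp add: T_def)
qed

definition lin_ext :: "('v mon \<Rightarrow> 'k) \<Rightarrow> ('v, 'k::field) pol \<Rightarrow> 'k" where
  "lin_ext h p = (\<Sum>u\<in>keys p. lookup p u * h u)"

lemma lin_ext_superset: "finite S \<Longrightarrow> keys p \<subseteq> S \<Longrightarrow> lin_ext h p = (\<Sum>u\<in>S. lookup p u * h u)"
  unfolding lin_ext_def by (rule sum.mono_neutral_left) (auto simp: in_keys_iff)

lemma lin_ext_add: "lin_ext h (p + q) = lin_ext h p + lin_ext h q"
proof -
  have *: "finite (keys p \<union> keys q)" by simp
  show ?thesis
    using lin_ext_superset[OF *, of p h] lin_ext_superset[OF *, of q h] lin_ext_superset[OF *, of "p + q" h]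
      Poly_Mapping.keys_add[of p q]
    by (simp add: lookup_add sum.distrib distrib_right)
qed

lemma lin_ext_scale: "lin_ext h (pscale c p) = c * lin_ext h p"
  using lin_ext_superset[OF _ keys_pscale[of c p], of h] by (simp add: lin_ext_def sum_distrib_left mult.assoc)

lemma lin_ext_mono_pol [simp]: "lin_ext h (mono_pol u) = h u"
  by (simp add: lin_ext_def lookup_mono_pol)

lemma lin_ext_diff: "lin_ext h (p - q) = lin_ext h p - lin_ext h q"
  using lin_ext_add[of h "p - q" q] by (simp add: algebra_simps)

lemma subspace_lin_ext: "pv.subspace {p. lin_ext h p = 0}"
  by (auto simp: pv.subspace_def lin_ext_add lin_ext_scale) (simp add: lin_ext_def)

lemma mdeg_superset: "finite S \<Longrightarrow> keys u \<subseteq> S \<Longrightarrow> mdeg u = (\<Sum>v\<in>S. lookup u v)"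
  unfolding mdeg_def by (rule sum.mono_neutral_left) (auto simp: in_keys_iff)

lemma mdeg_add [simp]: "mdeg (u + v) = mdeg u + mdeg v"
  using mdeg_superset[of "keys u \<union> keys v"]
  by (simp add: keys_add_nat lookup_add sum.distrib)

lemma mdeg_single [simp]: "mdeg (single x n) = n"
  by (simp add: mdeg_def)

lemma mdeg_0 [simp]: "mdeg 0 = 0"
  by (simp add: mdeg_def)

lemma lookup_le_mdeg: "lookup u v \<le> mdeg u"
  unfolding mdeg_def by (cases "v \<in> keys u") (auto simp: in_keys_iff intro: member_le_sum)

lemma mdeg_eq_0_iff [simp]: "mdeg u = 0 \<longleftrightarrow> u = 0"
proof
  assume "mdeg u = 0"
  then show "u = 0" using lookup_le_mdeg[of u] by (intro poly_mapping_eqI) simp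
qed simp

lemma finite_monomials_deg: "finite X \<Longrightarrow> finite {u \<in> monomials X. mdeg u = k}"
proof -
  assume X: "finite X"
  have "finite {f. \<forall>x. (x \<in> X \<longrightarrow> f x \<in> {0..k}) \<and> (x \<notin> X \<longrightarrow> f x = 0)}"
    using X by (intro finite_set_of_finite_funs) auto
  moreover have "lookup ` {u \<in> monomials X. mdeg u = k} \<subseteq> \<dots>"
    using lookup_le_mdeg by (fastforce simp: monomials_def in_keys_iff)
  ultimately have "finite (lookup ` {u \<in> monomials X. mdeg u = k})" by (rule finite_subset[rotated])
  then show ?thesis by (rule finite_imageD) (auto intro!: inj_onI simp only: poly_mapping_eq_iff)
qed

lemma linear_order_on_max:
  assumes "linear_order_on A r" "finite S" "S \<noteq> {}" "S \<subseteq> A"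
  shows "\<exists>u\<in>S. \<forall>v\<in>S. (v, u) \<in> r"
  using assms(2-4)
proof (induction rule: finite_ne_induct)
  case (singleton x)
  then show ?case using assms(1) by (auto simp: order_on_defs refl_on_def)
next
  case (insert x F)
  then obtain u where u: "u \<in> F" "\<forall>v\<in>F. (v, u) \<in> r" by blast
  have ux: "u \<in> A" "x \<in> A" using u insert by auto
  have r: "refl_on A r" "trans r" "total_on A r" using assms(1) by (auto simp: order_on_defs)
  show ?case
  proof (cases "(x, u) \<in> r")
    case True then show ?thesis using u by (intro bexI[of _ u]) auto
  next
    case False
    then have "x \<noteq> u" using r(1) ux by (auto simp: refl_on_def)
    then have xu: "(u, x) \<in> r" using False r(3) ux by (auto simp: total_on_def)
    have "(v, x) \<in> r" if "v \<in> insert x F" for v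
      using that u(2) xu r ux by (auto simp: refl_on_def dest: transD)
    then show ?thesis by blast
  qed
qed

section \<open>Prime binomial ideals with squarefree quadratic initial ideal\<close>

locale prime_binomial_ideal =
  fixes X :: "'v set" and I :: "('v, 'k::field) pol set" and B :: "('v, 'k) pol set"
  assumes fin: "finite X"
    and B_carrier: "B \<subseteq> carrier (poly_ring X)"
    and I_gen: "I = Idl\<^bsub>poly_ring X\<^esub> B"
    and B_quad: "\<forall>b\<in>B. quadratic_binomial X b"
    and I_prime: "primeideal I (poly_ring X)"
begin

definition eqv :: "'v mon \<Rightarrow> 'v mon \<Rightarrow> bool" where
  "eqv u v \<longleftrightarrow> u \<in> monomials X \<and> v \<in> monomials X \<and> mono_pol u - mono_pol v \<in> I"

lemma I_ideal: "ideal I (poly_ring X)"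
  using I_prime by (rule primeideal.axioms(1))

lemmas I_carrier = ideal_poly_ringD(1)[OF I_ideal]
  and I_0 = ideal_poly_ringD(2)[OF I_ideal]
  and I_add = ideal_poly_ringD(3)[OF I_ideal]
  and I_mult = ideal_poly_ringD(4)[OF I_ideal]
  and I_subspace = ideal_subspace[OF I_ideal]

lemma I_keys: "f \<in> I \<Longrightarrow> u \<in> keys f \<Longrightarrow> u \<in> monomials X"
  using subsetD[OF I_carrier, of f] in_carrier_poly_ring[of f X] by blast

lemma eqv_refl: "u \<in> monomials X \<Longrightarrow> eqv u u"
  by (simp add: eqv_def I_0)

lemma eqv_sym: "eqv u v \<Longrightarrow> eqv v u"
  using pv.subspace_neg[OF I_subspace, of "mono_pol u - mono_pol v"] by (simp add: eqv_def)

lemma eqv_trans [trans]: "eqv u v \<Longrightarrow> eqv v w \<Longrightarrow> eqv u w"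
  using I_add[of "mono_pol u - mono_pol v" "mono_pol v - mono_pol w"] by (simp add: eqv_def)

lemma eqv_add: "eqv u v \<Longrightarrow> w \<in> monomials X \<Longrightarrow> eqv (u + w) (v + w)"
  using I_mult[of "mono_pol u - mono_pol v" "mono_pol w"]
  by (simp add: eqv_def algebra_simps mono_pol_mult)

text \<open>Equal degrees are demanded here because it is not yet known that equivalent monomials
  have the same degree; \<open>eqv_mdeg\<close> derives this from the fact that these binomials span
  \<open>I\<close>.\<close>

definition same_degree_binomials :: "('v, 'k) pol set" where
  "same_degree_binomials = {mono_pol u - mono_pol v | u v. eqv u v \<and> mdeg u = mdeg v}"

text \<open>A monomial multiple of such a binomial is again one, so the span is already an ideal,
  and it contains the generators.\<close>

lemma I_eq_span: "I = pv.span same_degree_binomials"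
proof
  let ?S = "pv.span same_degree_binomials"
  have SI: "?S \<subseteq> I"
    by (rule pv.span_minimal[OF _ I_subspace]) (auto simp: same_degree_binomials_def eqv_def)
  have "ideal ?S (poly_ring X)"
  proof (rule ideal_poly_ringI)
    show "?S \<subseteq> carrier (poly_ring X)" using SI I_carrier by blast
    show "q * p \<in> ?S" if p: "p \<in> ?S" and q: "q \<in> carrier (poly_ring X)" for p q
    proof -
      have "pv.subspace {p. q * p \<in> ?S}"
        unfolding pv.subspace_def
      proof (intro conjI ballI allI)
        fix c p assume "p \<in> {p. q * p \<in> ?S}"
        moreover have "q * pscale c p = pscale c (q * p)" by (simp add: pscale_def mult.left_commute)
        ultimately show "pscale c p \<in> {p. q * p \<in> ?S}" by (simp add: pv.span_scale)
      qed (simp_all add: pv.span_zero pv.span_add distrib_left)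
      moreover have "q * p \<in> ?S" if "p \<in> same_degree_binomials" for p
      proof -
        obtain u v where uv: "p = mono_pol u - mono_pol v" "eqv u v" "mdeg u = mdeg v"
          using \<open>p \<in> same_degree_binomials\<close> by (auto simp: same_degree_binomials_def)
        have "q * p = (\<Sum>w\<in>keys q. pscale (lookup q w) (mono_pol (u + w) - mono_pol (v + w)))"
        proof -
          have "q * p = (\<Sum>w\<in>keys q. pscale (lookup q w) (mono_pol w) * p)"
            using arg_cong[OF poly_mapping_sum_mono_pol[of q], of "\<lambda>q. q * p"] by (simp add: sum_distrib_right)
          moreover have "pscale c (mono_pol w) * p = pscale c (mono_pol (u + w) - mono_pol (v + w))" for c w
            unfolding pscale_def uv mono_pol_mult[symmetric] by (simp add: algebra_simps)
          ultimately show ?thesis by simp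
        qed
        also have "\<dots> \<in> ?S"
        proof (intro pv.span_sum pv.span_scale pv.span_base)
          fix w assume "w \<in> keys q"
          then have "w \<in> monomials X" using q by (auto simp: in_carrier_poly_ring)
          then show "mono_pol (u + w) - mono_pol (v + w) \<in> same_degree_binomials"
            using eqv_add[OF uv(2)] uv(3) unfolding same_degree_binomials_def
            by (intro CollectI exI[of _ "u + w"] exI[of _ "v + w"]) simp
        qed
        finally show ?thesis .
      qed
      ultimately show ?thesis using pv.span_minimal[of same_degree_binomials "{p. q * p \<in> ?S}"] p by blast
    qed
  qed (auto simp: pv.span_zero pv.span_add)
  moreover have "B \<subseteq> ?S"
  proof
    fix b assume b: "b \<in> B"
    then obtain u v where uv: "u \<in> monomials X" "v \<in> monomials X" "mdeg u = 2" "mdeg v = 2"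
      "b = mono_pol u - mono_pol v" using B_quad unfolding quadratic_binomial_def by blast
    have "b \<in> I" using b Idl_superset[OF B_carrier] by (auto simp: I_gen)
    then have "b \<in> same_degree_binomials" using uv unfolding same_degree_binomials_def eqv_def
      by (intro CollectI exI[of _ u] exI[of _ v]) simp
    then show "b \<in> ?S" by (rule pv.span_base)
  qed
  ultimately show "I \<subseteq> ?S" unfolding I_gen by (rule Idl_minimal)
  show "?S \<subseteq> I" by (rule SI)
qed

text \<open>A functional that is constant on the classes kills the spanning binomials. Suitable
  choices of \<open>h\<close> detect the degree, the sum of all coefficients, a single class, or a
  given normal form.\<close>

lemma lin_ext_I_eq_0:
  assumes f: "f \<in> I" and h: "\<And>u v. eqv u v \<Longrightarrow> mdeg u = mdeg v \<Longrightarrow> h u = h v"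
  shows "lin_ext h f = 0"
proof -
  have "same_degree_binomials \<subseteq> {p. lin_ext h p = 0}"
    using h by (auto simp: same_degree_binomials_def lin_ext_diff)
  then show ?thesis using pv.span_minimal[OF _ subspace_lin_ext[of h], of same_degree_binomials] f I_eq_span by blast
qed

lemma eqv_mdeg: "eqv u v \<Longrightarrow> mdeg u = mdeg v"
  using lin_ext_I_eq_0[of "mono_pol u - mono_pol v" "\<lambda>x. if mdeg x = mdeg u then 1 else 0"]
  by (simp add: eqv_def lin_ext_diff split: if_splits)

lemma mono_pol_notin_I: "mono_pol u \<notin> I"
  using lin_ext_I_eq_0[of "mono_pol u" "\<lambda>_. 1"] by auto

text \<open>This is where primality enters: the product of \<open>mono_pol w\<close> and the
  binomial lies in \<open>I\<close>, while no monomial does.\<close>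

lemma eqv_cancel:
  assumes "eqv (u + w) (v + w)"
  shows "eqv u v"
proof -
  have m: "u \<in> monomials X" "v \<in> monomials X" "w \<in> monomials X" using assms by (auto simp: eqv_def)
  have c: "mono_pol w \<in> carrier (poly_ring X)" "mono_pol u - mono_pol v \<in> carrier (poly_ring X)"
    using m by (auto intro: carrier_poly_ring_closed)
  have "mono_pol w * (mono_pol u - mono_pol v) \<in> I"
    using assms by (simp add: eqv_def algebra_simps mono_pol_mult)
  then show ?thesis
    using primeideal.I_prime[OF I_prime c] mono_pol_notin_I m by (simp add: eqv_def)
qed

text \<open>Otherwise the sum of the coefficients of \<open>f\<close> over the class of
  \<open>u\<close>, which vanishes on \<open>I\<close>, would reduce to the coefficient at
  \<open>u\<close>.\<close>

lemma other_key:
  assumes f: "f \<in> I" and u: "u \<in> keys f"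
  shows "\<exists>v\<in>keys f. v \<noteq> u \<and> eqv u v"
proof (rule ccontr)
  assume n: "\<not> ?thesis"
  have um: "u \<in> monomials X" using I_keys[OF f u] .
  have "lin_ext (\<lambda>x. if eqv u x then 1 else 0) f = 0"
  proof (rule lin_ext_I_eq_0[OF f])
    fix a b assume "eqv a b"
    then have "eqv u a \<longleftrightarrow> eqv u b" using eqv_trans eqv_sym by blast
    then show "(if eqv u a then 1 else 0) = (if eqv u b then 1 else (0::'k))" by simp
  qed
  moreover have "lin_ext (\<lambda>x. if eqv u x then 1 else 0) f = (\<Sum>x\<in>keys f. if x = u then lookup f u else 0)"
    unfolding lin_ext_def by (rule sum.cong) (use n eqv_refl[OF um] in auto)
  ultimately show False using u by (simp add: in_keys_iff)
qed

end

locale toric_squarefree = prime_binomial_ideal X I B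
  for X :: "'v set" and I :: "('v, 'k::field) pol set" and B :: "('v, 'k) pol set" +
  fixes r :: "'v mon rel" and M :: "'v mon set"
  assumes order: "monomial_order X r"
    and M: "M \<subseteq> {u \<in> monomials X. mdeg u = 2 \<and> squarefree_monomial u}"
    and initial: "initial_ideal X r I = Idl\<^bsub>poly_ring X\<^esub> (mono_pol ` M)"
begin

lemma lead_mon:
  assumes f: "f \<in> carrier (poly_ring X)" "f \<noteq> 0"
  shows "lead_mon r f \<in> keys f" "\<And>v. v \<in> keys f \<Longrightarrow> (v, lead_mon r f) \<in> r"
proof -
  have lin: "linear_order_on (monomials X) r" using order by (simp add: monomial_order_def)
  have k: "keys f \<subseteq> monomials X" "keys f \<noteq> {}" using f by (auto simp: in_carrier_poly_ring)
  obtain u where u: "u \<in> keys f" "\<forall>v\<in>keys f. (v, u) \<in> r"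
    using linear_order_on_max[OF lin finite_keys k(2,1)] by blast
  have as: "antisym r" using lin by (simp add: order_on_defs)
  have "lead_mon r f = u" unfolding lead_mon_def
    by (rule the_equality) (use u as in \<open>auto dest: antisymD\<close>)
  then show "lead_mon r f \<in> keys f" "\<And>v. v \<in> keys f \<Longrightarrow> (v, lead_mon r f) \<in> r" using u by auto
qed

lemma lead_mon_carrier: "f \<in> I \<Longrightarrow> f \<noteq> 0 \<Longrightarrow> lead_mon r f \<in> monomials X"
  using lead_mon(1)[of f] I_keys I_carrier by blast

lemma initial_superset: "f \<in> I \<Longrightarrow> f \<noteq> 0 \<Longrightarrow> mono_pol (lead_mon r f) \<in> (initial_ideal X r I :: ('v, 'k) pol set)"
  unfolding initial_ideal_def
  by (rule subsetD[OF Idl_superset]) (use lead_mon_carrier in auto)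

lemma M_subset: "M \<subseteq> monomials X"
  using M by blast

lemma lead_mon_divisible:
  assumes "f \<in> I" "f \<noteq> 0"
  shows "\<exists>m\<in>M. \<exists>w\<in>monomials X. lead_mon r f = m + w"
  using mono_pol_in_monomial_ideal[OF M_subset] initial_superset[OF assms] initial by simp

lemma lead_mon_in_M:
  assumes "f \<in> I" "f \<noteq> 0" "homogeneous 2 f"
  shows "lead_mon r f \<in> M"
proof -
  obtain m w where m: "m \<in> M" "lead_mon r f = m + w" using lead_mon_divisible assms by blast
  have "mdeg (lead_mon r f) = 2"
    using lead_mon(1)[of f] assms I_carrier by (auto simp: homogeneous_def)
  then have "w = 0" using m M by auto
  then show ?thesis using m by simp
qed

lemma M_divides_lead:
  assumes m: "m \<in> M"
  shows "\<exists>f\<in>I. f \<noteq> 0 \<and> (\<exists>w\<in>monomials X. m = lead_mon r f + w)"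
proof -
  define A where "A = {lead_mon r f | f. f \<in> I \<and> f \<noteq> 0}"
  have A: "A \<subseteq> monomials X" using lead_mon_carrier by (auto simp: A_def)
  have "(mono_pol m :: ('v, 'k) pol) \<in> Idl\<^bsub>poly_ring X\<^esub> (mono_pol ` M)"
    by (rule subsetD[OF Idl_superset]) (use M_subset m in auto)
  also have "\<dots> = Idl\<^bsub>poly_ring X\<^esub> (mono_pol ` A)"
    unfolding initial[symmetric] initial_ideal_def A_def by (rule arg_cong[where f = "genideal _"]) auto
  finally obtain a w where "a \<in> A" "w \<in> monomials X" "m = a + w"
    using mono_pol_in_monomial_ideal[OF A, of m, where ?'k = 'k] by blast
  then show ?thesis by (auto simp: A_def)
qed

text \<open>The complement of the graph whose edge ideal is the initial ideal; its cliques are the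
  faces of the Stanley-Reisner complex.\<close>

definition adj :: "'v \<Rightarrow> 'v \<Rightarrow> bool" where
  "adj y z \<longleftrightarrow> single y 1 + single z 1 \<notin> M"

lemma M_pair:
  assumes "m \<in> M"
  shows "\<exists>y z. y \<noteq> z \<and> y \<in> X \<and> z \<in> X \<and> m = single y 1 + single z 1"
proof -
  have m: "keys m \<subseteq> X" "mdeg m = 2" "\<And>v. lookup m v \<le> 1"
    using assms M by (auto simp: monomials_def squarefree_monomial_def)
  have l: "lookup m v = (if v \<in> keys m then 1 else 0)" for v
    using m(3)[of v] by (auto simp: in_keys_iff)
  have "mdeg m = card (keys m)" unfolding mdeg_def by (simp add: l cong: sum.cong)
  then obtain y z where yz: "keys m = {y, z}" "y \<noteq> z" using m(2) by (auto simp: card_2_iff)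
  have "m = single y 1 + single z 1"
    by (rule poly_mapping_eqI) (use yz in \<open>auto simp: l lookup_add lookup_single when_def\<close>)
  then show ?thesis using yz m(1) by auto
qed

lemma double_notin_M: "single y 1 + single y 1 \<notin> M"
proof
  assume "single y 1 + single y 1 \<in> M"
  then have "lookup (single y 1 + single y 1 :: 'v mon) y \<le> 1" using M by (auto simp: squarefree_monomial_def)
  then show False by (simp add: lookup_add)
qed

text \<open>Divisibility by a product of two distinct variables depends on the support only.\<close>

lemma standard_iff:
  assumes s: "s \<in> monomials X"
  shows "clique X adj (keys s) \<longleftrightarrow> \<not> (\<exists>m\<in>M. \<exists>w. s = m + w)"
proof
  assume c: "clique X adj (keys s)"
  show "\<not> (\<exists>m\<in>M. \<exists>w. s = m + w)"
  proof
    assume "\<exists>m\<in>M. \<exists>w. s = m + w"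
    then obtain m w where m: "m \<in> M" "s = m + w" by blast
    obtain y z where "y \<noteq> z" "m = single y 1 + single z 1" using M_pair[OF m(1)] by blast
    then show False using c m by (auto simp: clique_def adj_def keys_add_nat)
  qed
next
  assume n: "\<not> (\<exists>m\<in>M. \<exists>w. s = m + w)"
  show "clique X adj (keys s)"
    unfolding clique_def adj_def
  proof (intro conjI ballI impI notI)
    show "keys s \<subseteq> X" using s by (simp add: monomials_def)
    fix y z assume yz: "y \<in> keys s" "z \<in> keys s" "y \<noteq> z" "single y 1 + single z 1 \<in> M"
    have "s = (single y 1 + single z 1) + (s - (single y 1 + single z 1))"
      by (rule poly_mapping_eqI)
        (use yz in \<open>auto simp: lookup_add lookup_minus lookup_single when_def in_keys_iff\<close>)
    then show False using n yz(4) by blast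
  qed
qed

text \<open>The least monomial of the class is standard: if a leading monomial of some
  \<open>f\<close> in \<open>I\<close> divided it, \<open>other_key\<close> would provide a smaller
  equivalent one. The class is finite because equivalence preserves the degree.\<close>

lemma standard_ex:
  assumes u: "u \<in> monomials X"
  shows "\<exists>s. eqv u s \<and> clique X adj (keys s)"
proof -
  have lin: "linear_order_on (monomials X) r" and
    comp: "\<And>u v w. (u, v) \<in> r \<Longrightarrow> w \<in> monomials X \<Longrightarrow> (u + w, v + w) \<in> r"
    using order by (auto simp: monomial_order_def)
  define S where "S = {v. eqv u v}"
  have "S \<subseteq> {v \<in> monomials X. mdeg v = mdeg u}" using eqv_mdeg by (auto simp: S_def eqv_def)
  then have "finite S" using finite_monomials_deg[OF fin] finite_subset by blast
  moreover have "S \<noteq> {}" "S \<subseteq> monomials X" using eqv_refl[OF u] by (auto simp: S_def eqv_def)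
  ultimately obtain s where s: "s \<in> S" "\<forall>v\<in>S. (v, s) \<in> r\<inverse>"
    using linear_order_on_max[of "monomials X" "r\<inverse>" S] lin by auto
  have us: "eqv u s" using s(1) by (simp add: S_def)
  then have sm: "s \<in> monomials X" by (simp add: eqv_def)
  have "clique X adj (keys s)"
  proof (rule ccontr)
    assume "\<not> ?thesis"
    then obtain m w where m: "m \<in> M" "s = m + w" using standard_iff[OF sm] by blast
    obtain f w' where f: "f \<in> I" "f \<noteq> 0" "m = lead_mon r f + w'" using M_divides_lead[OF m(1)] by blast
    have fc: "f \<in> carrier (poly_ring X)" using f I_carrier by blast
    obtain v where v: "v \<in> keys f" "v \<noteq> lead_mon r f" "eqv (lead_mon r f) v"
      using other_key[OF f(1) lead_mon(1)[OF fc f(2)]] by blast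
    have ww: "w' + w \<in> monomials X" using sm by (simp add: m f)
    have s_eq: "s = lead_mon r f + (w' + w)" by (simp add: m f ac_simps)
    have "(v + (w' + w), s) \<in> r"
      unfolding s_eq by (intro comp ww lead_mon(2)[OF fc f(2) v(1)])
    moreover have "eqv s (v + (w' + w))" unfolding s_eq by (rule eqv_add[OF v(3) ww])
    then have "(s, v + (w' + w)) \<in> r" using s(2) eqv_trans[OF us] by (auto simp: S_def)
    ultimately have "s = v + (w' + w)" using lin by (auto simp: order_on_defs dest: antisymD)
    then show False using v(2) s_eq by simp
  qed
  then show ?thesis using us by blast
qed

text \<open>The difference of two distinct equivalent standard monomials would be a nonzero element
  of \<open>I\<close> with a standard leading monomial.\<close>

lemma standard_unique:
  assumes e: "eqv u v" and c: "clique X adj (keys u)" "clique X adj (keys v)"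
  shows "u = v"
proof (rule ccontr)
  assume ne: "u \<noteq> v"
  define f where "f = (mono_pol u - mono_pol v :: ('v, 'k) pol)"
  have m: "u \<in> monomials X" "v \<in> monomials X" and fI: "f \<in> I" using e by (auto simp: eqv_def f_def)
  have "lookup f u \<noteq> 0" using ne by (simp add: f_def lookup_minus lookup_mono_pol)
  then have f0: "f \<noteq> 0" by auto
  have "keys f \<subseteq> {u, v}"
    using keys_diff[of "mono_pol u :: ('v, 'k) pol" "mono_pol v"] by (auto simp: f_def)
  then have "lead_mon r f \<in> {u, v}" using lead_mon(1)[of f] fI f0 I_carrier by blast
  then show False using lead_mon_divisible[OF fI f0] standard_iff[OF m(1)] standard_iff[OF m(2)] c by auto
qed

sublocale flag_monoid X eqv adj
proof
  show "adj z y" if "adj y z" for y z using that by (simp add: adj_def add.commute)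
  show "u \<in> monomials X" if "eqv u v" for u v using that by (simp add: eqv_def)
qed (fact fin eqv_refl eqv_sym eqv_trans eqv_add eqv_cancel standard_ex standard_unique)+

definition homog_part :: "nat \<Rightarrow> ('v, 'k) pol set" where
  "homog_part k = {f \<in> I. homogeneous k f}"

text \<open>Macaulay's basis theorem in degree \<open>k\<close>: the differences between the
  nonstandard monomials and their normal forms are a basis.\<close>

lemma dim_homog_part:
  "pv.dim (homog_part k) + card {u \<in> monomials X. mdeg u = k \<and> clique X adj (keys u)}
    = card {u \<in> monomials X. mdeg u = k}"
proof -
  obtain nf where nf: "\<And>u. u \<in> monomials X \<Longrightarrow> eqv u (nf u)"
    "\<And>u. u \<in> monomials X \<Longrightarrow> clique X adj (keys (nf u))"
    using standard_ex by metis
  define N where "N = {u \<in> monomials X. mdeg u = k \<and> \<not> clique X adj (keys u)}"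
  define b where "b u = (mono_pol u - mono_pol (nf u) :: ('v, 'k) pol)" for u
  have nfN: "nf u \<notin> N" if "u \<in> monomials X" for u using nf(2)[OF that] by (simp add: N_def)
  have bk: "b u \<in> homog_part k" if "u \<in> N" for u
    using that nf(1)[of u] eqv_mdeg[of u "nf u"] keys_diff[of "mono_pol u :: ('v, 'k) pol" "mono_pol (nf u)"]
    by (auto simp: N_def homog_part_def b_def eqv_def homogeneous_def)
  have ind: "inj_on b N" "pv.independent (b ` N)"
  proof -
    have diag: "lookup (b u) u \<noteq> 0" and off: "v \<in> N \<Longrightarrow> u \<noteq> v \<Longrightarrow> lookup (b v) u = 0"
      if "u \<in> N" for u v
      using that nfN[of u] nfN[of v] by (auto simp: b_def lookup_minus lookup_mono_pol N_def)
    show "inj_on b N" "pv.independent (b ` N)"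
      by (rule pv.independent_functionals[where L = "\<lambda>u f. lookup f u"]; simp add: lookup_add diag off)+
  qed
  have "homog_part k \<subseteq> pv.span (b ` N)"
  proof
    fix f assume "f \<in> homog_part k"
    then have f: "f \<in> I" "\<And>u. u \<in> keys f \<Longrightarrow> mdeg u = k" by (auto simp: homog_part_def homogeneous_def)
    have km: "u \<in> monomials X" if "u \<in> keys f" for u using I_keys[OF f(1) that] .
    \<comment> \<open>The coefficients of \<open>f\<close> sum to zero over the monomials with a
      given normal form, so the combination of the normal forms vanishes and may be
      subtracted.\<close>
    have "f = (\<Sum>u\<in>keys f. pscale (lookup f u) (b u))"
    proof (rule poly_mapping_eqI)
      fix s
      have "lin_ext (\<lambda>u. if nf u = s then 1 else 0) f = 0"
      proof (rule lin_ext_I_eq_0[OF f(1)])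
        fix u v assume e: "eqv u v"
        then have m: "u \<in> monomials X" "v \<in> monomials X" by (auto simp: eqv_def)
        have "eqv (nf u) (nf v)" using eqv_trans[OF eqv_trans[OF eqv_sym[OF nf(1)[OF m(1)]] e] nf(1)[OF m(2)]] .
        then have "nf u = nf v" using standard_unique nf(2) m by blast
        then show "(if nf u = s then 1 else 0) = (if nf v = s then 1 else (0::'k))" by simp
      qed
      then have "(\<Sum>u\<in>keys f. lookup f u * (if nf u = s then 1 else 0)) = 0" by (simp add: lin_ext_def)
      moreover have "(\<Sum>u\<in>keys f. lookup f u * (if u = s then 1 else 0)) = lookup f s"
        by (auto simp: if_distrib in_keys_iff cong: if_cong)
      ultimately show "lookup f s = lookup (\<Sum>u\<in>keys f. pscale (lookup f u) (b u)) s"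
        by (simp add: lookup_sum b_def lookup_minus lookup_mono_pol right_diff_distrib sum_subtractf)
    qed
    also have "\<dots> \<in> pv.span (b ` N)"
    proof (rule pv.span_sum)
      fix u assume u: "u \<in> keys f"
      show "pscale (lookup f u) (b u) \<in> pv.span (b ` N)"
      proof (cases "u \<in> N")
        case True then show ?thesis by (intro pv.span_scale pv.span_base) auto
      next
        case False
        then have "clique X adj (keys u)" using km[OF u] f(2)[OF u] by (simp add: N_def)
        then have "nf u = u" using standard_unique[OF nf(1)[OF km[OF u]]] nf(2)[OF km[OF u]] by simp
        then show ?thesis by (simp add: b_def pv.span_zero)
      qed
    qed
    finally show "f \<in> pv.span (b ` N)" .
  qed
  then have "pv.dim (homog_part k) = card N"
    using pv.basis_card_eq_dim[of "b ` N" "homog_part k"] bk ind card_image[OF ind(1)]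
    by (metis image_subsetI)
  moreover have "card {u \<in> monomials X. mdeg u = k}
      = card N + card {u \<in> monomials X. mdeg u = k \<and> clique X adj (keys u)}"
    unfolding N_def
    by (subst card_Un_disjoint[symmetric])
      (auto intro: finite_subset[OF _ finite_monomials_deg[OF fin, of k]] arg_cong[where f = card])
  ultimately show ?thesis by simp
qed

end

section \<open>The linear strand\<close>

lemma lookup_var_mult:
  "lookup (var v * p :: ('v, 'k::field) pol) m = (if v \<in> keys m then lookup p (m - single v 1) else 0)"
proof (cases "v \<in> keys m")
  case True
  then have "m = single v 1 + (m - single v 1)"
    by (intro poly_mapping_eqI) (auto simp: lookup_add lookup_minus lookup_single when_def in_keys_iff)
  then show ?thesis using True lookup_single_mult[of "single v 1" 1 p "m - single v 1"]
    by (simp add: var_def mono_pol_def)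
next
  case False
  have "m \<notin> keys (var v * p)"
    using keys_single_mult[of m "single v 1" 1 p] False by (auto simp: var_def mono_pol_def keys_add_nat)
  then show ?thesis using False by (simp add: in_keys_iff)
qed

lemma single_pair_eq_iff:
  "single a (1::nat) + single b 1 = single c 1 + single d 1 \<longleftrightarrow> (a = c \<and> b = d) \<or> (a = d \<and> b = c)"
proof
  assume e: "single a (1::nat) + single b 1 = single c 1 + single d 1"
  have l: "lookup (single a (1::nat) + single b 1) x = lookup (single c 1 + single d 1) x" for x
    using e by simp
  show "(a = c \<and> b = d) \<or> (a = d \<and> b = c)"
    using l[of a] l[of b] l[of c] l[of d]
    by (auto simp: lookup_add lookup_single when_def split: if_splits)
qed (auto simp: add.commute)

definition mon_of :: "'v list \<Rightarrow> 'v mon" where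
  "mon_of l = sum_list (map (\<lambda>v. single v 1) l)"

lemma mon_of_append [simp]: "mon_of (l @ l') = mon_of l + mon_of l'"
  by (simp add: mon_of_def)

lemma mon_of_Cons [simp]: "mon_of [] = 0" "mon_of (v # l) = single v 1 + mon_of l"
  by (simp_all add: mon_of_def)

lemma mon_of_mset: "mset l = mset l' \<Longrightarrow> mon_of l = mon_of l'"
  unfolding mon_of_def by (metis mset_map sum_mset_sum_list)

lemma mon_of_monomials: "set l \<subseteq> X \<Longrightarrow> mon_of l \<in> monomials X"
  by (induction l) auto

context toric_squarefree begin

text \<open>The term of \<open>\<omega>\<close> of largest multidegree is a cycle over the initial ideal. It can be
  read as a \<open>1\<close>-cocycle on \<open>W\<close> vanishing on the edges of the induced graph, and this graph is
  connected.\<close>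

lemma linear_strand_vanishes:
  fixes \<omega> :: "'v list \<Rightarrow> ('v, 'k) pol"
  assumes F0: "facet F0" and i: "card X \<le> Suc n + card F0"
    and \<omega>I: "\<And>l. length l = Suc n \<Longrightarrow> set l \<subseteq> X \<Longrightarrow> \<omega> l \<in> I \<and> homogeneous 2 (\<omega> l)"
    and pm: "\<And>l l'. length l = Suc n \<Longrightarrow> set l \<subseteq> X \<Longrightarrow> mset l = mset l' \<Longrightarrow> \<omega> l = \<omega> l' \<or> \<omega> l = - \<omega> l'"
    and dist: "\<And>l. length l = Suc n \<Longrightarrow> set l \<subseteq> X \<Longrightarrow> \<not> distinct l \<Longrightarrow> \<omega> l = 0"
    and cyc: "\<And>l. length l = n \<Longrightarrow> set l \<subseteq> X \<Longrightarrow> (\<Sum>v\<in>X. var v * \<omega> (l @ [v])) = 0"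
    and l: "length l = Suc n" "set l \<subseteq> X"
  shows "\<omega> l = 0"
proof (rule ccontr)
  assume nz: "\<omega> l \<noteq> 0"
  have lin: "linear_order_on (monomials X) r" and
    comp: "\<And>u v w. (u, v) \<in> r \<Longrightarrow> w \<in> monomials X \<Longrightarrow> (u + w, v + w) \<in> r"
    using order by (auto simp: monomial_order_def)
  \<comment> \<open>A term \<open>m\<close> of \<open>\<omega> l\<close> is given the multidegree
    \<open>mon_of l + m\<close> that it has in the Koszul complex. As \<open>I\<close> need not be
    homogeneous for this grading, the largest multidegree \<open>\<gamma>\<close> that occurs is
    singled out.\<close>
  define T where "T = (SIGMA l:{l. set l \<subseteq> X \<and> length l = Suc n}. keys (\<omega> l))"
  define G where "G = (\<lambda>(l, m). mon_of l + m) ` T"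
  have "finite T" unfolding T_def by (intro finite_SigmaI finite_lists_length_eq fin) simp
  then have G1: "finite G" by (simp add: G_def)
  obtain m where "m \<in> keys (\<omega> l)" using nz by (metis all_not_in_conv keys_eq_empty)
  then have "(l, m) \<in> T" using l by (simp add: T_def)
  then have G2: "G \<noteq> {}" by (auto simp: G_def)
  have G3: "G \<subseteq> monomials X"
  proof
    fix u assume "u \<in> G"
    then obtain l m where "u = mon_of l + m" "length l = Suc n" "set l \<subseteq> X" "m \<in> keys (\<omega> l)"
      by (auto simp: G_def T_def)
    then show "u \<in> monomials X" using mon_of_monomials[of l X] I_keys \<omega>I by auto
  qed
  obtain \<gamma> where \<gamma>: "\<gamma> \<in> G" "\<And>v. v \<in> G \<Longrightarrow> (v, \<gamma>) \<in> r"
    using linear_order_on_max[OF lin G1 G2 G3] by blast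
  \<comment> \<open>In multidegree \<open>\<gamma>\<close> only leading monomials occur: a larger
    monomial in \<open>\<omega> l\<close> would produce a multidegree above
    \<open>\<gamma>\<close>.\<close>
  have top: "m \<in> M" if lm: "length l = Suc n" "set l \<subseteq> X" "m \<in> keys (\<omega> l)" "mon_of l + m = \<gamma>" for l m
  proof -
    have w: "\<omega> l \<in> I" "homogeneous 2 (\<omega> l)" "\<omega> l \<noteq> 0" using \<omega>I lm by auto
    then have wc: "\<omega> l \<in> carrier (poly_ring X)" using I_carrier by blast
    define u where "u = lead_mon r (\<omega> l)"
    have u: "u \<in> keys (\<omega> l)" "(m, u) \<in> r" "u \<in> M"
      using lead_mon[OF wc w(3)] lm(3) lead_mon_in_M[OF w(1,3,2)] by (auto simp: u_def)
    have "mon_of l + u \<in> G"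
      unfolding G_def T_def by (rule image_eqI[of _ _ "(l, u)"]) (use lm u in auto)
    then have "(mon_of l + u, \<gamma>) \<in> r" by (rule \<gamma>(2))
    moreover have "(\<gamma>, mon_of l + u) \<in> r"
      using comp[OF u(2) mon_of_monomials[OF lm(2)]] lm(4) by (simp add: add.commute)
    ultimately have "mon_of l + u = \<gamma>" using lin by (auto simp: order_on_defs dest: antisymD)
    then show ?thesis using u(3) lm(4) by (metis add_left_imp_eq)
  qed
  have rel: "(\<Sum>v\<in>keys m. lookup (\<omega> (l @ [v])) (m - single v 1)) = 0"
    if "length l = n" "set l \<subseteq> X" "m \<in> monomials X" for l m
  proof -
    have "0 = lookup (\<Sum>v\<in>X. var v * \<omega> (l @ [v])) m" using cyc[OF that(1,2)] by simp
    also have "\<dots> = (\<Sum>v\<in>X. if v \<in> keys m then lookup (\<omega> (l @ [v])) (m - single v 1) else 0)"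
      by (simp add: lookup_sum lookup_var_mult)
    also have "\<dots> = (\<Sum>v\<in>keys m. if v \<in> keys m then lookup (\<omega> (l @ [v])) (m - single v 1) else 0)"
      by (rule sum.mono_neutral_right) (use fin that(3) in \<open>auto simp: monomials_def\<close>)
    finally show ?thesis by (simp cong: sum.cong)
  qed
  have pm0: "lookup (\<omega> l) m = 0 \<longleftrightarrow> lookup (\<omega> l') m = 0"
    if "length l = Suc n" "set l \<subseteq> X" "mset l = mset l'" for l l' m
    using pm[OF that] by auto
  obtain l m where lm: "length l = Suc n" "set l \<subseteq> X" "m \<in> keys (\<omega> l)" "mon_of l + m = \<gamma>"
    using \<gamma>(1) by (auto simp: G_def T_def)
  have dl: "distinct l" using dist[OF lm(1,2)] lm(3) by fastforce
  obtain y z where yz: "y \<noteq> z" "y \<in> X" "z \<in> X" "m = single y 1 + single z 1" using M_pair top[OF lm] by blast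
  \<comment> \<open>If \<open>y\<close> occurred in \<open>l\<close>, the cycle relation at
    \<open>y^2 z\<close> would have just two terms and force \<open>y^2\<close> to occur in
    multidegree \<open>\<gamma>\<close>, although \<open>M\<close> is squarefree. Hence
    \<open>\<gamma>\<close> is squarefree.\<close>
  have notin: "y \<notin> set l" if yz: "y \<noteq> z" "y \<in> X" "z \<in> X" "m = single y 1 + single z 1" for y z
  proof
    assume y: "y \<in> set l"
    define l' where "l' = remove1 y l"
    have m': "mset (l' @ [y]) = mset l" using y by (simp add: l'_def)
    have l': "length l' = n" "set l' \<subseteq> X"
      using y lm(1,2) set_remove1_subset[of y l] by (auto simp: l'_def length_remove1)
    have k: "keys (single y 1 + single y 1 + single z 1 :: 'v mon) = {y, z}" by (auto simp: keys_add_nat)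
    have d: "single y 1 + single y 1 + single z 1 - single y 1 = m"
      "single y 1 + single y 1 + single z 1 - single z 1 = (single y 1 + single y 1 :: 'v mon)"
      by (simp_all add: yz(4) add.assoc) (metis add_diff_cancel_right' add.assoc)
    have "lookup (\<omega> (l' @ [y])) m + lookup (\<omega> (l' @ [z])) (single y 1 + single y 1) = 0"
      using rel[OF l', of "single y 1 + single y 1 + single z 1"] yz(1,2,3) unfolding k by (simp add: d del: One_nat_def)
    moreover have "lookup (\<omega> (l' @ [y])) m \<noteq> 0"
      using pm0[OF lm(1,2) m'[symmetric]] lm(3) by (simp add: in_keys_iff)
    ultimately have "single y 1 + single y 1 \<in> keys (\<omega> (l' @ [z]))" by (auto simp: in_keys_iff)
    moreover have "mon_of (l' @ [z]) + (single y 1 + single y 1) = mon_of (l' @ [y]) + m"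
      by (simp add: yz(4) ac_simps)
    then have "mon_of (l' @ [z]) + (single y 1 + single y 1) = \<gamma>"
      using mon_of_mset[OF m'] lm(4) by metis
    ultimately show False
      using top[of "l' @ [z]" "single y 1 + single y 1"] double_notin_M l' yz(3) by simp
  qed
  have yzl: "y \<notin> set l" "z \<notin> set l" using notin[of y z] notin[of z y] yz by (auto simp: add.commute)
  define W where "W = insert y (insert z (set l))"
  define Wm where "Wm = mset l + {#y, z#}"
  have WX: "W \<subseteq> X" using lm(2) yz by (auto simp: W_def)
  have cW: "card W = Suc n + 2" using yzl yz(1) dl lm(1) by (simp add: W_def distinct_card)
  \<comment> \<open>\<open>W\<close> consists of the \<open>n + 1\<close> entries of
    \<open>l\<close> and the two variables of the quadric, so \<open>i\<close> leaves at most
    \<open>card F0 - 2\<close> vertices outside.\<close>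
  have "card (X - W) + 2 \<le> card F0"
    using card_Diff_subset[OF finite_subset[OF WX fin] WX] card_mono[OF fin WX] cW i by simp
  then have path: "(y, z) \<in> {(p, q). p \<in> W \<and> q \<in> W \<and> adj p q}\<^sup>*"
    using induced_graph_connected[OF F0 WX] by (simp add: W_def)
  \<comment> \<open>\<open>P p q\<close> says that the cochain vanishes on the pair
    \<open>p\<close>, \<open>q\<close>. Quantifying over all orderings \<open>l'\<close> of the
    other vertices of \<open>W\<close> keeps signs out of the argument.\<close>
  define P where "P p q \<longleftrightarrow> (\<forall>l'. length l' = Suc n \<and> mset l' + {#p, q#} = Wm \<longrightarrow>
    lookup (\<omega> l') (single p 1 + single q 1) = 0)" for p q
  have l'X: "set l' \<subseteq> X" if "mset l' + {#p, q#} = Wm" for l' p q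
  proof -
    have "set_mset (mset l' + {#p, q#}) = set_mset Wm" using that by simp
    then show ?thesis using WX by (auto simp: Wm_def W_def)
  qed
  have g\<gamma>: "mon_of l' + (single p 1 + single q 1) = \<gamma>" if "mset l' + {#p, q#} = Wm" for l' p q
  proof -
    have "mset (l' @ [p, q]) = mset (l @ [y, z])" using that by (simp add: Wm_def)
    from mon_of_mset[OF this] show ?thesis by (simp add: lm(4)[symmetric] yz(4))
  qed
  have Padj: "P p q" if "adj p q" for p q
    unfolding P_def
  proof (intro allI impI)
    fix l' assume l': "length l' = Suc n \<and> mset l' + {#p, q#} = Wm"
    show "lookup (\<omega> l') (single p 1 + single q 1) = 0"
      using top[of l' "single p 1 + single q 1"] l' l'X[of l'] g\<gamma>[of l'] that
      by (auto simp: adj_def in_keys_iff)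
  qed
  \<comment> \<open>The cycle relation at the product of \<open>p\<close>, \<open>q\<close>,
    \<open>s\<close> is the cocycle condition on a triangle; if two of its terms vanish, so does the
    third.\<close>
  have Ptri: "P p s" if pqs: "p \<noteq> q" "q \<noteq> s" "p \<noteq> s" "q \<in> W" and P: "P p q" "P q s" for p q s
    unfolding P_def
  proof (intro allI impI)
    fix l' assume l': "length l' = Suc n \<and> mset l' + {#p, s#} = Wm"
    have "set_mset (mset l' + {#p, s#}) = W" using l' by (simp add: Wm_def W_def)
    then have q: "q \<in> set l'" and psX: "p \<in> X" "s \<in> X" using pqs WX by auto
    define l'' where "l'' = remove1 q l'"
    have m'': "mset (l'' @ [q]) = mset l'" using q by (simp add: l''_def)
    have l'': "length l'' = n" "set l'' \<subseteq> X"
      using q l' set_remove1_subset[of q l'] l'X[of l'] by (auto simp: l''_def length_remove1)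
    have k: "keys (single p 1 + single q 1 + single s 1 :: 'v mon) = {p, q, s}" by (auto simp: keys_add_nat)
    have e: "single p 1 + single q 1 + single s 1 = single p 1 + (single q 1 + single s 1 :: 'v mon)"
      "single p 1 + single q 1 + single s 1 = single q 1 + (single p 1 + single s 1 :: 'v mon)"
      "single p 1 + single q 1 + single s 1 = single s 1 + (single p 1 + single q 1 :: 'v mon)"
      by (simp_all add: ac_simps)
    have d: "single p 1 + single q 1 + single s 1 - single p 1 = (single q 1 + single s 1 :: 'v mon)"
      "single p 1 + single q 1 + single s 1 - single q 1 = (single p 1 + single s 1 :: 'v mon)"
      "single p 1 + single q 1 + single s 1 - single s 1 = (single p 1 + single q 1 :: 'v mon)"
      by (subst e, rule add_diff_cancel_left')+
    have "lookup (\<omega> (l'' @ [p])) (single q 1 + single s 1)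
        + (lookup (\<omega> (l'' @ [q])) (single p 1 + single s 1)
        + lookup (\<omega> (l'' @ [s])) (single p 1 + single q 1)) = 0"
      using rel[OF l'', of "single p 1 + single q 1 + single s 1"] pqs psX WX
      unfolding k by (auto simp: d simp del: One_nat_def)
    moreover have "lookup (\<omega> (l'' @ [p])) (single q 1 + single s 1) = 0"
      by (rule P(2)[unfolded P_def, rule_format]) (use l' l''(1) m'' in \<open>auto simp: add_mset_commute\<close>)
    moreover have "lookup (\<omega> (l'' @ [s])) (single p 1 + single q 1) = 0"
      by (rule P(1)[unfolded P_def, rule_format]) (use l' l''(1) m'' in \<open>auto simp: add_mset_commute\<close>)
    ultimately have "lookup (\<omega> (l'' @ [q])) (single p 1 + single s 1) = 0" by simp
    then show "lookup (\<omega> l') (single p 1 + single s 1) = 0"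
      by (subst pm0[OF conjunct1[OF l'] l'X[OF conjunct2[OF l']] m''[symmetric]])
  qed
  \<comment> \<open>The vanishing spreads from the edges along a path from \<open>y\<close> to
    \<open>z\<close>; the alternative \<open>z = y\<close> covers the degenerate stages of the
    induction.\<close>
  have "z = y \<or> P y z"
    using path
  proof induction
    case base then show ?case by simp
  next
    case (step q s)
    then have q: "q \<in> W" "adj q s" by auto
    show ?case
    proof (cases "s = y \<or> s = q \<or> q = y")
      case True then show ?thesis using step.IH Padj q(2) by auto
    next
      case False then show ?thesis using step.IH Ptri[of y q s] Padj q by auto
    qed
  qed
  then have "P y z" using yz(1) by simp
  then have "lookup (\<omega> l) m = 0" using lm(1) by (simp add: P_def Wm_def yz(4))
  then show False using lm(3) by (simp add: in_keys_iff)
qed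

end

section \<open>Scalar matrices of a linear resolution and the Koszul cycles they define\<close>

lemma single_0_sum: "single 0 (\<Sum>i\<in>A. f i) = (\<Sum>i\<in>A. single 0 (f i) :: ('v, 'k::field) pol)"
  by (induction A rule: infinite_finite_induct) (simp_all add: single_add)

lemma single_0_mult: "single 0 (a * b) = (single 0 a * single 0 b :: ('v, 'k::field) pol)"
  by (simp add: mult_single)

lemma mdeg_eq_1D:
  assumes "mdeg u = 1"
  shows "\<exists>v\<in>keys u. u = single v 1"
proof -
  have "u \<noteq> 0" using assms by auto
  then obtain v where v: "v \<in> keys u" by (metis all_not_in_conv keys_eq_empty)
  then have u: "u = single v 1 + (u - single v 1)"
    by (intro poly_mapping_eqI) (auto simp: lookup_add lookup_minus lookup_single when_def in_keys_iff)
  have "mdeg u = 1 + mdeg (u - single v 1)" by (subst u) simp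
  then have "u - single v 1 = 0" using assms by simp
  then show ?thesis using u v by (metis add.right_neutral)
qed

lemma single_1_eq_iff: "single v (1::nat) = single w 1 \<longleftrightarrow> v = w"
proof
  assume "single v (1::nat) = single w 1"
  then have "keys (single v (1::nat)) = keys (single w (1::nat))" by simp
  then show "v = w" by simp
qed simp

lemma linear_form_eq:
  assumes X: "finite X" and p: "(p :: ('v, 'k::field) pol) \<in> carrier (poly_ring X)"
    "\<And>u. u \<in> keys p \<Longrightarrow> mdeg u = 1"
  shows "p = (\<Sum>v\<in>X. var v * single 0 (lookup p (single v 1)))"
proof (rule poly_mapping_eqI)
  fix m
  have "var v * single 0 c = (single (single v 1) c :: ('v, 'k) pol)" for v c
    by (simp add: var_def mono_pol_def mult_single)
  then have *: "lookup (\<Sum>v\<in>X. var v * single 0 (lookup p (single v 1))) m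
    = (\<Sum>v\<in>X. if single v 1 = m then lookup p m else 0)"
    by (simp add: lookup_sum lookup_single when_def) (rule sum.cong, auto)
  show "lookup p m = lookup (\<Sum>v\<in>X. var v * single 0 (lookup p (single v 1))) m"
  proof (cases "m \<in> keys p")
    case True
    then obtain v where v: "v \<in> keys m" "m = single v 1" using p(2) mdeg_eq_1D by blast
    have "v \<in> X" using True v p(1) by (auto simp: in_carrier_poly_ring monomials_def)
    have "(\<Sum>v\<in>X. if single v 1 = m then lookup p m else 0) = (\<Sum>w\<in>X. if w = v then lookup p m else 0)"
      by (rule sum.cong) (simp_all only: v(2) single_1_eq_iff)
    then show ?thesis unfolding * using \<open>v \<in> X\<close> X by simp
  next
    case False
    then have "lookup p m = 0" by (simp add: in_keys_iff)
    then show ?thesis unfolding * \<open>lookup p m = 0\<close> by simp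
  qed
qed

text \<open>Linear entries contribute nothing to the constant term. This is the form in which
  minimality of the resolution is used.\<close>

lemma no_linear_combination_const:
  assumes "\<And>k u. k < n \<Longrightarrow> u \<in> keys (p k :: ('v, 'k::field) pol) \<Longrightarrow> mdeg u = 1"
    and "single 0 c = (\<Sum>k<n. p k * z k)"
  shows "c = 0"
proof -
  have "lookup (p k * z k) 0 = 0" if "k < n" for k
  proof (rule ccontr)
    assume "lookup (p k * z k) 0 \<noteq> 0"
    then have "0 \<in> keys (p k * z k)" by (simp add: in_keys_iff)
    then obtain a c where "0 = a + c" "a \<in> keys (p k)" using keys_mult by blast
    then show False using assms(1)[OF that, of a] by (metis add_is_0 mdeg_0 mdeg_add zero_neq_one)
  qed
  then show ?thesis using arg_cong[OF assms(2), of "\<lambda>p. lookup p 0"] by (simp add: lookup_sum)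
qed

text \<open>These are the coefficients of \<open>v^2\<close> and of \<open>v w\<close>. The first is
  stated separately because in characteristic two it does not follow from the second.\<close>

lemma quadric_coefficients_zero:
  assumes X: "finite X" and v: "v \<in> X" "w \<in> X"
    and z: "(\<Sum>y\<in>X. var y * (\<Sum>x\<in>X. var x * single 0 (c x y :: 'k::field))) = 0"
  shows "c v v = 0" "c v w + c w v = 0"
proof -
  have t: "var y * (var x * single 0 d) = (single (single y 1 + single x 1) d :: ('v, 'k) pol)" for x y d
    by (simp add: var_def mono_pol_def mult_single)
  have s: "(\<Sum>y\<in>X. \<Sum>x\<in>X. if single y (1::nat) + single x 1 = single v 1 + single w 1 then c x y else 0) = 0"
    for v w
    using arg_cong[OF z, of "\<lambda>p. lookup p (single v 1 + single w 1)"]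
    by (simp add: sum_distrib_left t lookup_sum lookup_single when_def del: One_nat_def)
  have "(\<Sum>y\<in>X. \<Sum>x\<in>X. if single y (1::nat) + single x 1 = single v 1 + single v 1 then c x y else 0)
    = (\<Sum>y\<in>X. if y = v then (\<Sum>x\<in>X. if x = v then c x y else 0) else 0)"
    by (intro sum.cong refl) (auto simp: single_pair_eq_iff simp del: One_nat_def intro!: sum.cong sum.neutral)
  then show cv: "c v v = 0" using s[of v v] X v by simp
  show "c v w + c w v = 0"
  proof (cases "v = w")
    case True then show ?thesis using cv by simp
  next
    case False
    have "(\<Sum>y\<in>X. \<Sum>x\<in>X. if single y (1::nat) + single x 1 = single v 1 + single w 1 then c x y else 0)
      = (\<Sum>y\<in>X. (if y = v then (\<Sum>x\<in>X. if x = w then c x y else 0) else 0)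
         + (if y = w then (\<Sum>x\<in>X. if x = v then c x y else 0) else 0))"
      using False
      by (intro sum.cong refl) (auto simp: single_pair_eq_iff simp del: One_nat_def intro!: sum.cong sum.neutral)
    also have "\<dots> = c w v + c v w" using X v by (simp add: sum.distrib)
    finally show ?thesis using s[of v w] by (simp add: add.commute)
  qed
qed

text \<open>The shifts \<open>d i j = 2 + i\<close> are built in: the generators are quadrics and
  all matrix entries are linear forms.\<close>

locale linear_res = toric_squarefree X I B r M
  for X :: "'v set" and I :: "('v, 'k::field) pol set" and B :: "('v, 'k) pol set"
    and r :: "'v mon rel" and M :: "'v mon set" +
  fixes b :: "nat \<Rightarrow> nat" and g :: "nat \<Rightarrow> ('v, 'k) pol" and phi :: "nat \<Rightarrow> nat \<Rightarrow> nat \<Rightarrow> ('v, 'k) pol"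
  assumes g_carrier: "j < b 0 \<Longrightarrow> g j \<in> carrier (poly_ring X)"
    and g_homogeneous: "j < b 0 \<Longrightarrow> homogeneous 2 (g j)"
    and phi_carrier: "j < b i \<Longrightarrow> k < b (Suc i) \<Longrightarrow> phi i j k \<in> carrier (poly_ring X)"
    and phi_linear: "j < b i \<Longrightarrow> k < b (Suc i) \<Longrightarrow> u \<in> keys (phi i j k) \<Longrightarrow> mdeg u = 1"
    and I_image: "I = {\<Sum>j<b 0. g j * w j | w. w \<in> free_elems X (b 0)}"
    and exact_0: "w \<in> free_elems X (b 0) \<Longrightarrow> (\<Sum>j<b 0. g j * w j) = 0 \<longleftrightarrow>
        (\<exists>z\<in>free_elems X (b 1). \<forall>j<b 0. w j = (\<Sum>k<b 1. phi 0 j k * z k))"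
    and exact_Suc: "w \<in> free_elems X (b (Suc i)) \<Longrightarrow>
        (\<forall>j<b i. (\<Sum>k<b (Suc i). phi i j k * w k) = 0) \<longleftrightarrow>
        (\<exists>z\<in>free_elems X (b (Suc (Suc i))).
           \<forall>k<b (Suc i). w k = (\<Sum>l<b (Suc (Suc i)). phi (Suc i) k l * z l))"
begin

lemma const_free: "(\<lambda>k. single 0 (\<kappa> k)) \<in> free_elems X n"
  by (simp add: free_elems_def single_0_carrier)

lemma phi_image_free:
  assumes "z \<in> free_elems X (b (Suc i))"
  shows "(\<lambda>j. \<Sum>k<b (Suc i). phi i j k * z k) \<in> free_elems X (b i)"
proof -
  have "(\<Sum>k\<in>A. phi i j k * z k) \<in> carrier (poly_ring X)"
    if "j < b i" "A \<subseteq> {..<b (Suc i)}" for j A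
    using finite_subset[OF that(2) finite_lessThan] that(2)
  proof induction
    case empty then show ?case using ideal_poly_ringD(2)[OF I_ideal] I_carrier by auto
  next
    case (insert k A)
    then show ?case
      using assms that(1) by (auto simp: free_elems_def intro!: carrier_poly_ring_closed phi_carrier)
  qed
  then show ?thesis by (simp add: free_elems_def)
qed

text \<open>Since the entries of \<open>phi i\<close> are linear forms, \<open>phi i = (\<Sum>v\<in>X. v \<cdot> linear_coeff i v)\<close> with scalar
  matrices \<open>linear_coeff i v\<close>; these anticommute because consecutive maps compose to zero.\<close>

definition linear_coeff :: "nat \<Rightarrow> 'v \<Rightarrow> (nat \<Rightarrow> 'k) \<Rightarrow> nat \<Rightarrow> 'k" where
  "linear_coeff i v \<kappa> j = (if j < b i then (\<Sum>k<b (Suc i). lookup (phi i j k) (single v 1) * \<kappa> k) else 0)"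

lemma phi_const:
  assumes "j < b i"
  shows "(\<Sum>k<b (Suc i). phi i j k * single 0 (\<kappa> k)) = (\<Sum>v\<in>X. var v * single 0 (linear_coeff i v \<kappa> j))"
proof -
  have "(\<Sum>k<b (Suc i). phi i j k * single 0 (\<kappa> k))
    = (\<Sum>k<b (Suc i). \<Sum>v\<in>X. var v * single 0 (lookup (phi i j k) (single v 1) * \<kappa> k))"
  proof (rule sum.cong)
    fix k assume "k \<in> {..<b (Suc i)}"
    then have "phi i j k = (\<Sum>v\<in>X. var v * single 0 (lookup (phi i j k) (single v 1)))"
      using linear_form_eq[OF fin phi_carrier[of j i k] phi_linear[of j i k]] assms by simp
    from arg_cong[OF this, of "\<lambda>p. p * single 0 (\<kappa> k)"]
    show "phi i j k * single 0 (\<kappa> k) = (\<Sum>v\<in>X. var v * single 0 (lookup (phi i j k) (single v 1) * \<kappa> k))"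
      by (simp add: sum_distrib_right single_0_mult mult.assoc)
  qed simp
  also have "\<dots> = (\<Sum>v\<in>X. \<Sum>k<b (Suc i). var v * single 0 (lookup (phi i j k) (single v 1) * \<kappa> k))"
    by (rule sum.swap)
  finally show ?thesis by (simp add: linear_coeff_def assms single_0_sum sum_distrib_left)
qed

lemma phi_phi:
  assumes "z \<in> free_elems X (b (Suc (Suc i)))" "j < b i"
  shows "(\<Sum>k<b (Suc i). phi i j k * (\<Sum>l<b (Suc (Suc i)). phi (Suc i) k l * z l)) = 0"
  using exact_Suc[OF phi_image_free[OF assms(1)]] assms by blast

lemma g_phi:
  assumes "z \<in> free_elems X (b (Suc 0))"
  shows "(\<Sum>j<b 0. g j * (\<Sum>k<b (Suc 0). phi 0 j k * z k)) = 0"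
  using exact_0[OF phi_image_free[OF assms]] assms by auto

lemma linear_coeff_quadric:
  assumes "j < b i"
  shows "(\<Sum>w\<in>X. var w * (\<Sum>v\<in>X. var v * single 0 (linear_coeff i v (linear_coeff (Suc i) w \<kappa>) j))) = 0"
proof -
  have "0 = (\<Sum>k<b (Suc i). phi i j k * (\<Sum>l<b (Suc (Suc i)). phi (Suc i) k l * single 0 (\<kappa> l)))"
    using phi_phi[OF const_free assms, of \<kappa>] by simp
  also have "\<dots> = (\<Sum>k<b (Suc i). \<Sum>w\<in>X. var w * (phi i j k * single 0 (linear_coeff (Suc i) w \<kappa> k)))"
    by (rule sum.cong) (simp_all add: phi_const sum_distrib_left mult.left_commute)
  also have "\<dots> = (\<Sum>w\<in>X. \<Sum>k<b (Suc i). var w * (phi i j k * single 0 (linear_coeff (Suc i) w \<kappa> k)))"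
    by (rule sum.swap)
  also have "\<dots> = (\<Sum>w\<in>X. var w * (\<Sum>v\<in>X. var v * single 0 (linear_coeff i v (linear_coeff (Suc i) w \<kappa>) j)))"
    by (simp add: sum_distrib_left[symmetric] phi_const[OF assms])
  finally show ?thesis by simp
qed

lemma linear_coeff_anti:
  assumes "v \<in> X" "w \<in> X"
  shows "linear_coeff i v (linear_coeff (Suc i) v \<kappa>) = (\<lambda>_. 0)" "linear_coeff i v (linear_coeff (Suc i) w \<kappa>) = (\<lambda>j. - linear_coeff i w (linear_coeff (Suc i) v \<kappa>) j)"
proof -
  have "linear_coeff i v (linear_coeff (Suc i) v \<kappa>) j = 0 \<and> linear_coeff i v (linear_coeff (Suc i) w \<kappa>) j = - linear_coeff i w (linear_coeff (Suc i) v \<kappa>) j" for j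
  proof (cases "j < b i")
    case True
    have q: "linear_coeff i v (linear_coeff (Suc i) v \<kappa>) j = 0"
      "linear_coeff i v (linear_coeff (Suc i) w \<kappa>) j + linear_coeff i w (linear_coeff (Suc i) v \<kappa>) j = 0"
      using quadric_coefficients_zero[OF fin assms, of "\<lambda>v w. linear_coeff i v (linear_coeff (Suc i) w \<kappa>) j"]
        linear_coeff_quadric[OF True] by blast+
    then show ?thesis using add_eq_0_iff2 by blast
  next
    case False then show ?thesis by (simp add: linear_coeff_def)
  qed
  then show "linear_coeff i v (linear_coeff (Suc i) v \<kappa>) = (\<lambda>_. 0)"
    "linear_coeff i v (linear_coeff (Suc i) w \<kappa>) = (\<lambda>j. - linear_coeff i w (linear_coeff (Suc i) v \<kappa>) j)" by auto
qed

lemma linear_coeff_scale: "linear_coeff i v (\<lambda>k. s * \<kappa> k) = (\<lambda>j. s * linear_coeff i v \<kappa> j)"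
  by (auto simp: linear_coeff_def fun_eq_iff sum_distrib_left mult.left_commute)

text \<open>The action of the exterior algebra on the linear strand known from the
  Bernstein-Gelfand-Gelfand correspondence. Every variable of the list lowers the homological degree
  by one, so a list of length \<open>i\<close> leads from constant vectors of the
  \<open>i\<close>-th module to those of the \<open>0\<close>-th. The last clause is a default for
  lists that are too long.\<close>

fun contract :: "nat \<Rightarrow> 'v list \<Rightarrow> (nat \<Rightarrow> 'k) \<Rightarrow> nat \<Rightarrow> 'k" where
  "contract i [] \<kappa> = \<kappa>"
| "contract (Suc i) (v # l) \<kappa> = contract i l (linear_coeff i v \<kappa>)"
| "contract 0 (v # l) \<kappa> = (\<lambda>_. 0)"

lemma contract_scale: "contract i l (\<lambda>k. s * \<kappa> k) = (\<lambda>j. s * contract i l \<kappa> j)"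
  by (induction i l \<kappa> rule: contract.induct) (simp_all add: linear_coeff_scale)

lemma contract_append: "length l \<le> i \<Longrightarrow> contract i (l @ l') \<kappa> = contract (i - length l) l' (contract i l \<kappa>)"
  by (induction i l \<kappa> rule: contract.induct) simp_all

text \<open>By anticommutation \<open>x\<close> passes the entries of \<open>p\<close> one at a
  time. The sign stays existential, as \<open>linear_strand_vanishes\<close> asks for symmetry up to
  sign only.\<close>

lemma contract_move:
  "length (p @ x # q) \<le> i \<Longrightarrow> set (p @ x # q) \<subseteq> X \<Longrightarrow>
    \<exists>s\<in>{1, -1}. \<forall>\<kappa>. contract i (p @ x # q) \<kappa> = (\<lambda>j. s * contract i (x # p @ q) \<kappa> j)"
proof (induction p arbitrary: i)
  case Nil
  show ?case by (intro bexI[of _ 1]) auto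
next
  case (Cons y p)
  obtain i' where i': "i = Suc (Suc i')" using Cons.prems(1) by (metis Suc_le_D append_Cons le_SucE length_Cons length_append
    add_Suc_right Suc_le_mono)
  obtain s where s: "s \<in> {1, -1}" "\<And>\<kappa>. contract (Suc i') (p @ x # q) \<kappa> = (\<lambda>j. s * contract (Suc i') (x # p @ q) \<kappa> j)"
    using Cons.IH[of "Suc i'"] Cons.prems unfolding i' by fastforce
  have "contract i ((y # p) @ x # q) \<kappa> = (\<lambda>j. (- s) * contract i (x # (y # p) @ q) \<kappa> j)" for \<kappa>
  proof -
    have "contract i ((y # p) @ x # q) \<kappa> = (\<lambda>j. s * contract i' (p @ q) (linear_coeff i' x (linear_coeff (Suc i') y \<kappa>)) j)"
      using s(2) by (simp add: i')
    also have "linear_coeff i' x (linear_coeff (Suc i') y \<kappa>) = (\<lambda>k. (- 1) * linear_coeff i' y (linear_coeff (Suc i') x \<kappa>) k)"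
      using linear_coeff_anti(2)[of x y] Cons.prems by simp
    finally show ?thesis unfolding contract_scale by (simp add: i')
  qed
  then show ?case using s(1) by (intro bexI[of _ "- s"]) auto
qed

lemma contract_mset:
  "length l \<le> i \<Longrightarrow> set l \<subseteq> X \<Longrightarrow> mset l = mset l' \<Longrightarrow>
    \<exists>s\<in>{1, -1}. \<forall>\<kappa>. contract i l \<kappa> = (\<lambda>j. s * contract i l' \<kappa> j)"
proof (induction l arbitrary: i l')
  case Nil
  then show ?case by (intro bexI[of _ 1]) auto
next
  case (Cons x l)
  obtain i' where i': "i = Suc i'" using Cons.prems(1) by (cases i) auto
  have "x \<in> set l'" using Cons.prems(3) by (metis list.set_intros(1) mset_eq_setD)
  then obtain p q where l': "l' = p @ x # q" by (meson split_list)
  have m: "mset l = mset (p @ q)" using Cons.prems(3) by (simp add: l')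
  have "set l' = set (x # l)" "length l' = length (x # l)"
    using Cons.prems(3) mset_eq_setD mset_eq_length by metis+
  then have "\<exists>s\<in>{1, -1}. \<forall>\<kappa>. contract i l' \<kappa> = (\<lambda>j. s * contract i (x # p @ q) \<kappa> j)"
    unfolding l' by (intro contract_move) (use Cons.prems in auto)
  then obtain s where s: "s \<in> {1, -1}" "\<And>\<kappa>. contract i l' \<kappa> = (\<lambda>j. s * contract i (x # p @ q) \<kappa> j)"
    by blast
  obtain t where t: "t \<in> {1, -1}" "\<And>\<kappa>. contract i' l \<kappa> = (\<lambda>j. t * contract i' (p @ q) \<kappa> j)"
    using Cons.IH[OF _ _ m, of i'] Cons.prems unfolding i' by fastforce
  have ss: "s * s = 1" using s(1) by auto
  have "contract i (x # l) \<kappa> = (\<lambda>j. (t * s) * contract i l' \<kappa> j)" for \<kappa>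
    using s(2)[of \<kappa>] t(2) by (simp add: i' mult.assoc) (simp add: mult.assoc[symmetric] ss)
  then show ?case using s(1) t(1) by (intro bexI[of _ "t * s"]) auto
qed

lemma contract_0: "contract i l (\<lambda>_. 0) = (\<lambda>_. 0)"
  using contract_scale[of i l 0 "\<lambda>_. 0"] by simp

text \<open>Two occurrences of a variable are moved to the front, where their matrices compose to
  zero.\<close>

lemma contract_not_distinct:
  assumes l: "length l \<le> i" "set l \<subseteq> X" "\<not> distinct l"
  shows "contract i l \<kappa> = (\<lambda>_. 0)"
proof -
  obtain p x q t where d: "l = p @ [x] @ q @ [x] @ t" using not_distinct_decomp[OF l(3)] by blast
  have "mset l = mset (x # x # p @ q @ t)" by (simp add: d)
  then obtain s where s: "\<And>\<kappa>. contract i l \<kappa> = (\<lambda>j. s * contract i (x # x # p @ q @ t) \<kappa> j)"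
    using contract_mset[OF l(1,2)] by blast
  obtain i' where i': "i = Suc (Suc i')" using l(1) d by (cases i; cases "i - 1") auto
  have "x \<in> X" using l(2) d by simp
  then show ?thesis unfolding s[of \<kappa>] unfolding i' by (simp add: linear_coeff_anti(1) contract_0)
qed

text \<open>As a function of \<open>l\<close> of length \<open>i\<close>, this is the Koszul cycle
  with values in the quadrics of \<open>I\<close> that corresponds, up to sign, to the constant
  vector \<open>\<kappa>\<close> of the \<open>i\<close>-th module when Tor is computed in two
  ways.\<close>

definition omega :: "nat \<Rightarrow> (nat \<Rightarrow> 'k) \<Rightarrow> 'v list \<Rightarrow> ('v, 'k) pol" where
  "omega i \<kappa> l = (\<Sum>j<b 0. g j * single 0 (contract i l \<kappa> j))"

lemma omega_I: "omega i \<kappa> l \<in> I"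
  unfolding omega_def 
  by (subst I_image, rule CollectI, rule exI[of _ "\<lambda>j. single 0 (contract i l \<kappa> j)"]) (simp add: const_free)

lemma omega_homogeneous: "homogeneous 2 (omega i \<kappa> l)"
  unfolding homogeneous_def
proof
  fix u assume "u \<in> keys (omega i \<kappa> l)"
  then obtain j where j: "j < b 0" "u \<in> keys (g j * single 0 (contract i l \<kappa> j))"
    using keys_sum[of "\<lambda>j. g j * single 0 (contract i l \<kappa> j)" "{..<b 0}"] by (auto simp: omega_def)
  then have "u \<in> keys (pscale (contract i l \<kappa> j) (g j))" by (simp add: pscale_def mult.commute)
  then show "mdeg u = 2" using g_homogeneous[OF j(1)] keys_pscale by (auto simp: homogeneous_def)
qed

text \<open>A nonzero constant vector is not in the image of the next map, whose entries are linear,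
  so by exactness the map out of its module does not kill it, and contracting with some variable
  gives a nonzero vector one level lower. At the bottom the same argument shows that
  \<open>g\<close> does not kill it.\<close>

lemma omega_nonzero:
  "k < b i \<Longrightarrow> \<kappa> k \<noteq> 0 \<Longrightarrow> \<exists>l. length l = i \<and> set l \<subseteq> X \<and> omega i \<kappa> l \<noteq> 0"
proof (induction i arbitrary: \<kappa> k)
  case 0
  have "omega 0 \<kappa> [] \<noteq> 0"
  proof
    assume "omega 0 \<kappa> [] = 0"
    then obtain z where "single 0 (\<kappa> k) = (\<Sum>l<b 1. phi 0 k l * z l)"
      using exact_0[OF const_free, of \<kappa>] 0(1) by (auto simp: omega_def)
    then have "\<kappa> k = 0"
      by (rule no_linear_combination_const[rotated]) (use phi_linear[of k 0] 0(1) in auto)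
    then show False using 0(2) by simp
  qed
  then show ?case by (intro exI[of _ "[]"]) simp
next
  case (Suc i)
  have "\<exists>v\<in>X. \<exists>j<b i. linear_coeff i v \<kappa> j \<noteq> 0"
  proof (rule ccontr)
    assume "\<not> ?thesis"
    then have "\<forall>j<b i. (\<Sum>k<b (Suc i). phi i j k * single 0 (\<kappa> k)) = 0" by (simp add: phi_const)
    then obtain z where "single 0 (\<kappa> k) = (\<Sum>l<b (Suc (Suc i)). phi (Suc i) k l * z l)"
      using exact_Suc[OF const_free, of i \<kappa>] Suc.prems(1) by auto
    then have "\<kappa> k = 0"
      by (rule no_linear_combination_const[rotated]) (use phi_linear[of k "Suc i"] Suc.prems(1) in auto)
    then show False using Suc.prems(2) by simp
  qed
  then obtain v j where v: "v \<in> X" "j < b i" "linear_coeff i v \<kappa> j \<noteq> 0" by blast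
  obtain l where "length l = i \<and> set l \<subseteq> X \<and> omega i (linear_coeff i v \<kappa>) l \<noteq> 0"
    using Suc.IH[OF v(2), of "linear_coeff i v \<kappa>"] v(3) by blast
  then show ?case using v(1) by (intro exI[of _ "v # l"]) (simp add: omega_def)
qed

text \<open>The appended variable is contracted last, so the sum over \<open>v\<close> reassembles
  \<open>phi 0\<close> on a constant vector, and \<open>g\<close> kills the image of
  \<open>phi 0\<close>.\<close>

lemma omega_cycle:
  assumes "length l = n"
  shows "(\<Sum>v\<in>X. var v * omega (Suc n) \<kappa> (l @ [v])) = 0"
proof -
  define \<kappa>' where "\<kappa>' = contract (Suc n) l \<kappa>"
  have c: "contract (Suc n) (l @ [v]) \<kappa> = linear_coeff 0 v \<kappa>'" for v
    using assms by (simp add: contract_append \<kappa>'_def)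
  have "(\<Sum>v\<in>X. var v * omega (Suc n) \<kappa> (l @ [v]))
    = (\<Sum>v\<in>X. \<Sum>j<b 0. g j * (var v * single 0 (linear_coeff 0 v \<kappa>' j)))"
    by (simp add: omega_def c sum_distrib_left mult.left_commute)
  also have "\<dots> = (\<Sum>j<b 0. \<Sum>v\<in>X. g j * (var v * single 0 (linear_coeff 0 v \<kappa>' j)))"
    by (rule sum.swap)
  also have "\<dots> = (\<Sum>j<b 0. g j * (\<Sum>k<b (Suc 0). phi 0 j k * single 0 (\<kappa>' k)))"
    by (simp add: phi_const sum_distrib_left)
  also have "\<dots> = 0" by (rule g_phi[OF const_free])
  finally show ?thesis .
qed

text \<open>The vector with all entries one would yield a nonzero alternating Koszul cycle, which
  \<open>linear_strand_vanishes\<close> excludes. Degrees are counted in the resolution of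
  \<open>I\<close>: position \<open>Suc n\<close> is homological degree \<open>n + 2\<close> for
  \<open>S/I\<close>.\<close>

lemma betti_eq_0:
  assumes F0: "facet F0" and i: "card X \<le> Suc n + card F0"
  shows "b (Suc n) = 0"
proof (rule ccontr)
  assume "b (Suc n) \<noteq> 0"
  then obtain l where l: "length l = Suc n" "set l \<subseteq> X" "omega (Suc n) (\<lambda>_. 1) l \<noteq> 0"
    using omega_nonzero[of 0 "Suc n" "\<lambda>_. 1"] by auto
  have "omega (Suc n) (\<lambda>_. 1) l = 0"
  proof (rule linear_strand_vanishes[OF F0 i _ _ _ _ l(1,2)])
    fix l l' assume l: "length l = Suc n" "set l \<subseteq> X" "mset l = mset (l' :: 'v list)"
    obtain s where s: "s \<in> {1, - 1}"
      "\<And>\<kappa>. contract (Suc n) l \<kappa> = (\<lambda>j. s * contract (Suc n) l' \<kappa> j)" using contract_mset[of l "Suc n" l'] l by fastforce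
    then show "omega (Suc n) (\<lambda>_. 1) l = omega (Suc n) (\<lambda>_. 1) l' \<or>
        omega (Suc n) (\<lambda>_. 1) l = - omega (Suc n) (\<lambda>_. 1) l'"
      by (auto simp: omega_def single_uminus sum_negf)
  next
    fix l assume "length l = Suc n" "set l \<subseteq> X" "\<not> distinct (l :: 'v list)"
    then show "omega (Suc n) (\<lambda>_. 1) l = 0" by (simp add: omega_def contract_not_distinct)
  qed (auto simp: omega_I omega_homogeneous omega_cycle)
  then show False using l(3) by simp
qed

end

section \<open>Hilbert series\<close>

definition fscale :: "'k::field \<Rightarrow> (nat \<Rightarrow> ('v, 'k) pol) \<Rightarrow> nat \<Rightarrow> ('v, 'k) pol" where
  "fscale c w = (\<lambda>j. pscale c (w j))"

interpretation mv: vector_space "fscale :: 'k::field \<Rightarrow> (nat \<Rightarrow> ('v, 'k) pol) \<Rightarrow> _"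
  by unfold_locales (auto simp: fscale_def fun_eq_iff pv.scale_right_distrib pv.scale_left_distrib)

interpretation mp: vector_space_pair "fscale :: 'k::field \<Rightarrow> (nat \<Rightarrow> ('v, 'k) pol) \<Rightarrow> _"
  "pscale :: 'k \<Rightarrow> ('v, 'k) pol \<Rightarrow> _" ..

interpretation mm: vector_space_pair "fscale :: 'k::field \<Rightarrow> (nat \<Rightarrow> ('v, 'k) pol) \<Rightarrow> _"
  "fscale :: 'k \<Rightarrow> (nat \<Rightarrow> ('v, 'k) pol) \<Rightarrow> _" ..

definition mon_filter :: "('v mon \<Rightarrow> bool) \<Rightarrow> ('v, 'k::field) pol \<Rightarrow> ('v, 'k) pol" where
  "mon_filter P p = (\<Sum>u\<in>keys p. if P u then single u (lookup p u) else 0)"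

lemma lookup_mon_filter: "lookup (mon_filter P p) u = (if P u then lookup p u else 0)"
proof -
  have "lookup (mon_filter P p) u = (\<Sum>x\<in>keys p. if x = u then (if P u then lookup p u else 0) else 0)"
    unfolding mon_filter_def lookup_sum by (rule sum.cong) (auto simp: lookup_single when_def)
  then show ?thesis by (auto simp: in_keys_iff)
qed

lemma keys_mon_filter: "keys (mon_filter P p) = {u \<in> keys p. P u}"
  by (auto simp: in_keys_iff lookup_mon_filter split: if_splits)

lemma mon_filter_sum: "mon_filter P (\<Sum>i\<in>A. f i) = (\<Sum>i\<in>A. mon_filter P (f i))"
  by (rule poly_mapping_eqI) (simp add: lookup_mon_filter lookup_sum)

lemma mon_filter_carrier: "p \<in> carrier (poly_ring X) \<Longrightarrow> mon_filter P p \<in> carrier (poly_ring X)"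
  by (auto simp: in_carrier_poly_ring keys_mon_filter)

text \<open>Degree conditions are written additively so that the shift by \<open>e\<close> involves
  no truncated subtraction. The lemma lets a preimage under a graded map be replaced by its
  component of the right degree.\<close>

lemma mon_filter_mult:
  assumes p: "\<And>u. u \<in> keys p \<Longrightarrow> mdeg u = e"
  shows "mon_filter (\<lambda>u. mdeg u + a = k) (p * z) = p * mon_filter (\<lambda>u. mdeg u + (a + e) = k) (z :: ('v, 'k::field) pol)"
proof (rule poly_mapping_eqI)
  fix u
  define Q where "Q = (\<lambda>u :: 'v mon. mdeg u + (a + e) = k)"
  have z: "z = mon_filter Q z + mon_filter (\<lambda>u. \<not> Q u) z"
    by (rule poly_mapping_eqI) (simp add: lookup_add lookup_mon_filter)
  have "lookup (p * mon_filter (\<lambda>u. \<not> Q u) z) u = 0" if "mdeg u + a = k"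
  proof (rule ccontr)
    assume "\<not> ?thesis"
    then have "u \<in> keys (p * mon_filter (\<lambda>u. \<not> Q u) z)" by (simp add: in_keys_iff)
    then obtain c d where cd: "u = c + d" "c \<in> keys p" "d \<in> keys (mon_filter (\<lambda>u. \<not> Q u) z)" using keys_mult by blast
    then show False using p[OF cd(2)] that by (auto simp: keys_mon_filter Q_def)
  qed
  moreover have "lookup (p * mon_filter Q z) u = 0" if "mdeg u + a \<noteq> k"
  proof (rule ccontr)
    assume "\<not> ?thesis"
    then have "u \<in> keys (p * mon_filter Q z)" by (simp add: in_keys_iff)
    then obtain c d where cd: "u = c + d" "c \<in> keys p" "d \<in> keys (mon_filter Q z)" using keys_mult by blast
    then show False using p[OF cd(2)] that by (auto simp: keys_mon_filter Q_def)
  qed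
  moreover have "lookup (p * z) u = lookup (p * mon_filter Q z) u + lookup (p * mon_filter (\<lambda>u. \<not> Q u) z) u"
    by (subst z) (simp add: distrib_left lookup_add)
  ultimately show "lookup (mon_filter (\<lambda>u. mdeg u + a = k) (p * z)) u = lookup (p * mon_filter (\<lambda>u. mdeg u + (a + e) = k) z) u"
    unfolding Q_def[symmetric] by (simp add: lookup_mon_filter)
qed

lemma mon_filter_id: "(\<And>u. u \<in> keys p \<Longrightarrow> P u) \<Longrightarrow> mon_filter P p = p"
  by (rule poly_mapping_eqI) (auto simp: lookup_mon_filter in_keys_iff)

context linear_res begin

text \<open>The basis of the \<open>i\<close>-th free module lives in degree \<open>2 + i\<close>.\<close>

definition free_part :: "nat \<Rightarrow> nat \<Rightarrow> (nat \<Rightarrow> ('v, 'k) pol) set" where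
  "free_part i k = {w. \<forall>j. if j < b i then w j \<in> carrier (poly_ring X) \<and> (\<forall>u\<in>keys (w j). mdeg u + (2 + i) = k)
     else w j = 0}"

lemma free_part_free_elems: "w \<in> free_part i k \<Longrightarrow> w \<in> free_elems X (b i)"
  unfolding free_part_def free_elems_def by (auto split: if_splits)

lemma filter_free_part:
  assumes "w \<in> free_elems X (b i)"
  shows "(\<lambda>j. if j < b i then mon_filter (\<lambda>u. mdeg u + (2 + i) = k) (w j) else 0) \<in> free_part i k"
  using assms by (auto simp: free_part_def free_elems_def keys_mon_filter intro: mon_filter_carrier)

lemma free_partD:
  assumes "w \<in> free_part i k"
  shows "w j \<in> carrier (poly_ring X)" "u \<in> keys (w j) \<Longrightarrow> mdeg u + (2 + i) = k" "\<not> j < b i \<Longrightarrow> w j = 0"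
  using assms carrier_poly_ring_closed(5) by (auto simp: free_part_def in_carrier_poly_ring dest!: spec[where x = j] split: if_splits)

lemma free_partI:
  assumes "\<And>j. j < b i \<Longrightarrow> w j \<in> carrier (poly_ring X)"
    and "\<And>j u. j < b i \<Longrightarrow> u \<in> keys (w j) \<Longrightarrow> mdeg u + (2 + i) = k" "\<And>j. \<not> j < b i \<Longrightarrow> w j = 0"
  shows "w \<in> free_part i k"
  using assms by (simp add: free_part_def)

lemma free_part_subspace: "mv.subspace (free_part i k)"
  unfolding mv.subspace_def
proof (intro conjI ballI allI)
  show "0 \<in> free_part i k" by (rule free_partI) (auto simp: in_carrier_poly_ring)
  show "v + w \<in> free_part i k" if vw: "v \<in> free_part i k" "w \<in> free_part i k" for v w
  proof (rule free_partI)
    fix j u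
    show "(v + w) j \<in> carrier (poly_ring X)"
      using free_partD(1)[OF vw(1)] free_partD(1)[OF vw(2)] by (simp add: carrier_poly_ring_closed)
    show "mdeg u + (2 + i) = k" if "u \<in> keys ((v + w) j)"
    proof -
      have "u \<in> keys (v j) \<or> u \<in> keys (w j)" using that Poly_Mapping.keys_add[of "v j" "w j"] by auto
      then show ?thesis using free_partD(2)[OF vw(1)] free_partD(2)[OF vw(2)] by blast
    qed
    show "\<not> j < b i \<Longrightarrow> (v + w) j = 0" using free_partD(3)[OF vw(1)] free_partD(3)[OF vw(2)] by simp
  qed
  show "fscale c w \<in> free_part i k" if w: "w \<in> free_part i k" for c w
  proof (rule free_partI)
    fix j u
    have k: "keys (fscale c w j) \<subseteq> keys (w j)" by (simp add: fscale_def keys_pscale)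
    then show "fscale c w j \<in> carrier (poly_ring X)"
      using free_partD(1)[OF w, of j] by (auto simp: in_carrier_poly_ring)
    show "u \<in> keys (fscale c w j) \<Longrightarrow> mdeg u + (2 + i) = k" using k free_partD(2)[OF w] by blast
    show "\<not> j < b i \<Longrightarrow> fscale c w j = 0" using free_partD(3)[OF w] by (simp add: fscale_def)
  qed
qed

definition free_index :: "nat \<Rightarrow> nat \<Rightarrow> (nat \<times> 'v mon) set" where
  "free_index i k = {..<b i} \<times> {u \<in> monomials X. mdeg u + (2 + i) = k}"

definition free_basis :: "nat \<times> 'v mon \<Rightarrow> nat \<Rightarrow> ('v, 'k) pol" where
  "free_basis = (\<lambda>(j, u) j'. if j' = j then mono_pol u else 0)"

lemma free_index_finite: "finite (free_index i k)"
  unfolding free_index_def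
  by (intro finite_cartesian_product finite_lessThan)
    (rule finite_subset[OF _ finite_monomials_deg[OF fin, of "k - (2 + i)"]], auto)

lemma free_basis_in_part: "x \<in> free_index i k \<Longrightarrow> free_basis x \<in> free_part i k"
  by (auto simp: free_index_def free_basis_def free_part_def in_carrier_poly_ring split: if_splits)

lemma free_basis_independent: "inj_on free_basis (free_index i k)" "mv.independent (free_basis ` free_index i k)"
proof -
  have *: "lookup (free_basis y (fst x)) (snd x) = (if x = y then 1 else 0)" for x y
    by (cases x; cases y) (auto simp: free_basis_def lookup_mono_pol)
  show "inj_on free_basis (free_index i k)" "mv.independent (free_basis ` free_index i k)"
    by (rule mv.independent_functionals[where L = "\<lambda>x w. lookup (w (fst x)) (snd x)"];
      simp add: * lookup_add fscale_def)+
qed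

lemma free_part_span: "free_part i k \<subseteq> mv.span (free_basis ` free_index i k)"
proof
  fix w assume w: "w \<in> free_part i k"
  have sum_app: "(\<Sum>x\<in>A. f x) j = (\<Sum>x\<in>A. f x j)" for f :: "nat \<times> 'v mon \<Rightarrow> nat \<Rightarrow> ('v, 'k) pol" and A j
    by (induction A rule: infinite_finite_induct) auto
  have "w = (\<Sum>x\<in>free_index i k. fscale (lookup (w (fst x)) (snd x)) (free_basis x))"
  proof (rule ext, rule poly_mapping_eqI)
    fix j u
    have "lookup ((\<Sum>x\<in>free_index i k. fscale (lookup (w (fst x)) (snd x)) (free_basis x)) j) u
      = (\<Sum>x\<in>free_index i k. if x = (j, u) then lookup (w j) u else 0)"
      unfolding sum_app lookup_sum
      by (rule sum.cong) (auto simp: fscale_def free_basis_def lookup_mono_pol split: if_splits)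
    also have "\<dots> = (if (j, u) \<in> free_index i k then lookup (w j) u else 0)"
      using free_index_finite by simp
    also have "\<dots> = lookup (w j) u"
      using w by (auto simp: free_index_def free_part_def in_carrier_poly_ring in_keys_iff split: if_splits
        dest!: spec[where x = j])
    finally show "lookup (w j) u = lookup ((\<Sum>x\<in>free_index i k. fscale (lookup (w (fst x)) (snd x)) (free_basis x)) j) u"
      by simp
  qed
  also have "\<dots> \<in> mv.span (free_basis ` free_index i k)"
    by (intro mv.span_sum mv.span_scale mv.span_base) auto
  finally show "w \<in> mv.span (free_basis ` free_index i k)" .
qed

lemma dim_free_part: "mv.dim (free_part i k) = b i * card {u \<in> monomials X. mdeg u + (2 + i) = k}"
proof -
  have "card (free_basis ` free_index i k) = mv.dim (free_part i k)"
    by (rule mv.basis_card_eq_dim[OF _ free_part_span free_basis_independent(2)]) (use free_basis_in_part in auto)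
  moreover have "card (free_basis ` free_index i k) = card (free_index i k)" by (rule card_image[OF free_basis_independent(1)])
  ultimately show ?thesis by (simp add: free_index_def card_cartesian_product)
qed

definition gmap :: "(nat \<Rightarrow> ('v, 'k) pol) \<Rightarrow> ('v, 'k) pol" where
  "gmap w = (\<Sum>j<b 0. g j * w j)"

definition phimap :: "nat \<Rightarrow> (nat \<Rightarrow> ('v, 'k) pol) \<Rightarrow> nat \<Rightarrow> ('v, 'k) pol" where
  "phimap i w = (\<lambda>j. if j < b i then (\<Sum>k<b (Suc i). phi i j k * w k) else 0)"

lemma linear_gmap: "Vector_Spaces.linear fscale pscale gmap"
  unfolding Vector_Spaces.linear_iff using mv.vector_space_axioms pv.vector_space_axioms
  by (auto simp: gmap_def fscale_def pscale_def sum_distrib_left distrib_left sum.distrib mult.left_commute)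

lemma linear_phimap: "Vector_Spaces.linear fscale fscale (phimap i)"
  unfolding Vector_Spaces.linear_iff using mv.vector_space_axioms
  by (auto simp: phimap_def fscale_def pscale_def sum_distrib_left distrib_left sum.distrib
      mult.left_commute fun_eq_iff)

fun kernel_part :: "nat \<Rightarrow> nat \<Rightarrow> (nat \<Rightarrow> ('v, 'k) pol) set" where
  "kernel_part 0 k = {w \<in> free_part 0 k. gmap w = 0}"
| "kernel_part (Suc i) k = {w \<in> free_part (Suc i) k. phimap i w = 0}"

lemma gmap_image: "gmap ` free_part 0 k = homog_part k"
proof
  show "gmap ` free_part 0 k \<subseteq> homog_part k"
  proof safe
    fix w assume w: "w \<in> free_part 0 k"
    have "gmap w \<in> I" by (subst I_image) (use free_part_free_elems[OF w] in \<open>auto simp: gmap_def\<close>)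
    moreover have "homogeneous k (gmap w)"
      unfolding homogeneous_def
    proof
      fix u assume "u \<in> keys (gmap w)"
      then obtain j where j: "j < b 0" "u \<in> keys (g j * w j)"
        using keys_sum[of "\<lambda>j. g j * w j" "{..<b 0}"] by (auto simp: gmap_def)
      then obtain c d where cd: "u = c + d" "c \<in> keys (g j)" "d \<in> keys (w j)" using keys_mult by blast
      have "mdeg c = 2" using g_homogeneous[OF j(1)] cd(2) by (simp add: homogeneous_def)
      moreover have "mdeg d + 2 = k" using free_partD(2)[OF w cd(3)] by simp
      ultimately show "mdeg u = k" using cd(1) by simp
    qed
    ultimately show "gmap w \<in> homog_part k" by (simp add: homog_part_def)
  qed
  show "homog_part k \<subseteq> gmap ` free_part 0 k"
  proof
    fix f assume f: "f \<in> homog_part k"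
    then have "f \<in> I" by (simp add: homog_part_def)
    then have "f \<in> {\<Sum>j<b 0. g j * w j | w. w \<in> free_elems X (b 0)}"
      by (subst (asm) I_image)
    then obtain w where w: "f = (\<Sum>j<b 0. g j * w j)" "w \<in> free_elems X (b 0)" by blast
    have "f = mon_filter (\<lambda>u. mdeg u + 0 = k) f" using f by (simp add: homog_part_def homogeneous_def mon_filter_id)
    also have "\<dots> = (\<Sum>j<b 0. mon_filter (\<lambda>u. mdeg u + 0 = k) (g j * w j))" by (simp add: w(1) mon_filter_sum)
    also have "\<dots> = gmap (\<lambda>j. if j < b 0 then mon_filter (\<lambda>u. mdeg u + (2 + 0) = k) (w j) else 0)"
      unfolding gmap_def
      by (rule sum.cong, simp, subst mon_filter_mult[where e = 2])
        (use g_homogeneous in \<open>auto simp: homogeneous_def\<close>)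
    finally show "f \<in> gmap ` free_part 0 k" using filter_free_part[OF w(2)] by blast
  qed
qed

text \<open>Exactness degree by degree: some preimage exists, and its component of the right degree
  is already a preimage. The case distinction on \<open>i\<close> separates the augmentation
  \<open>g\<close> from the maps \<open>phi\<close>.\<close>

lemma phimap_image: "phimap i ` free_part (Suc i) k = kernel_part i k"
proof
  show "phimap i ` free_part (Suc i) k \<subseteq> kernel_part i k"
  proof safe
    fix z assume z: "z \<in> free_part (Suc i) k"
    have "phimap i z \<in> free_part i k"
      unfolding free_part_def
    proof (intro CollectI allI)
      fix j
      have "mdeg u + (2 + i) = k" if j: "j < b i" and u: "u \<in> keys (\<Sum>l<b (Suc i). phi i j l * z l)" for u
      proof -
        obtain l where l: "l < b (Suc i)" "u \<in> keys (phi i j l * z l)"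
          using keys_sum[of "\<lambda>l. phi i j l * z l" "{..<b (Suc i)}"] u by auto
        then obtain c d where cd: "u = c + d" "c \<in> keys (phi i j l)" "d \<in> keys (z l)" using keys_mult by blast
        have "mdeg c = 1" using phi_linear[OF j l(1) cd(2)] .
        moreover have "mdeg d + (2 + Suc i) = k" using free_partD(2)[OF z cd(3)] .
        ultimately show ?thesis using cd(1) by simp
      qed
      then show "if j < b i then phimap i z j \<in> carrier (poly_ring X) \<and>
          (\<forall>u\<in>keys (phimap i z j). mdeg u + (2 + i) = k) else phimap i z j = 0"
        using phi_image_free[OF free_part_free_elems[OF z]] by (auto simp: phimap_def free_elems_def)
    qed
    then show "phimap i z \<in> kernel_part i k"
    proof (cases i)
      case 0
      have "gmap (phimap 0 z) = (\<Sum>j<b 0. g j * (\<Sum>k<b (Suc 0). phi 0 j k * z k))"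
        by (simp add: gmap_def phimap_def)
      then show ?thesis using \<open>phimap i z \<in> free_part i k\<close> g_phi free_part_free_elems[OF z] 0 by simp
    next
      case (Suc i')
      have "phimap i' (phimap (Suc i') z) = 0"
      proof
        fix j
        have "j < b i' \<Longrightarrow> (\<Sum>k<b (Suc i'). phi i' j k * (\<Sum>l<b (Suc (Suc i')). phi (Suc i') k l * z l)) = 0"
          using phi_phi free_part_free_elems[OF z] Suc by simp
        then show "phimap i' (phimap (Suc i') z) j = 0 j" by (simp add: phimap_def)
      qed
      then show ?thesis using \<open>phimap i z \<in> free_part i k\<close> Suc by simp
    qed
  qed
  show "kernel_part i k \<subseteq> phimap i ` free_part (Suc i) k"
  proof
    fix w assume w: "w \<in> kernel_part i k"
    then have wF: "w \<in> free_part i k" by (cases i) auto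
    have "\<exists>z\<in>free_elems X (b (Suc i)). \<forall>j<b i. w j = (\<Sum>l<b (Suc i). phi i j l * z l)"
    proof (cases i)
      case 0
      then have "w \<in> free_part 0 k" "(\<Sum>j<b 0. g j * w j) = 0" using w by (auto simp: gmap_def)
      then show ?thesis using exact_0[OF free_part_free_elems] 0 by simp
    next
      case (Suc i')
      have "(\<Sum>l<b (Suc i'). phi i' j l * w l) = 0" if "j < b i'" for j
      proof -
        have "phimap i' w j = 0" using w Suc by simp
        then show ?thesis using that by (simp add: phimap_def)
      qed
      then show ?thesis using exact_Suc[OF free_part_free_elems] wF Suc by blast
    qed
    then obtain z where z: "z \<in> free_elems X (b (Suc i))"
      "\<And>j. j < b i \<Longrightarrow> w j = (\<Sum>l<b (Suc i). phi i j l * z l)" by blast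
    define z' where "z' = (\<lambda>l. if l < b (Suc i) then mon_filter (\<lambda>u. mdeg u + (2 + Suc i) = k) (z l) else 0)"
    have "w = phimap i z'"
    proof
      fix j
      show "w j = phimap i z' j"
      proof (cases "j < b i")
        case True
        have "w j = mon_filter (\<lambda>u. mdeg u + (2 + i) = k) (w j)"
          by (rule mon_filter_id[symmetric]) (rule free_partD(2)[OF wF])
        also have "\<dots> = (\<Sum>l<b (Suc i). mon_filter (\<lambda>u. mdeg u + (2 + i) = k) (phi i j l * z l))"
          by (simp add: z(2)[OF True] mon_filter_sum)
        also have "\<dots> = (\<Sum>l<b (Suc i). phi i j l * z' l)"
        proof (rule sum.cong)
          fix l assume l: "l \<in> {..<b (Suc i)}"
          have "mon_filter (\<lambda>u. mdeg u + (2 + i) = k) (phi i j l * z l)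
            = phi i j l * mon_filter (\<lambda>u. mdeg u + (2 + i + 1) = k) (z l)"
            by (rule mon_filter_mult) (use phi_linear[OF True] l in auto)
          then show "mon_filter (\<lambda>u. mdeg u + (2 + i) = k) (phi i j l * z l) = phi i j l * z' l"
            using l by (simp add: z'_def)
        qed simp
        finally show ?thesis using True by (simp add: phimap_def)
      next
        case False then show ?thesis using wF by (auto simp: free_part_def phimap_def)
      qed
    qed
    moreover have "z' \<in> free_part (Suc i) k" unfolding z'_def by (rule filter_free_part[OF z(1)])
    ultimately show "w \<in> phimap i ` free_part (Suc i) k" by blast
  qed
qed

lemma dim_free_part_0: "mv.dim (free_part 0 k) = mv.dim (kernel_part 0 k) + pv.dim (homog_part k)"
  using mp.rank_nullity[OF linear_gmap free_part_subspace free_part_span finite_imageI[OF free_index_finite]]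
  by (simp add: gmap_image)

lemma dim_free_part_Suc: "mv.dim (free_part (Suc i) k) = mv.dim (kernel_part (Suc i) k) + mv.dim (kernel_part i k)"
  using mm.rank_nullity[OF linear_phimap free_part_subspace free_part_span finite_imageI[OF free_index_finite], of "Suc i" k i]
  by (simp add: phimap_image)

text \<open>Rank-nullity at each map makes the sum telescope; the kernel at level \<open>n\<close>
  remains as an error term.\<close>

lemma dim_homog_part_alternating:
  "int (pv.dim (homog_part k)) = (\<Sum>i\<le>n. (-1) ^ i * int (mv.dim (free_part i k))) + (-1) ^ Suc n * int (mv.dim (kernel_part n k))"
proof (induction n)
  case 0 then show ?case by (simp add: dim_free_part_0)
next
  case (Suc n)
  have "(-1) ^ Suc n * int (mv.dim (kernel_part n k))
    = (-1) ^ Suc n * int (mv.dim (free_part (Suc n) k)) + (-1) ^ Suc (Suc n) * int (mv.dim (kernel_part (Suc n) k))"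
    by (simp add: dim_free_part_Suc algebra_simps)
  then show ?case using Suc by simp
qed

text \<open>At a zero module the error term disappears and the alternating sum stops.\<close>

lemma dim_homog_part_betti:
  assumes "b c = 0"
  shows "int (pv.dim (homog_part k))
    = (\<Sum>i<c. (-1) ^ i * int (b i * card {u \<in> monomials X. mdeg u + (2 + i) = k}))"
proof -
  have F: "free_part c k = {0}" using assms by (auto simp: free_part_def fun_eq_iff)
  have "kernel_part c k \<subseteq> mv.span {}" using F by (cases c) auto
  then have "mv.dim (kernel_part c k) = 0" using mv.dim_le_card[of "kernel_part c k" "{}"] by simp
  moreover have "{..c} = insert c {..<c}" by auto
  ultimately show ?thesis
    using dim_homog_part_alternating[of k c] by (simp add: dim_free_part assms)
qed

end

section \<open>Generating functions of monomials with prescribed supports\<close>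

definition mons_supp :: "'v set \<Rightarrow> nat \<Rightarrow> 'v mon set" where
  "mons_supp C k = {u. keys u = C \<and> mdeg u = k}"

lemma mons_supp_finite: "finite C \<Longrightarrow> finite (mons_supp C k)"
  by (rule finite_subset[OF _ finite_monomials_deg[of C k]]) (auto simp: mons_supp_def monomials_def)

text \<open>Dividing by \<open>x\<close> leaves a monomial that still contains \<open>x\<close> or
  has support \<open>C\<close>.\<close>

lemma mons_supp_insert_Suc:
  assumes C: "finite C" "x \<notin> C"
  shows "card (mons_supp (insert x C) (Suc k)) = card (mons_supp (insert x C) k) + card (mons_supp C k)"
proof -
  have "mons_supp (insert x C) (Suc k) = (\<lambda>u. u + single x 1) ` (mons_supp (insert x C) k \<union> mons_supp C k)"
    (is "?L = ?R")
  proof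
    show "?R \<subseteq> ?L"
    proof
      fix u assume "u \<in> ?R"
      then obtain v where v: "u = v + single x 1" "v \<in> mons_supp (insert x C) k \<union> mons_supp C k" by blast
      have "keys u = keys v \<union> {x}" "mdeg u = Suc (mdeg v)" by (simp_all add: v(1) keys_add_nat)
      then show "u \<in> ?L" using v(2) by (auto simp: mons_supp_def)
    qed
    show "?L \<subseteq> ?R"
    proof
      fix u assume u: "u \<in> ?L"
      define v where "v = u - single x 1"
      have x: "x \<in> keys u" using u by (auto simp: mons_supp_def)
      then have uv: "u = v + single x 1"
        by (intro poly_mapping_eqI) (auto simp: v_def lookup_add lookup_minus lookup_single when_def in_keys_iff)
      have "mdeg v = k" using u by (simp add: mons_supp_def uv)
      moreover have "keys v = insert x C \<or> keys v = C"
      proof -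
        have "keys u = insert x (keys v)" by (subst uv) (simp add: keys_add_nat)
        then have "insert x (keys v) = insert x C" using u by (simp add: mons_supp_def)
        then show ?thesis using C(2) by (cases "x \<in> keys v") (simp_all add: insert_absorb insert_ident)
      qed
      ultimately have "v \<in> mons_supp (insert x C) k \<union> mons_supp C k" by (simp add: mons_supp_def)
      then show "u \<in> ?R" using uv by (rule rev_image_eqI)
    qed
  qed
  moreover have "inj_on (\<lambda>u. u + single x 1) (mons_supp (insert x C) k \<union> mons_supp C k)"
    by (simp add: inj_on_def)
  moreover have "mons_supp (insert x C) k \<inter> mons_supp C k = {}"
    using C(2) by (auto simp: mons_supp_def)
  ultimately show ?thesis
    using C by (simp add: card_image card_Un_disjoint mons_supp_finite)
qed

text \<open>The series is \<open>t / (1 - t)\<close> to the power \<open>card C\<close>;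
  denominators are cleared to remain among integer power series.\<close>

lemma fps_mons_supp:
  fixes C :: "'v set"
  assumes "finite C"
  shows "(1 - fps_X) ^ card C * Abs_fps (\<lambda>k. int (card (mons_supp C k))) = fps_X ^ card C"
  using assms
proof induction
  case empty
  have "mons_supp ({} :: 'v set) k = (if k = 0 then {0} else {})" for k
    by (auto simp: mons_supp_def)
  then show ?case by (simp add: fps_eq_iff)
next
  case (insert x C)
  have z: "mons_supp (insert x C) 0 = {}" by (auto simp: mons_supp_def)
  have "(1 - fps_X) * Abs_fps (\<lambda>k. int (card (mons_supp (insert x C) k)))
    = fps_X * Abs_fps (\<lambda>k. int (card (mons_supp C k)))"
  proof (rule fps_ext)
    fix n
    show "fps_nth ((1 - fps_X) * Abs_fps (\<lambda>k. int (card (mons_supp (insert x C) k)))) n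
      = fps_nth (fps_X * Abs_fps (\<lambda>k. int (card (mons_supp C k)))) n"
      by (cases n) (simp_all add: left_diff_distrib z mons_supp_insert_Suc[OF insert.hyps])
  qed
  then have "(1 - fps_X) ^ card (insert x C) * Abs_fps (\<lambda>k. int (card (mons_supp (insert x C) k)))
    = (1 - fps_X) ^ card C * (fps_X * Abs_fps (\<lambda>k. int (card (mons_supp C k))))"
    using insert.hyps by (simp add: mult.assoc mult.left_commute)
  also have "\<dots> = fps_X * fps_X ^ card C" by (simp add: mult.left_commute insert.IH)
  finally show ?case using insert.hyps by simp
qed

text \<open>Monomials are sorted by support. When \<open>S\<close> is the set of cliques and
  \<open>d\<close> the size of the facets, the right-hand side is the h-polynomial of the clique
  complex.\<close>

lemma fps_monomials_family:
  assumes X: "finite X" and S: "S \<subseteq> Pow X" and d: "\<And>C. C \<in> S \<Longrightarrow> card C \<le> d"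
  shows "(1 - fps_X) ^ d * Abs_fps (\<lambda>k. int (card {u. keys u \<in> S \<and> mdeg u = k}))
    = (\<Sum>C\<in>S. fps_X ^ card C * (1 - fps_X) ^ (d - card C))"
proof -
  have fS: "finite S" using S X finite_subset by blast
  have fC: "finite C" if "C \<in> S" for C using that S X finite_subset by blast
  have "int (card {u. keys u \<in> S \<and> mdeg u = k}) = (\<Sum>C\<in>S. int (card (mons_supp C k)))" for k
  proof -
    have "{u. keys u \<in> S \<and> mdeg u = k} = (\<Union>C\<in>S. mons_supp C k)" by (auto simp: mons_supp_def)
    then have "card {u. keys u \<in> S \<and> mdeg u = k} = (\<Sum>C\<in>S. card (mons_supp C k))"
      using card_UN_disjoint[OF fS, of "\<lambda>C. mons_supp C k"] fC
      by (simp add: mons_supp_finite) (auto simp: mons_supp_def)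
    then show ?thesis by simp
  qed
  then have "Abs_fps (\<lambda>k. int (card {u. keys u \<in> S \<and> mdeg u = k}))
    = (\<Sum>C\<in>S. Abs_fps (\<lambda>k. int (card (mons_supp C k))))"
    by (simp add: fps_eq_iff fps_sum_nth)
  moreover have "(1 - fps_X) ^ d * Abs_fps (\<lambda>k. int (card (mons_supp C k)))
      = fps_X ^ card C * (1 - fps_X) ^ (d - card C)" if "C \<in> S" for C
  proof -
    have pd: "(1 - fps_X :: int fps) ^ d = (1 - fps_X) ^ (d - card C) * (1 - fps_X) ^ card C"
      unfolding power_add[symmetric] using d[OF that] by (intro arg_cong2[where f = power]) simp_all
    show ?thesis unfolding pd mult.assoc fps_mons_supp[OF fC[OF that]]
      by (rule mult.commute)
  qed
  ultimately show ?thesis by (simp add: sum_distrib_left)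
qed

text \<open>The sum over all supports is the expansion of \<open>t + (1 - t)\<close> to the power
  \<open>card X\<close>.\<close>

lemma fps_all_monomials:
  assumes X: "finite X"
  shows "(1 - fps_X) ^ card X * Abs_fps (\<lambda>k. int (card {u \<in> monomials X. mdeg u = k})) = 1"
proof -
  have "{u \<in> monomials X. mdeg u = k} = {u. keys u \<in> Pow X \<and> mdeg u = k}" for k
    by (simp add: monomials_def)
  then have "(1 - fps_X) ^ card X * Abs_fps (\<lambda>k. int (card {u \<in> monomials X. mdeg u = k}))
    = (\<Sum>C\<in>Pow X. fps_X ^ card C * (1 - fps_X :: int fps) ^ (card X - card C))"
    using fps_monomials_family[OF X, of "Pow X" "card X"] card_mono[OF X] by simp
  also have "\<dots> = (\<Sum>C\<in>Pow X. (\<Prod>x\<in>C. fps_X) * (\<Prod>x\<in>X - C. 1 - fps_X))"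
    by (rule sum.cong) (use X in \<open>auto simp: card_Diff_subset finite_subset\<close>)
  also have "\<dots> = (\<Prod>x\<in>X. fps_X + (1 - fps_X))" by (rule prod_add[OF X, symmetric])
  finally show ?thesis by simp
qed

text \<open>Comparing degrees leaves \<open>h = h0 + h1 t\<close>. The coefficients of
  \<open>1\<close> and \<open>t\<close> give \<open>h0 = 1\<close> and \<open>h1 = c\<close>, and
  that of \<open>t^2\<close> then reads \<open>- coeff q 2 = (c choose 2) - c * c\<close>.\<close>

lemma linear_h_polynomial:
  fixes h q :: "int poly"
  assumes e: "[:1, -1:] ^ c * h = 1 - q" and q: "degree q \<le> Suc c" "coeff q 0 = 0" "coeff q 1 = 0"
    and c: "c > 0"
  shows "coeff q 2 = int (Suc c choose 2)"
proof -
  have h0: "h \<noteq> 0"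
  proof
    assume "h = 0"
    then have "coeff (1 - q) 0 = 0" using e by simp
    then show False using q(2) by simp
  qed
  have "degree ([:1, -1:] ^ c * h) = c + degree h"
    using h0 by (subst degree_mult_eq) (auto simp: degree_power_eq)
  moreover have "degree (1 - q) \<le> Suc c" using q(1) by (intro degree_diff_le) auto
  ultimately have "degree h \<le> 1" using e by simp
  then have "coeff h n = coeff [:coeff h 0, coeff h 1:] n" for n
    using coeff_eq_0[of h n] by (auto simp: coeff_pCons split: nat.split)
  then have "h = [:coeff h 0, coeff h 1:]" by (rule poly_eqI)
  then obtain h0 h1 where h: "h = [:h0, h1:]" by blast
  have co: "coeff ([:1, -1:] ^ c :: int poly) i = int (c choose i) * (-1) ^ i" for i
  proof (cases "i \<le> c")
    case True
    then show ?thesis by (subst coeff_linear_poly_power) simp_all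
  next
    case False
    then have "degree ([:1, -1:] ^ c :: int poly) < i" by (simp add: degree_power_eq)
    then show ?thesis using False by (simp add: coeff_eq_0 binomial_eq_0)
  qed
  have n: "coeff ([:1, -1:] ^ c * h) (Suc n)
      = h0 * coeff ([:1, -1:] ^ c) (Suc n) + h1 * coeff ([:1, -1:] ^ c) n" for n
    by (simp add: h mult.commute[of _ "[:h0, h1:]"])
  have "coeff ([:1, -1:] ^ c * h) 0 = h0" by (simp add: h coeff_mult_0 co)
  then have a: "h0 = 1" using e q(2) by simp
  have b: "h1 = int c" using n[of 0] e q(3) a by (simp add: co)
  have "- coeff q 2 = coeff ([:1, -1:] ^ c * h) (Suc 1)" using e by (simp add: numeral_2_eq_2)
  also have "\<dots> = int (c choose 2) - int c * int c" unfolding n co a b by (simp add: numeral_2_eq_2)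
  finally have "coeff q 2 = int c * int c - int (c choose 2)" by simp
  moreover have "2 * int (m choose 2) = int m * (int m - 1)" for m
    by (induction m) (simp_all add: numeral_2_eq_2 algebra_simps)
  from this[of c] this[of "Suc c"]
  have "2 * int (c choose 2) = int c * (int c - 1)" "2 * int (Suc c choose 2) = (int c + 1) * int c"
    by simp_all
  ultimately show ?thesis by (simp add: algebra_simps)
qed

lemma fps_monom_mult_nth:
  "fps_nth (fps_of_poly (monom (a :: int) m) * f) n = a * (if n < m then 0 else fps_nth f (n - m))"
  by (simp add: fps_of_poly_monom mult.assoc fps_X_power_mult_nth)

context linear_res begin

text \<open>The Hilbert series of \<open>S/I\<close> is computed twice: the resolution gives
  \<open>(1 - q) / (1 - t)^N\<close> with \<open>N = card X\<close>, and the standard monomials give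
  \<open>h / (1 - t)^d\<close> with \<open>d = card F0\<close>.\<close>

lemma dim_quadrics:
  assumes F0: "facet F0" and c: "card F0 < card X"
  shows "pv.dim (homog_part 2) = Suc (card X - card F0) choose 2"
proof -
  define c where "c = card X - card F0"
  have c0: "c > 0" using c by (simp add: c_def)
  then obtain c' where c': "c = Suc c'" by (cases c) auto
  have bc: "b c = 0" unfolding c' by (rule betti_eq_0[OF F0]) (use c' c in \<open>simp add: c_def\<close>)
  define s where "s k = int (card {u \<in> monomials X. mdeg u = k})" for k
  define t where "t k = int (card {u. keys u \<in> Collect (clique X adj) \<and> mdeg u = k})" for k
  \<comment> \<open>The numerator of the Hilbert series of \<open>I\<close>: the \<open>i\<close>-th
    module is generated in degree \<open>i + 2\<close>. Since \<open>b c = 0\<close>, the sum stops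
    at \<open>i = c - 1\<close>, which bounds the degree by \<open>c + 1\<close>.\<close>
  define q where "q = (\<Sum>i<c. monom ((-1) ^ i * int (b i)) (i + 2))"
  have cl: "C \<subseteq> X \<and> card C \<le> card F0" if "clique X adj C" for C
  proof -
    obtain F where F: "facet F" "C \<subseteq> F" using facet_ex[OF \<open>clique X adj C\<close>] by blast
    then show ?thesis using card_facet[OF F0 F(1)] card_mono[OF facet_finite[OF F(1)] F(2)] that
      by (simp add: clique_def)
  qed
  have st: "card {u \<in> monomials X. mdeg u + (2 + i) = k} = (if k < i + 2 then 0 else nat (s (k - (i + 2))))"
    for i k
  proof (cases "k < i + 2")
    case False
    then have "{u \<in> monomials X. mdeg u + (2 + i) = k} = {u \<in> monomials X. mdeg u = k - (i + 2)}" by auto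
    then show ?thesis using False by (simp add: s_def)
  next
    case True
    then have "{u \<in> monomials X. mdeg u + (2 + i) = k} = {}" by auto
    then show ?thesis using True by (simp only: card.empty if_True)
  qed
  have dim: "int (pv.dim (homog_part k)) = fps_nth (fps_of_poly q * Abs_fps s) k" for k
  proof -
    have "fps_nth (fps_of_poly q * Abs_fps s) k
      = (\<Sum>i<c. (-1) ^ i * int (b i) * (if k < i + 2 then 0 else s (k - (i + 2))))"
      unfolding q_def fps_of_poly_sum sum_distrib_right fps_sum_nth fps_monom_mult_nth fps_nth_Abs_fps by simp
    also have "\<dots> = (\<Sum>i<c. (-1) ^ i * int (b i * card {u \<in> monomials X. mdeg u + (2 + i) = k}))"
      unfolding st by (rule sum.cong) (auto simp: s_def)
    finally show ?thesis using dim_homog_part_betti[OF bc, of k] by simp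
  qed
  have "Abs_fps t = Abs_fps s - fps_of_poly q * Abs_fps s"
  proof (rule fps_ext)
    fix k
    have "{u. keys u \<in> Collect (clique X adj) \<and> mdeg u = k}
      = {u \<in> monomials X. mdeg u = k \<and> clique X adj (keys u)}"
      by (auto simp: monomials_def clique_def)
    then have "int (pv.dim (homog_part k)) + t k = s k"
      using dim_homog_part[of k] by (simp add: t_def s_def)
    then show "fps_nth (Abs_fps t) k = fps_nth (Abs_fps s - fps_of_poly q * Abs_fps s) k" by (simp add: dim)
  qed
  then have t_eq: "Abs_fps t = (1 - fps_of_poly q) * Abs_fps s" by (simp add: algebra_simps)
  define h where "h = (\<Sum>C\<in>Collect (clique X adj). monom 1 (card C) * [:1, -1:] ^ (card F0 - card C) :: int poly)"
  have X1: "fps_of_poly [:1, -1:] = (1 - fps_X :: int fps)"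
    by (simp add: fps_of_poly_pCons)
  have "fps_of_poly h = (1 - fps_X) ^ card F0 * Abs_fps t"
    unfolding t_def by (subst fps_monomials_family[OF fin])
      (use cl in \<open>auto simp: h_def fps_of_poly_sum fps_of_poly_mult fps_of_poly_power X1 fps_of_poly_monom\<close>)
  then have "fps_of_poly ([:1, -1:] ^ c * h) = (1 - fps_X) ^ (c + card F0) * Abs_fps t"
    by (simp add: fps_of_poly_mult fps_of_poly_power X1 power_add mult.assoc)
  also have "c + card F0 = card X" using c by (simp add: c_def)
  also have "(1 - fps_X) ^ card X * Abs_fps t
      = (1 - fps_of_poly q) * ((1 - fps_X) ^ card X * Abs_fps s)" by (simp add: t_eq ac_simps)
  also have "\<dots> = fps_of_poly (1 - q)"
    unfolding s_def fps_all_monomials[OF fin] by (simp add: fps_of_poly_diff)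
  finally have "[:1, -1:] ^ c * h = 1 - q" by (simp add: fps_of_poly_eq_iff)
  moreover have "degree q \<le> Suc c" unfolding q_def
    by (rule degree_sum_le) (auto intro: order_trans[OF degree_monom_le])
  moreover have "coeff q 0 = 0" "coeff q 1 = 0" by (simp_all add: q_def coeff_sum)
  ultimately have "coeff q 2 = int (Suc c choose 2)" using c0 by (rule linear_h_polynomial)
  \<comment> \<open>\<open>q\<close> starts in degree two and the Hilbert series of \<open>S\<close>
    has constant term one.\<close>
  moreover have "int (pv.dim (homog_part 2)) = coeff q 2"
  proof -
    have "{u \<in> monomials X. mdeg u = 0} = {0}" by auto
    then have "s 0 = 1" by (simp add: s_def)
    then show ?thesis using dim[of 2] \<open>coeff q 0 = 0\<close> \<open>coeff q 1 = 0\<close>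
      by (simp add: fps_mult_nth numeral_2_eq_2)
  qed
  ultimately show ?thesis by (simp add: c_def)
qed

end

section \<open>Minimal numbers of generators\<close>

lemma subspace_homogeneous: "pv.subspace {f. homogeneous e f}"
proof -
  have "homogeneous e (p + q)" if "homogeneous e p" "homogeneous e q" for p q :: "('v, 'k::field) pol"
    using that Poly_Mapping.keys_add[of p q] unfolding homogeneous_def by blast
  moreover have "homogeneous e (pscale c p)" if "homogeneous e p" for c and p :: "('v, 'k::field) pol"
    using that keys_pscale[of c p] unfolding homogeneous_def by blast
  moreover have "homogeneous e (0 :: ('v, 'k::field) pol)" by (simp add: homogeneous_def)
  ultimately show ?thesis unfolding pv.subspace_def by blast
qed

lemma keys_deg_ge_ideal:
  "ideal {f :: ('v, 'k::field) pol. f \<in> carrier (poly_ring X) \<and> (\<forall>u\<in>keys f. 2 \<le> mdeg u)} (poly_ring X)"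
proof (rule ideal_poly_ringI)
  fix p q :: "('v, 'k) pol"
  assume p: "p \<in> {f. f \<in> carrier (poly_ring X) \<and> (\<forall>u\<in>keys f. 2 \<le> mdeg u)}"
  show "p + q \<in> {f. f \<in> carrier (poly_ring X) \<and> (\<forall>u\<in>keys f. 2 \<le> mdeg u)}"
    if "q \<in> {f. f \<in> carrier (poly_ring X) \<and> (\<forall>u\<in>keys f. 2 \<le> mdeg u)}"
    using p that Poly_Mapping.keys_add[of p q] by (auto intro: carrier_poly_ring_closed)
  show "q * p \<in> {f. f \<in> carrier (poly_ring X) \<and> (\<forall>u\<in>keys f. 2 \<le> mdeg u)}"
    if "q \<in> carrier (poly_ring X)"
    using p that keys_mult[of q p] by (fastforce intro: carrier_poly_ring_closed)
qed (auto simp: in_carrier_poly_ring)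

text \<open>In degree two only the constant terms of the coefficients of a combination of the generators
  matter.\<close>

lemma degree_2_part_span:
  fixes C :: "('v, 'k::field) pol set"
  assumes C: "C \<subseteq> carrier (poly_ring X)" "\<And>c. c \<in> C \<Longrightarrow> \<exists>e. homogeneous e c"
    and ge: "\<And>c u. c \<in> C \<Longrightarrow> u \<in> keys c \<Longrightarrow> 2 \<le> mdeg u"
  shows "{f \<in> Idl\<^bsub>poly_ring X\<^esub> C. homogeneous 2 f} = pv.span {c \<in> C. homogeneous 2 c}"
proof
  let ?S = "pv.span {c \<in> C. homogeneous 2 c}"
  define P where "P = (mon_filter (\<lambda>u :: 'v mon. mdeg u = 2) :: ('v, 'k) pol \<Rightarrow> ('v, 'k) pol)"
  \<comment> \<open>The lower bound on the degrees is part of \<open>T\<close> because closure under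
    multiplication depends on it.\<close>
  define T where "T = {f :: ('v, 'k) pol. f \<in> carrier (poly_ring X) \<and> (\<forall>u\<in>keys f. 2 \<le> mdeg u) \<and> P f \<in> ?S}"
  have Padd: "P (p + q) = P p + P q" and Pscale: "P (pscale c p) = pscale c (P p)" for p q c
    by (rule poly_mapping_eqI; simp add: P_def lookup_mon_filter lookup_add)+
  have "ideal T (poly_ring X)"
  proof (rule ideal_poly_ringI)
    show "0 \<in> T" by (auto simp: T_def P_def mon_filter_def in_carrier_poly_ring pv.span_zero)
    show "p + q \<in> T" if "p \<in> T" "q \<in> T" for p q
      using that Poly_Mapping.keys_add[of p q]
      by (auto simp: T_def Padd pv.span_add intro: carrier_poly_ring_closed)
    show "q * p \<in> T" if p: "p \<in> T" and q: "q \<in> carrier (poly_ring X)" for p q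
    proof -
      \<comment> \<open>Without its constant term, \<open>q\<close> lifts every monomial of
        \<open>p\<close> above degree two and so contributes nothing to the part in degree
        two.\<close>
      define q' where "q' = q - single 0 (lookup q 0)"
      have q'0: "lookup q' 0 = 0" by (simp add: q'_def lookup_minus)
      have "P (q' * p) = 0"
      proof (rule poly_mapping_eqI, rule ccontr)
        fix u assume "lookup (P (q' * p)) u \<noteq> lookup 0 u"
        then have u: "mdeg u = 2" "u \<in> keys (q' * p)"
          by (auto simp: P_def lookup_mon_filter in_keys_iff split: if_splits)
        then obtain c d where cd: "u = c + d" "c \<in> keys q'" "d \<in> keys p" using keys_mult by blast
        have "c \<noteq> 0" using cd(2) q'0 by (auto simp: in_keys_iff)
        then have "0 < mdeg c" using mdeg_eq_0_iff[of c] by (intro gr0I) blast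
        moreover have "2 \<le> mdeg d" using p cd(3) by (simp add: T_def)
        ultimately show False using u(1) cd(1) by simp
      qed
      moreover have "q * p = pscale (lookup q 0) p + q' * p"
        by (simp add: q'_def pscale_def left_diff_distrib)
      ultimately have "P (q * p) = pscale (lookup q 0) (P p)" by (simp add: Padd Pscale)
      then have "P (q * p) \<in> ?S" using p by (simp add: T_def pv.span_scale)
      moreover have "q * p \<in> {f. f \<in> carrier (poly_ring X) \<and> (\<forall>u\<in>keys f. 2 \<le> mdeg u)}"
        by (rule ideal_poly_ringD(4)[OF keys_deg_ge_ideal _ q]) (use p in \<open>simp add: T_def\<close>)
      ultimately show ?thesis by (simp add: T_def)
    qed
  qed (auto simp: T_def)
  moreover have "C \<subseteq> T"
  proof
    fix c assume c: "c \<in> C"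
    have "P c \<in> ?S"
    proof (cases "homogeneous 2 c")
      case True
      then have "P c = c" by (auto simp: P_def homogeneous_def intro: mon_filter_id)
      then show ?thesis using True c by (auto intro: pv.span_base)
    next
      case False
      obtain e where e: "homogeneous e c" using C(2) c by blast
      then have "e \<noteq> 2" using False by blast
      then have "P c = 0" using e
        by (intro poly_mapping_eqI) (auto simp: P_def lookup_mon_filter homogeneous_def in_keys_iff)
      then show ?thesis by (simp add: pv.span_zero)
    qed
    then show "c \<in> T" using c C(1) ge by (auto simp: T_def)
  qed
  ultimately have T: "Idl\<^bsub>poly_ring X\<^esub> C \<subseteq> T" by (rule Idl_minimal)
  show "{f \<in> Idl\<^bsub>poly_ring X\<^esub> C. homogeneous 2 f} \<subseteq> ?S"
  proof safe
    fix f assume f: "f \<in> Idl\<^bsub>poly_ring X\<^esub> C" "homogeneous 2 f"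
    have "P f = f" using f(2) by (auto simp: P_def homogeneous_def intro: mon_filter_id)
    then show "f \<in> ?S" using f(1) T by (auto simp: T_def)
  qed
  show "?S \<subseteq> {f \<in> Idl\<^bsub>poly_ring X\<^esub> C. homogeneous 2 f}"
  proof -
    have "?S \<subseteq> Idl\<^bsub>poly_ring X\<^esub> C"
      by (rule pv.span_minimal[OF _ ideal_subspace[OF ideal_Idl[OF C(1)]]])
        (use Idl_superset[OF C(1)] in auto)
    moreover have "?S \<subseteq> {f. homogeneous 2 f}"
      by (rule pv.span_minimal[OF _ subspace_homogeneous]) auto
    ultimately show ?thesis by auto
  qed
qed

text \<open>The quadrics in \<open>B\<close> span the degree two part, which contains
  \<open>A\<close>, so by minimality they are all of \<open>B\<close>. A linear dependence would
  make one of them redundant; hence \<open>B\<close> is a basis of this part, and its size is the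
  same for every choice of \<open>B\<close>, as the definite description in \<open>mu\<close>
  requires.\<close>

lemma minimal_generators_quadrics:
  fixes A B :: "('v, 'k::field) pol set"
  assumes A: "A \<subseteq> carrier (poly_ring X)" "\<And>a. a \<in> A \<Longrightarrow> homogeneous 2 a"
    and B: "\<And>c. c \<in> B \<Longrightarrow> \<exists>e. homogeneous e c"
      "minimal_generators (poly_ring X) B (Idl\<^bsub>poly_ring X\<^esub> A)"
  shows "card B = pv.dim {f \<in> Idl\<^bsub>poly_ring X\<^esub> A. homogeneous 2 f}"
proof -
  let ?L = "Idl\<^bsub>poly_ring X\<^esub> A"
  note mg = B(2)[unfolded minimal_generators_def]
  have Bc: "B \<subseteq> carrier (poly_ring X)" using mg by (elim conjE)
  have LB: "?L = Idl\<^bsub>poly_ring X\<^esub> B" using mg by (elim conjE)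
  have minimal: "Idl\<^bsub>poly_ring X\<^esub> C \<noteq> ?L" if "C \<subset> B" for C
    using mg that by (elim conjE) (rule mp, erule spec)
  have "?L \<subseteq> {f. f \<in> carrier (poly_ring X) \<and> (\<forall>u\<in>keys f. 2 \<le> mdeg u)}"
    by (rule Idl_minimal[OF keys_deg_ge_ideal]) (use A in \<open>auto simp: homogeneous_def\<close>)
  moreover have "B \<subseteq> ?L" unfolding LB by (rule Idl_superset[OF Bc])
  ultimately have ge: "2 \<le> mdeg u" if "c \<in> B" "u \<in> keys c" for c u using that by blast
  define B2 where "B2 = {c \<in> B. homogeneous 2 c}"
  have B2c: "B2 \<subseteq> carrier (poly_ring X)" using Bc by (auto simp: B2_def)
  have L2: "{f \<in> ?L. homogeneous 2 f} = pv.span B2"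
    unfolding LB B2_def by (rule degree_2_part_span[OF Bc B(1) ge])
  have span_Idl: "pv.span C \<subseteq> Idl\<^bsub>poly_ring X\<^esub> C" if "C \<subseteq> B" for C
    by (rule pv.span_minimal[OF Idl_superset ideal_subspace[OF ideal_Idl]]) (use that Bc in auto)
  have "A \<subseteq> Idl\<^bsub>poly_ring X\<^esub> B2"
    using Idl_superset[OF A(1)] A(2) L2 span_Idl[of B2] by (auto simp: B2_def)
  then have "?L \<subseteq> Idl\<^bsub>poly_ring X\<^esub> B2" by (rule Idl_minimal[OF ideal_Idl[OF B2c]])
  moreover have "Idl\<^bsub>poly_ring X\<^esub> B2 \<subseteq> ?L"
    by (rule Idl_minimal[OF ideal_Idl[OF A(1)]]) (use \<open>B \<subseteq> ?L\<close> in \<open>auto simp: B2_def\<close>)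
  ultimately have B2: "B2 = B" using minimal[of B2] by (auto simp: B2_def)
  have "pv.independent B"
    unfolding pv.dependent_def
  proof
    assume "\<exists>x\<in>B. x \<in> pv.span (B - {x})"
    then obtain x where x: "x \<in> B" "x \<in> pv.span (B - {x})" by blast
    have c: "B - {x} \<subseteq> carrier (poly_ring X)" using Bc by blast
    have "B \<subseteq> Idl\<^bsub>poly_ring X\<^esub> (B - {x})"
      using Idl_superset[OF c] span_Idl[of "B - {x}"] x(2) by auto
    then have "?L \<subseteq> Idl\<^bsub>poly_ring X\<^esub> (B - {x})" unfolding LB by (rule Idl_minimal[OF ideal_Idl[OF c]])
    moreover have "Idl\<^bsub>poly_ring X\<^esub> (B - {x}) \<subseteq> ?L"
      by (rule Idl_minimal[OF ideal_Idl[OF A(1)]]) (use \<open>B \<subseteq> ?L\<close> in auto)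
    ultimately show False using minimal[of "B - {x}"] x(1) by blast
  qed
  then show ?thesis
    using pv.dim_span_eq_card_independent[of B] L2 B2 by simp
qed

lemma mu_eq_card:
  fixes A :: "('v, 'k::field) pol set"
  assumes A: "finite A" "A \<subseteq> carrier (poly_ring X)" "\<And>a. a \<in> A \<Longrightarrow> homogeneous 2 a"
    and m: "minimal_generators (poly_ring X) A (Idl\<^bsub>poly_ring X\<^esub> A)"
  shows "mu X (Idl\<^bsub>poly_ring X\<^esub> A) = card A"
  unfolding mu_def
proof (rule the_equality)
  show "\<exists>B. finite B \<and> (\<forall>b\<in>B. \<exists>e. homogeneous e b) \<and>
      minimal_generators (poly_ring X) B (Idl\<^bsub>poly_ring X\<^esub> A) \<and> card B = card A"
    using A m by blast
next
  fix k
  assume "\<exists>B. finite B \<and> (\<forall>b\<in>B. \<exists>e. homogeneous e b) \<and>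
      minimal_generators (poly_ring X) B (Idl\<^bsub>poly_ring X\<^esub> A) \<and> card B = k"
  then obtain B where B: "\<And>b. b \<in> B \<Longrightarrow> \<exists>e. homogeneous e b"
    "minimal_generators (poly_ring X) B (Idl\<^bsub>poly_ring X\<^esub> A)" "card B = k" by blast
  have "card A = pv.dim {f \<in> Idl\<^bsub>poly_ring X\<^esub> A. homogeneous 2 f}"
    by (rule minimal_generators_quadrics[OF A(2,3) _ m]) (use A(3) in auto)
  then show "k = card A"
    using minimal_generators_quadrics[OF A(2,3) B(1,2)] B(3) by simp
qed

text \<open>In degree two a proper subset generates only its own span, which misses an element of
  the independent set.\<close>

lemma independent_minimal_generators:
  fixes A :: "('v, 'k::field) pol set"
  assumes A: "A \<subseteq> carrier (poly_ring X)" "\<And>a. a \<in> A \<Longrightarrow> homogeneous 2 a" "pv.independent A"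
  shows "minimal_generators (poly_ring X) A (Idl\<^bsub>poly_ring X\<^esub> A)"
  unfolding minimal_generators_def
proof (intro conjI allI impI notI refl A(1))
  fix C assume C: "C \<subset> A" and e: "Idl\<^bsub>poly_ring X\<^esub> C = Idl\<^bsub>poly_ring X\<^esub> A"
  have "C \<subseteq> carrier (poly_ring X)" "\<And>c. c \<in> C \<Longrightarrow> homogeneous 2 c" using A C by auto
  then have "{f \<in> Idl\<^bsub>poly_ring X\<^esub> C. homogeneous 2 f} = pv.span {c \<in> C. homogeneous 2 c}"
    by (intro degree_2_part_span) (auto simp: homogeneous_def)
  moreover obtain x where x: "x \<in> A" "x \<notin> C" using C by blast
  moreover have "x \<in> {f \<in> Idl\<^bsub>poly_ring X\<^esub> C. homogeneous 2 f}"
    using x(1) A(2) Idl_superset[OF A(1)] by (auto simp: e)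
  moreover have "pv.span {c \<in> C. homogeneous 2 c} \<subseteq> pv.span (A - {x})"
    by (rule pv.span_mono) (use C x in auto)
  ultimately show False using A(3) x(1) by (auto simp: pv.dependent_def)
qed

section \<open>The ideal of minors\<close>

definition minor_pairs :: "nat \<Rightarrow> (nat \<times> nat) set" where
  "minor_pairs n = {(i, j). 1 \<le> i \<and> i < j \<and> j \<le> n}"

lemma card_minor_pairs: "finite (minor_pairs n) \<and> card (minor_pairs n) = n choose 2"
proof (induction n)
  case 0
  have "minor_pairs 0 = {}" by (auto simp: minor_pairs_def)
  then show ?case by (simp add: numeral_2_eq_2)
next
  case (Suc n)
  have "minor_pairs (Suc n) = minor_pairs n \<union> (\<lambda>i. (i, Suc n)) ` {1..n}"
    by (auto simp: minor_pairs_def le_Suc_eq)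
  moreover have "minor_pairs n \<inter> (\<lambda>i. (i, Suc n)) ` {1..n} = {}" by (auto simp: minor_pairs_def)
  moreover have "card ((\<lambda>i. (i, Suc n)) ` {1..n}) = n" by (subst card_image) (auto simp: inj_on_def)
  ultimately show ?case using Suc by (simp add: card_Un_disjoint numeral_2_eq_2)
qed

text \<open>The coefficient of \<open>x_i y_j\<close> with \<open>i < j\<close> detects the minor of
  the pair \<open>(i, j)\<close>, since the second monomial of any minor has the larger index on
  \<open>x\<close>. So the minors are linearly independent quadrics.\<close>

lemma mu_minors_ideal: "mu (xy_vars n) (minors_ideal n :: (nat + nat, 'k::field) pol set) = n choose 2"
proof -
  define f where "f = (\<lambda>(i, j). var (Inl i) * var (Inr j) - var (Inl j) * var (Inr i) :: (nat + nat, 'k) pol)"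
  define A where "A = f ` minor_pairs n"
  have L: "minors_ideal n = Idl\<^bsub>poly_ring (xy_vars n)\<^esub> A"
    unfolding minors_ideal_def A_def f_def minor_pairs_def by (rule arg_cong[where f = "genideal _"]) auto
  have f: "f (i, j) = mono_pol (single (Inl i) 1 + single (Inr j) 1) - mono_pol (single (Inl j) 1 + single (Inr i) 1)"
    for i j by (simp add: f_def var_def mono_pol_mult)
  have k: "keys (f (i, j)) \<subseteq> {single (Inl i) 1 + single (Inr j) 1, single (Inl j) 1 + single (Inr i) 1}" for i j
    unfolding f by (rule order_trans[OF keys_diff]) simp
  have c: "A \<subseteq> carrier (poly_ring (xy_vars n))"
    unfolding A_def f_def
    by (auto simp: minor_pairs_def xy_vars_def var_def intro!: carrier_poly_ring_closed)
  have h: "homogeneous 2 a" if "a \<in> A" for a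
    using that k by (fastforce simp: A_def homogeneous_def)
  have ind: "inj_on f (minor_pairs n)" "pv.independent (f ` minor_pairs n)"
  proof -
    define L where "L = (\<lambda>(i, j) (p :: (nat + nat, 'k) pol). lookup p (single (Inl i) 1 + single (Inr j) 1))"
    have "L x (f y) = (if x = y then 1 else 0)" if "x \<in> minor_pairs n" "y \<in> minor_pairs n" for x y
      using that by (cases x; cases y)
        (auto simp: L_def f lookup_minus lookup_mono_pol single_pair_eq_iff minor_pairs_def simp del: One_nat_def)
    moreover have "L x (p + q) = L x p + L x q" "L x (pscale c p) = c * L x p" for x p q c
      by (cases x; simp add: L_def lookup_add)+
    ultimately show "inj_on f (minor_pairs n)" "pv.independent (f ` minor_pairs n)"
      by (intro pv.independent_functionals[where L = L]; simp)+
  qed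
  have "mu (xy_vars n) (Idl\<^bsub>poly_ring (xy_vars n)\<^esub> A) = card A"
    by (rule mu_eq_card[OF _ c h independent_minimal_generators[OF c h]])
      (use ind card_minor_pairs in \<open>auto simp: A_def\<close>)
  also have "card A = n choose 2" using ind card_minor_pairs by (simp add: A_def card_image)
  finally show ?thesis by (simp add: L)
qed

theorem theorem2p3:
  fixes X :: "'v set" and I :: "('v, 'k::field) pol set" and B :: "('v, 'k) pol set"
  assumes "finite X"
    and "minimal_generators (poly_ring X) B I"
    and "finite B" and "2 \<le> card B"
    and "\<forall>b\<in>B. quadratic_binomial X b"
    and "primeideal I (poly_ring X)"
    and "\<exists>r. monomial_order X r \<and>
           (\<exists>M. M \<subseteq> {u \<in> monomials X. mdeg u = 2 \<and> squarefree_monomial u} \<and>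
                initial_ideal X r I = Idl\<^bsub>poly_ring X\<^esub> (mono_pol ` M))"
    and "linear_resolution X 2 I"
  shows "\<exists>n\<ge>3. mu X I = mu (xy_vars n) (minors_ideal n :: (nat + nat, 'k) pol set) \<and>
           mu (xy_vars n) (minors_ideal n :: (nat + nat, 'k) pol set) = n choose 2"
proof -
  have Bc: "B \<subseteq> carrier (poly_ring X)" and IB: "I = Idl\<^bsub>poly_ring X\<^esub> B"
    using assms(2) unfolding minimal_generators_def by blast+
  obtain r M where rM: "monomial_order X r" "M \<subseteq> {u \<in> monomials X. mdeg u = 2 \<and> squarefree_monomial u}"
    "initial_ideal X r I = Idl\<^bsub>poly_ring X\<^esub> (mono_pol ` M)" using assms(7) by blast
  interpret toric_squarefree X I B r M
    by (intro toric_squarefree.intro prime_binomial_ideal.intro toric_squarefree_axioms.intro assms Bc IB rM)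
  obtain b d g phi where res: "minimal_graded_free_resolution X I b d g phi" "\<forall>i. \<forall>j<b i. d i j = 2 + i"
    using assms(8) unfolding linear_resolution_def by blast
  have gfr: "graded_free_resolution X I b d g phi"
    using res(1) by (simp add: minimal_graded_free_resolution_def)
  note gfr' = gfr[unfolded graded_free_resolution_def]
  \<comment> \<open>Consecutive shifts differ by one, which turns homogeneity of the matrix entries
    into linearity.\<close>
  interpret linear_res X I B r M b g phi
  proof
    show "g j \<in> carrier (poly_ring X)" "homogeneous 2 (g j)" if "j < b 0" for j
      using gfr' res(2) that by auto
    show "phi i j k \<in> carrier (poly_ring X)" if "j < b i" "k < b (Suc i)" for i j k
      using gfr' that by blast
    show "mdeg u = 1" if "j < b i" "k < b (Suc i)" "u \<in> keys (phi i j k)" for i j k u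
    proof -
      have "mdeg u + d i j = d (Suc i) k" using gfr' that by blast
      then show ?thesis using res(2) that by simp
    qed
  qed (use gfr' in blast)+
  have hom: "homogeneous 2 c" if c: "c \<in> B" for c
  proof -
    obtain u v where "mdeg u = 2" "mdeg v = 2" "c = mono_pol u - mono_pol v"
      using assms(5) c unfolding quadratic_binomial_def by blast
    then show ?thesis using keys_diff[of "mono_pol u :: ('v, 'k) pol" "mono_pol v"]
      by (auto simp: homogeneous_def)
  qed
  have m: "minimal_generators (poly_ring X) B (Idl\<^bsub>poly_ring X\<^esub> B)" using assms(2) IB by simp
  have muB: "mu X I = card B" unfolding IB by (rule mu_eq_card[OF assms(3) Bc hom m])
  have dimB: "card B = pv.dim (homog_part 2)"
    unfolding homog_part_def by (subst IB, rule minimal_generators_quadrics[OF Bc hom _ m]) (use hom in auto)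
  obtain F0 where F0: "facet F0" using facet_ex[of "{}"] by (auto simp: clique_def)
  have F0X: "F0 \<subseteq> X" using facet_clique[OF F0] by (simp add: clique_def)
  \<comment> \<open>If one facet contained all variables, every monomial would be standard and
    \<open>I\<close> would contain no nonzero quadric.\<close>
  have "card F0 < card X"
  proof (rule ccontr)
    assume "\<not> ?thesis"
    then have "F0 = X" using card_seteq[OF fin F0X] by simp
    then have "clique X adj (keys u)" if "u \<in> monomials X" for u
      using clique_subset[OF facet_clique[OF F0]] that by (simp add: monomials_def)
    then have "{u \<in> monomials X. mdeg u = 2 \<and> clique X adj (keys u)} = {u \<in> monomials X. mdeg u = 2}"
      by blast
    then have "pv.dim (homog_part 2) = 0" using dim_homog_part[of 2] by simp
    then show False using dimB assms(4) by simp
  qed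
  then have card: "card B = Suc (card X - card F0) choose 2" using dim_quadrics[OF F0] dimB by simp
  \<comment> \<open>One more than the codimension of \<open>I\<close>. For \<open>n \<le> 2\<close>
    the binomial coefficient would be at most one, but there are at least two generators.\<close>
  define n where "n = Suc (card X - card F0)"
  have "n \<ge> 3"
  proof (rule ccontr)
    assume "\<not> n \<ge> 3"
    then have "n choose 2 \<le> 2 choose 2" by (intro binomial_right_mono) simp
    then show False using card assms(4) by (simp add: n_def)
  qed
  then show ?thesis using muB card mu_minors_ideal[of n, where ?'k = 'k]
    by (intro exI[of _ n]) (simp add: n_def)
qed

end
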